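(* Let $V,W,U$ be finite-dimensional real vector spaces, $\mathbf X\in\mathscr C^p_\omega([0,T],V)$, $\overline H\in\mathscr D_{\mathbf X}(\mathcal L(V,W))$, $I:=\int\overline H\,\mathrm d\mathbf X$, let $\overline I:=\overline{\int}\overline H\,\mathrm d\mathbf X\in\mathscr D_{\mathbf X}(W)$ and $\mathbf I:=\uparrow_{\mathbf X}\overline I\in\mathscr C^p_\omega([0,T],W)$ be the canonical controlled path and rough path above $I$, and let $\overline K\in\mathscr D_{\mathbf I}(\mathcal L(W,U))$. Then $$\Big(\overline{\int}\overline K\,\mathrm d\mathbf I\Big)*\overline I=\overline{\int}(\overline K*\overline I)\cdot\overline H\,\mathrm d\mathbf X\quad\text{in }\mathscr D_{\mathbf X}(U),$$ and therefore $$\boldsymbol{\int}\overline K\,\mathrm d\mathbf I=\boldsymbol{\int}(\overline K*\overline I)\cdot\overline H\,\mathrm d\mathbf X\quad\text{in }\mathscr C^p_\omega([0,T],U).$$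
   Context: All vector spaces are finite-dimensional and real; $T^N(V)=\bigoplus_{n=0}^N V^{\otimes n}$, with $a^n$ the component of $a$ in $V^{\otimes n}$. $T>0$, $p\ge1$, $\Delta_T=\{(s,t):0\le s\le t\le T\}$. A control is a continuous $\omega:\Delta_T\to[0,\infty)$ with $\omega(t,t)=0$ and $\omega(s,u)+\omega(u,t)\le\omega(s,t)$ for $s\le u\le t$. For a path $Y$, $Y_{st}:=Y_t-Y_s$; $\mathcal C^p_\omega([0,T],E)$ is the set of continuous $E$-valued paths with $|Y_{st}|\le C\omega(s,t)^{1/p}$ for some $C$. We write $a_{st}\approx_m b_{st}$ if $a_{st}-b_{st}=O(\omega(s,t)^{m/p})$, i.e. $|a_{st}-b_{st}|\le C\omega(s,t)^{m/p}$ for a constant $C$; $\approx$ means $\approx_{\lfloor p\rfloor+1}$. Shuffles: $\mathrm{Sh}(n_1,\ldots,n_m)$ is the set of permutations $\sigma$ of $\{1,\ldots,n_1+\cdots+n_m\}$ increasing on each of the consecutive blocks of sizes $n_1,\ldots,n_m$; $\overline{\mathrm{Sh}}(n_1,\ldots,n_m)$ (for $n_i\ge1$) is the subset of those with also $\sigma(n_1)<\sigma(n_1+n_2)<\cdots<\sigma(n_1+\cdots+n_m)$. For $n=n_1+\cdots+n_m$ define on $V^{\otimes n}$ $$\widetilde\Delta^{n_1,\ldots,n_m}_{\mathrm{osh}}(v_1\otimes\cdots\otimes v_n)=\sum_{\sigma\in\overline{\mathrm{Sh}}(n_1,\ldots,n_m)}(v_{\sigma(1)}\otimes\cdots\otimes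 v_{\sigma(n_1)})\boxtimes\cdots\boxtimes(v_{\sigma(n-n_m+1)}\otimes\cdots\otimes v_{\sigma(n)}),$$ and $\Delta^{a,b}_{\mathrm{sh}}$ on $V^{\otimes(a+b)}$ by the same formula with $\mathrm{Sh}(a,b)$ ($a,b\ge0$); $\boxtimes$ is the external tensor product. Rough paths: $\mathbf X\in\mathscr C^p_\omega([0,T],V)$ is a continuous map $\mathbf X:\Delta_T\to T^{\lfloor p\rfloor}(V)$ with $\mathbf X^0=1$ and: $|\mathbf X^n_{st}|\le C\omega(s,t)^{n/p}$ for $1\le n\le\lfloor p\rfloor$; $\mathbf X_{st}=\mathbf X_{su}\otimes\mathbf X_{ut}$ truncated at degree $\lfloor p\rfloor$, $s\le u\le t$; $\mathbf X^a_{st}\boxtimes\mathbf X^b_{st}=\Delta^{a,b}_{\mathrm{sh}}\mathbf X^{a+b}_{st}$ for $a+b\le\lfloor p\rfloor$. Its trace is the path $X$ with increments $\mathbf X^1$ and a given initial value $X_0$. Controlled paths: $\overline H\in\mathscr D_{\mathbf X}(U)$ is an element of $\mathcal C^p_\omega([0,T],\mathcal L(T^{\lfloor p\rfloor-1}(V),U))$ such that, with $\overline H_n:=\overline H|_{V^{\otimes n}}$, for $n=0,\ldots,\lfloor p\rfloor-2$ and $a\in V^{\otimes n}$: $\langle\overline H_{n;t},a\rangle\approx_{\lfloor p\rfloor-n}\sum_{k=0}^{\lfloor p\rfloor-1-n}\langle\overline H_{n+k;s},\mathbf X^k_{st}\otimes a\rangle$. Its trace is $H:=\overline H_0$. Lift: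 for $\overline H\in\mathscr D_{\mathbf X}(U)$, $\uparrow_{\mathbf X}\overline H$ is the unique element of $\mathscr C^p_\omega([0,T],U)$ (it exists), with trace $H$, such that $(\uparrow_{\mathbf X}\overline H)^m_{st}\approx\sum_{n_1,\ldots,n_m\ge1,\ n_1+\cdots+n_m\le\lfloor p\rfloor}\langle\overline H_{n_1;s}\boxtimes\cdots\boxtimes\overline H_{n_m;s},\widetilde\Delta^{n_1,\ldots,n_m}_{\mathrm{osh}}\mathbf X^{n_1+\cdots+n_m}_{st}\rangle$ for $2\le m\le\lfloor p\rfloor$. Rough integral: for $\overline H\in\mathscr D_{\mathbf X}(\mathcal L(V,W))$, identify $\mathcal L(V^{\otimes(n-1)},\mathcal L(V,W))=\mathcal L(V^{\otimes n},W)$ (the last tensor slot is the argument in $V$). Then $I=\int_0^\cdot\overline H\,\mathrm d\mathbf X$ is the unique path in $\mathcal C^p_\omega([0,T],W)$ with $I_0=0$ and $I_{st}\approx\sum_{n=1}^{\lfloor p\rfloor}\langle\overline H_{n-1;s},\mathbf X^n_{st}\rangle$. The controlled integral $\overline{\int}\overline H\,\mathrm d\mathbf X\in\mathscr D_{\mathbf X}(W)$ has trace $I$ and $n$-th level $\overline H_{n-1}$ for $1\le n\le\lfloor p\rfloor-1$. The rough-path integral is $\boldsymbol{\int}\overline H\,\mathrm d\mathbf X:=\uparrow_{\mathbf X}\overline{\int}\overline H\,\mathrm d\mathbf X$. Change of controlling path: for $\overline H\in\mathscr D_{\mathbf X}(U)$, $\mathbf H=\uparrow_{\mathbf X}\overline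 H$, $\overline K\in\mathscr D_{\mathbf H}(S)$, the controlled path $\overline K*\overline H\in\mathscr D_{\mathbf X}(S)$ is given by $(\overline K*\overline H)_0=K$ and, for $1\le n\le\lfloor p\rfloor-1$, $(\overline K*\overline H)_n=\sum_{m=1}^n\sum_{n_1,\ldots,n_m\ge1,\ n_1+\cdots+n_m=n}\overline K_m\circ(\overline H_{n_1}\boxtimes\cdots\boxtimes\overline H_{n_m})\circ\widetilde\Delta^{n_1,\ldots,n_m}_{\mathrm{osh}}$. Leibniz product: for $\overline H\in\mathscr D_{\mathbf X}(\mathcal L(U_1,U_2))$, $\overline K\in\mathscr D_{\mathbf X}(\mathcal L(U_2,U_3))$, $\overline K\cdot\overline H\in\mathscr D_{\mathbf X}(\mathcal L(U_1,U_3))$ is given by $(\overline K\cdot\overline H)_n=\sum_{a+b=n,\ a,b\ge0}\times\circ(\overline K_a\boxtimes\overline H_b)\circ\Delta^{a,b}_{\mathrm{sh}}$, with $\times(k\boxtimes h)=k\circ h$. *)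

theory Defs
  imports "HOL-Analysis.Analysis"
begin

text \<open>Finite-dimensional real vector spaces are rendered as real normed vector spaces
  (all norms on such a space are equivalent) spanned by a finite set.  In contrast to the class
  \<open>euclidean_space\<close>, which is a subclass, the zero space is included.\<close>

class fin_dim_normed_vector = real_normed_vector +
  assumes fin_dim: "\<exists>B. finite B \<and> (\<forall>x. \<exists>c. x = (\<Sum>b\<in>B. c b *\<^sub>R b))"

instance euclidean_space \<subseteq> fin_dim_normed_vector
proof
  show "\<exists>B::'a set. finite B \<and> (\<forall>x. \<exists>c. x = (\<Sum>b\<in>B. c b *\<^sub>R b))"
  proof (intro exI[of _ Basis] conjI allI finite_Basis)
    show "\<exists>c. x = (\<Sum>b\<in>Basis. c b *\<^sub>R b)" for x :: 'a
      by (rule exI[of _ "inner x"]) (simp add: euclidean_representation)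
  qed
qed

text \<open>Some basis of the whole space, fixed once and for all for each type.\<close>

definition vbasis :: "'v::fin_dim_normed_vector set" where
  "vbasis = extend_basis {}"

lemma independent_vbasis: "independent vbasis"
  unfolding vbasis_def by (intro independent_extend_basis independent_empty)

lemma span_vbasis: "span vbasis = UNIV"
  unfolding vbasis_def by (intro span_extend_basis independent_empty)

lemma finite_vbasis: "finite (vbasis :: 'v::fin_dim_normed_vector set)"
proof -
  obtain B :: "'v set" where "finite B" and B: "\<forall>x. \<exists>c. x = (\<Sum>b\<in>B. c b *\<^sub>R b)"
    using fin_dim by blast
  have "x \<in> span B" for x
  proof -
    obtain c where "x = (\<Sum>b\<in>B. c b *\<^sub>R b)"
      using B by blast
    then show ?thesis
      by (auto intro: span_sum span_scale span_base)
  qed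
  then have "span B = UNIV"
    by blast
  with \<open>finite B\<close> show ?thesis
    using independent_span_bound[OF _ independent_vbasis] by blast
qed

section \<open>Tensors\<close>

text \<open>A word \<open>w = [e\<^sub>1, \<dots>, e\<^sub>n]\<close> of basis vectors stands for the basis element
  \<open>e\<^sub>w = e\<^sub>1 \<otimes> \<dots> \<otimes> e\<^sub>n\<close> of the \<open>n\<close>-th tensor power of \<open>'v\<close>.  An element of the tensor
  algebra is represented by its coordinates \<open>'v list \<Rightarrow> real\<close> in this basis, an element of
  an external tensor product of tensor powers by its coordinates \<open>'v list list \<Rightarrow> real\<close>
  with respect to the external products of basis elements.  A linear map on tensors with values
  in \<open>'u\<close> is represented by its values \<open>'v list \<Rightarrow> 'u\<close> on the basis elements; its
  restriction to the \<open>n\<close>-th tensor power is given by the values on words of length \<open>n\<close>.\<close>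

type_synonym 'v tensor = "'v list \<Rightarrow> real"
type_synonym 'v ext_tensor = "'v list list \<Rightarrow> real"

definition words :: "nat \<Rightarrow> 'v::fin_dim_normed_vector list set" where
  "words n = {w. set w \<subseteq> vbasis \<and> length w = n}"

text \<open>The \<open>n\<close>-th tensor power.\<close>

definition tensors :: "nat \<Rightarrow> 'v::fin_dim_normed_vector tensor set" where
  "tensors n = {a. \<forall>w. w \<notin> words n \<longrightarrow> a w = 0}"

definition component :: "nat \<Rightarrow> 'v::fin_dim_normed_vector tensor \<Rightarrow> 'v tensor" where
  "component n a = (\<lambda>w. if w \<in> words n then a w else 0)"

definition basis_tensor :: "'v list \<Rightarrow> 'v tensor" where
  "basis_tensor w = (\<lambda>v. if v = w then 1 else 0)"

definition tensor_prod :: "'v tensor \<Rightarrow> 'v tensor \<Rightarrow> 'v tensor" where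
  "tensor_prod a b = (\<lambda>w. \<Sum>i\<le>length w. a (take i w) * b (drop i w))"

text \<open>The coordinates of \<open>v\<^sub>1 \<otimes> \<dots> \<otimes> v\<^sub>m\<close> for arbitrary vectors.\<close>

definition pure_tensor :: "'v::fin_dim_normed_vector list \<Rightarrow> 'v tensor" where
  "pure_tensor vs = (\<lambda>w. if w \<in> words (length vs)
     then \<Prod>i<length vs. representation vbasis (vs ! i) (w ! i) else 0)"

text \<open>The pairing of the degree \<open>n\<close> parts of a linear map \<open>h\<close> and of a tensor \<open>a\<close>.\<close>

definition pairing ::
  "nat \<Rightarrow> ('v::fin_dim_normed_vector list \<Rightarrow> 'u::real_vector) \<Rightarrow> 'v tensor \<Rightarrow> 'u" where
  "pairing n h a = (\<Sum>w\<in>words n. a w *\<^sub>R h w)"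

text \<open>\<open>h\<^sub>n\<^sub>1 \<boxtimes> \<dots> \<boxtimes> h\<^sub>n\<^sub>m\<close>, for \<open>ns = [n\<^sub>1, \<dots>, n\<^sub>m]\<close>, as a map into the \<open>m\<close>-th tensor power
  of \<open>'u\<close>.\<close>

definition ext_map ::
  "nat list \<Rightarrow> ('v::fin_dim_normed_vector list \<Rightarrow> 'u::fin_dim_normed_vector)
    \<Rightarrow> 'v ext_tensor \<Rightarrow> 'u tensor" where
  "ext_map ns h t = (\<lambda>y. \<Sum>ws\<in>listset (map words ns). t ws * pure_tensor (map h ws) y)"

section \<open>Shuffles\<close>

text \<open>Positions are counted from \<open>0\<close>: block \<open>j\<close> of \<open>ns\<close> is
  \<open>{offset ns j..<offset ns (Suc j)}\<close>.\<close>

definition offset :: "nat list \<Rightarrow> nat \<Rightarrow> nat" where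
  "offset ns j = sum_list (take j ns)"

definition Sh :: "nat list \<Rightarrow> (nat \<Rightarrow> nat) set" where
  "Sh ns = {\<sigma>. \<sigma> permutes {..<sum_list ns} \<and>
     (\<forall>j<length ns. strict_mono_on {offset ns j..<offset ns (Suc j)} \<sigma>)}"

definition oSh :: "nat list \<Rightarrow> (nat \<Rightarrow> nat) set" where
  "oSh ns = {\<sigma> \<in> Sh ns. strict_mono_on {..<length ns} (\<lambda>j. \<sigma> (offset ns (Suc j) - 1))}"

definition split_shuffle :: "nat list \<Rightarrow> (nat \<Rightarrow> nat) \<Rightarrow> 'v list \<Rightarrow> 'v list list" where
  "split_shuffle ns \<sigma> w =
     map (\<lambda>j. map (\<lambda>i. w ! \<sigma> i) [offset ns j..<offset ns (Suc j)]) [0..<length ns]"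

text \<open>The linear map sending \<open>e\<^sub>w\<close>, for \<open>w\<close> of length \<open>n\<^sub>1 + \<dots> + n\<^sub>m\<close>, to the sum over \<open>\<sigma> \<in> S\<close> of the
  external products of the blocks of \<open>w \<circ> \<sigma>\<close>.\<close>

definition coshuffle ::
  "(nat \<Rightarrow> nat) set \<Rightarrow> nat list \<Rightarrow> 'v::fin_dim_normed_vector tensor \<Rightarrow> 'v ext_tensor" where
  "coshuffle S ns a = (\<lambda>ws. \<Sum>w\<in>words (sum_list ns). \<Sum>\<sigma>\<in>S.
     if split_shuffle ns \<sigma> w = ws then a w else 0)"

definition Delta_sh ::
  "nat \<Rightarrow> nat \<Rightarrow> 'v::fin_dim_normed_vector tensor \<Rightarrow> 'v ext_tensor" where
  "Delta_sh a b = coshuffle (Sh [a, b]) [a, b]"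

definition Delta_osh ::
  "nat list \<Rightarrow> 'v::fin_dim_normed_vector tensor \<Rightarrow> 'v ext_tensor" where
  "Delta_osh ns = coshuffle (oSh ns) ns"

section \<open>Rough paths\<close>

definition triangle :: "real \<Rightarrow> (real \<times> real) set" where
  "triangle T = {(s, t). 0 \<le> s \<and> s \<le> t \<and> t \<le> T}"

definition control :: "real \<Rightarrow> (real \<Rightarrow> real \<Rightarrow> real) \<Rightarrow> bool" where
  "control T \<omega> \<longleftrightarrow>
     continuous_on (triangle T) (\<lambda>(s, t). \<omega> s t) \<and>
     (\<forall>(s, t)\<in>triangle T. 0 \<le> \<omega> s t) \<and>
     (\<forall>t\<in>{0..T}. \<omega> t t = 0) \<and>
     (\<forall>s u t. 0 \<le> s \<and> s \<le> u \<and> u \<le> t \<and> t \<le> T \<longrightarrow> \<omega> s u + \<omega> u t \<le> \<omega> s t)"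

text \<open>\<open>approx T p \<omega> m a b\<close> is \<open>a\<^sub>s\<^sub>t \<approx>\<^sub>m b\<^sub>s\<^sub>t\<close>.  For tensor-valued or linear-map-valued quantities
  it is used coordinatewise, which is equivalent as there are finitely many coordinates.\<close>

definition approx ::
  "real \<Rightarrow> real \<Rightarrow> (real \<Rightarrow> real \<Rightarrow> real) \<Rightarrow> nat
    \<Rightarrow> (real \<Rightarrow> real \<Rightarrow> 'a::real_normed_vector) \<Rightarrow> (real \<Rightarrow> real \<Rightarrow> 'a) \<Rightarrow> bool" where
  "approx T p \<omega> m a b \<longleftrightarrow>
     (\<exists>C. \<forall>(s, t)\<in>triangle T. norm (a s t - b s t) \<le> C * \<omega> s t powr (real m / p))"

definition holder_path ::
  "real \<Rightarrow> real \<Rightarrow> (real \<Rightarrow> real \<Rightarrow> real) \<Rightarrow> (real \<Rightarrow> 'a::real_normed_vector) \<Rightarrow> bool" where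
  "holder_path T p \<omega> Y \<longleftrightarrow>
     continuous_on {0..T} Y \<and> approx T p \<omega> 1 (\<lambda>s t. Y t) (\<lambda>s t. Y s)"

abbreviation level :: "real \<Rightarrow> nat" where
  "level p \<equiv> nat \<lfloor>p\<rfloor>"

definition rough_path ::
  "real \<Rightarrow> real \<Rightarrow> (real \<Rightarrow> real \<Rightarrow> real)
    \<Rightarrow> (real \<Rightarrow> real \<Rightarrow> 'v::fin_dim_normed_vector tensor) \<Rightarrow> bool" where
  "rough_path T p \<omega> X \<longleftrightarrow>
     (\<forall>n\<le>level p. \<forall>w\<in>words n. continuous_on (triangle T) (\<lambda>(s, t). X s t w)) \<and>
     (\<forall>(s, t)\<in>triangle T. X s t [] = 1) \<and>
     (\<forall>n\<in>{1..level p}. \<forall>w\<in>words n. approx T p \<omega> n (\<lambda>s t. X s t w) (\<lambda>s t. 0)) \<and>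
     (\<forall>s u t. 0 \<le> s \<and> s \<le> u \<and> u \<le> t \<and> t \<le> T \<longrightarrow>
        (\<forall>n\<le>level p. \<forall>w\<in>words n. X s t w = tensor_prod (X s u) (X u t) w)) \<and>
     (\<forall>(s, t)\<in>triangle T. \<forall>a b. a + b \<le> level p \<longrightarrow>
        (\<forall>u\<in>words a. \<forall>v\<in>words b. X s t u * X s t v = Delta_sh a b (X s t) [u, v]))"

definition rough_path_eq ::
  "real \<Rightarrow> real \<Rightarrow> (real \<Rightarrow> real \<Rightarrow> 'v::fin_dim_normed_vector tensor)
    \<Rightarrow> (real \<Rightarrow> real \<Rightarrow> 'v tensor) \<Rightarrow> bool" where
  "rough_path_eq T p X Y \<longleftrightarrow>
     (\<forall>(s, t)\<in>triangle T. \<forall>n\<le>level p. \<forall>w\<in>words n. X s t w = Y s t w)"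

section \<open>Controlled paths\<close>

text \<open>The tensor algebra truncated at degree \<open>\<lfloor>p\<rfloor> - 1\<close> has the words of length less than
  \<open>level p\<close> as a basis; values of a controlled path on longer words are irrelevant.\<close>

definition controlled_path ::
  "real \<Rightarrow> real \<Rightarrow> (real \<Rightarrow> real \<Rightarrow> real)
    \<Rightarrow> (real \<Rightarrow> real \<Rightarrow> 'v::fin_dim_normed_vector tensor)
    \<Rightarrow> (real \<Rightarrow> 'v list \<Rightarrow> 'u::real_normed_vector) \<Rightarrow> bool" where
  "controlled_path T p \<omega> X H \<longleftrightarrow>
     (\<forall>n<level p. \<forall>w\<in>words n. holder_path T p \<omega> (\<lambda>t. H t w)) \<and>
     (\<forall>n. n + 2 \<le> level p \<longrightarrow> (\<forall>a\<in>tensors n.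
        approx T p \<omega> (level p - n)
          (\<lambda>s t. pairing n (H t) a)
          (\<lambda>s t. \<Sum>k=0..level p - 1 - n.
             pairing (n + k) (H s) (tensor_prod (component k (X s t)) a))))"

definition controlled_path_eq ::
  "real \<Rightarrow> real \<Rightarrow> (real \<Rightarrow> 'v::fin_dim_normed_vector list \<Rightarrow> 'u)
    \<Rightarrow> (real \<Rightarrow> 'v list \<Rightarrow> 'u) \<Rightarrow> bool" where
  "controlled_path_eq T p H K \<longleftrightarrow>
     (\<forall>t\<in>{0..T}. \<forall>n<level p. \<forall>w\<in>words n. H t w = K t w)"

text \<open>\<open>is_lift T p \<omega> X H HH\<close>: \<open>HH\<close> is the rough path lifting the controlled path \<open>H\<close> over \<open>X\<close>.
  The trace of \<open>H\<close> is \<open>\<lambda>t. H t []\<close>; it also supplies the initial value of the trace of \<open>HH\<close>,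
  which is not part of the map \<open>HH\<close>.  As \<open>HH\<close> is determined only on \<open>triangle T\<close> and on words of
  length at most \<open>level p\<close>, the lift is a relation and not a function; similarly for the rough
  integral below.\<close>

definition is_lift ::
  "real \<Rightarrow> real \<Rightarrow> (real \<Rightarrow> real \<Rightarrow> real)
    \<Rightarrow> (real \<Rightarrow> real \<Rightarrow> 'v::fin_dim_normed_vector tensor)
    \<Rightarrow> (real \<Rightarrow> 'v list \<Rightarrow> 'u::fin_dim_normed_vector)
    \<Rightarrow> (real \<Rightarrow> real \<Rightarrow> 'u tensor) \<Rightarrow> bool" where
  "is_lift T p \<omega> X H HH \<longleftrightarrow>
     rough_path T p \<omega> HH \<and>
     (\<forall>(s, t)\<in>triangle T. \<forall>y\<in>words 1. HH s t y = pure_tensor [H t [] - H s []] y) \<and>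
     (\<forall>m\<in>{2..level p}. \<forall>y\<in>words m.
        approx T p \<omega> (level p + 1)
          (\<lambda>s t. HH s t y)
          (\<lambda>s t. \<Sum>ns | length ns = m \<and> (\<forall>n\<in>set ns. 1 \<le> n) \<and> sum_list ns \<le> level p.
             ext_map ns (H s) (Delta_osh ns (X s t)) y))"

text \<open>The identification of linear maps on the \<open>(n-1)\<close>-st tensor power of \<open>'v\<close> with values in
  \<open>'v \<Rightarrow>\<^sub>L 'w\<close> with linear maps on the \<open>n\<close>-th tensor power with values in \<open>'w\<close>.\<close>

definition uncurry_last ::
  "('v::real_normed_vector list \<Rightarrow> 'v \<Rightarrow>\<^sub>L 'w::real_normed_vector) \<Rightarrow> 'v list \<Rightarrow> 'w" where
  "uncurry_last h w = blinfun_apply (h (butlast w)) (last w)"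

text \<open>\<open>is_rough_integral T p \<omega> X H I\<close>: \<open>I\<close> is the rough integral of \<open>H\<close> against \<open>X\<close>.\<close>

definition is_rough_integral ::
  "real \<Rightarrow> real \<Rightarrow> (real \<Rightarrow> real \<Rightarrow> real)
    \<Rightarrow> (real \<Rightarrow> real \<Rightarrow> 'v::fin_dim_normed_vector tensor)
    \<Rightarrow> (real \<Rightarrow> 'v list \<Rightarrow> 'v \<Rightarrow>\<^sub>L 'w::real_normed_vector) \<Rightarrow> (real \<Rightarrow> 'w) \<Rightarrow> bool" where
  "is_rough_integral T p \<omega> X H I \<longleftrightarrow>
     holder_path T p \<omega> I \<and> I 0 = 0 \<and>
     approx T p \<omega> (level p + 1)
       (\<lambda>s t. I t - I s)
       (\<lambda>s t. \<Sum>n=1..level p. pairing n (uncurry_last (H s)) (X s t))"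

text \<open>Here \<open>I\<close> is meant to be the rough integral of \<open>H\<close>.\<close>

definition controlled_integral ::
  "(real \<Rightarrow> 'v::real_normed_vector list \<Rightarrow> 'v \<Rightarrow>\<^sub>L 'w::real_normed_vector) \<Rightarrow> (real \<Rightarrow> 'w)
    \<Rightarrow> real \<Rightarrow> 'v list \<Rightarrow> 'w" where
  "controlled_integral H I t w = (if w = [] then I t else uncurry_last (H t) w)"

text \<open>The change of controlling path \<open>K * H\<close>, for \<open>K\<close> controlled by the lift of \<open>H\<close>.\<close>

definition star ::
  "(real \<Rightarrow> 'u::fin_dim_normed_vector list \<Rightarrow> 's::real_normed_vector)
    \<Rightarrow> (real \<Rightarrow> 'v::fin_dim_normed_vector list \<Rightarrow> 'u) \<Rightarrow> real \<Rightarrow> 'v list \<Rightarrow> 's" where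
  "star K H t w =
     (if w = [] then K t []
      else \<Sum>m=1..length w.
        \<Sum>ns | length ns = m \<and> (\<forall>n\<in>set ns. 1 \<le> n) \<and> sum_list ns = length w.
          pairing m (K t) (ext_map ns (H t) (Delta_osh ns (basis_tensor w))))"

definition leibniz ::
  "(real \<Rightarrow> 'v::fin_dim_normed_vector list \<Rightarrow> 'b::real_normed_vector \<Rightarrow>\<^sub>L 'c::real_normed_vector)
    \<Rightarrow> (real \<Rightarrow> 'v list \<Rightarrow> 'a::real_normed_vector \<Rightarrow>\<^sub>L 'b)
    \<Rightarrow> real \<Rightarrow> 'v list \<Rightarrow> 'a \<Rightarrow>\<^sub>L 'c" where
  "leibniz K H t w =
     (\<Sum>(a, b) | a + b = length w. \<Sum>u\<in>words a. \<Sum>v\<in>words b.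
        Delta_sh a b (basis_tensor w) [u, v] *\<^sub>R (K t u o\<^sub>L H t v))"

end

theory Submission
  imports Defs
begin

text \<open>Ordered shuffles of a word correspond to partitions of its positions into blocks ordered by
  their last positions.  The block containing the last letter comes last, and removing it leaves a
  partition of a subword; applied to the last letter, which is the argument in the slot of the
  integrand, this recursion turns the change of controlling path of the integral into the Leibniz
  product.  The identity holds in all degrees up to \<open>level p\<close>, one more than a controlled path
  records, so the two integrals have the same local expansion and the sewing argument identifies
  the traces.  Since partitions of the blocks of a partition are the same as coarser partitions
  together with a partition of each coarse block, lifting twice has the same local expansion as
  lifting once, and rough paths with the same local expansion are equal.\<close>

section \<open>Deshuffles and ordered partitions of words\<close>

text \<open>Words may repeat letters, so different sets of positions can carry the same subword.
  Deshuffles and partitions are therefore lists with multiplicity; the comparison with permutations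
  is made for the word of positions \<open>[0..<n]\<close>, where nothing repeats, and carried over
  by naturality in the letters. The values \<open>H t b\<close> on blocks are arbitrary vectors,
  whereas \<open>K t\<close> is given on words of basis vectors only; hence the multilinear
  extension \<open>multilin\<close>. The main analytic obstacle is that \<open>star K H\<close> is
  again controlled by \<open>X\<close>. It contains several factors \<open>H t d\<close> at the
  later time, each expanding into a further factor \<open>X s t\<close>, while the required
  expansion is linear in \<open>X s t\<close>. The shuffle relation makes the products linear again;
  its combinatorial counterpart is that a partition of \<open>v @ w\<close> arises from one of
  \<open>w\<close> by attaching letters of \<open>v\<close>. Cutting an expansion at degree
  \<open>M\<close> costs an error of order \<open>M + 1\<close>, which is why \<open>M\<close> and
  \<open>Suc M\<close> occur together throughout.\<close>

lemma sum_list_concat_map: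
  "(\<Sum>y\<leftarrow>concat (map g xs). f y) = (\<Sum>x\<leftarrow>xs. \<Sum>y\<leftarrow>g x. f y)"
  by (induction xs) auto

lemma sum_list_swap_map:
  fixes f :: "'a \<Rightarrow> 'b \<Rightarrow> 'c::comm_monoid_add"
  shows "(\<Sum>x\<leftarrow>xs. \<Sum>y\<leftarrow>ys. f x y) = (\<Sum>y\<leftarrow>ys. \<Sum>x\<leftarrow>xs. f x y)"
  by (induction xs) (simp_all add: sum_list_addf)

lemma sum_sum_list_swap:
  fixes f :: "'a \<Rightarrow> 'b \<Rightarrow> 'c::comm_monoid_add"
  shows "(\<Sum>x\<in>A. \<Sum>y\<leftarrow>ys. f x y) = (\<Sum>y\<leftarrow>ys. \<Sum>x\<in>A. f x y)"
  by (induction ys) (simp_all add: sum.distrib)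

lemma scaleR_sum_list_right:
  fixes f :: "'a \<Rightarrow> 'b::real_vector"
  shows "c *\<^sub>R (\<Sum>x\<leftarrow>xs. f x) = (\<Sum>x\<leftarrow>xs. c *\<^sub>R f x)"
  by (induction xs) (simp_all add: scaleR_add_right)

lemma sum_list_cong: "(\<And>x. x \<in> set xs \<Longrightarrow> f x = g x) \<Longrightarrow> (\<Sum>x\<leftarrow>xs. f x) = (\<Sum>x\<leftarrow>xs. g x)"
  by (metis map_cong)

section \<open>The deshuffle coproduct of a word\<close>

text \<open>The terms of the deshuffle coproduct. A list and not a set, because one pair of subwords
  can arise from several choices of positions.\<close>

fun splits :: "'a list \<Rightarrow> ('a list \<times> 'a list) list" where
  "splits [] = [([], [])]"
| "splits (x # xs) =
    map (\<lambda>(u, v). (x # u, v)) (splits xs) @ map (\<lambda>(u, v). (u, x # v)) (splits xs)"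

lemma length_splits: "(u, v) \<in> set (splits xs) \<Longrightarrow> length u + length v = length xs"
  by (induction xs arbitrary: u v) auto

lemma set_splits: "(u, v) \<in> set (splits xs) \<Longrightarrow> set u \<union> set v = set xs"
  by (induction xs arbitrary: u v) fastforce+

lemma splits_map: "splits (map f xs) = map (\<lambda>(u, v). (map f u, map f v)) (splits xs)"
  by (induction xs) (auto simp: split_def)

lemma sum_splits_Cons:
  "(\<Sum>(u, v)\<leftarrow>splits (x # xs). f u v) =
     (\<Sum>(u, v)\<leftarrow>splits xs. f (x # u) v) + (\<Sum>(u, v)\<leftarrow>splits xs. f u (x # v))"
  by (simp add: split_def o_def)

text \<open>Each letter chooses its side independently of the others, so the coproduct is
  multiplicative for concatenation.\<close>

lemma sum_splits_append:
  fixes f :: "'a list \<Rightarrow> 'a list \<Rightarrow> 'b::comm_monoid_add"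
  shows "(\<Sum>(x, y)\<leftarrow>splits (v @ w). f x y) =
    (\<Sum>(v1, v2)\<leftarrow>splits v. \<Sum>(w1, w2)\<leftarrow>splits w. f (v1 @ w1) (v2 @ w2))"
proof (induction v arbitrary: f)
  case Nil
  then show ?case by (simp add: split_def)
next
  case (Cons a v)
  show ?case
    unfolding append_Cons sum_splits_Cons Cons.IH by simp
qed

text \<open>\<open>splits\<close> recurses at the front of a word and \<open>parts\<close> at its
  end; this mediates between the two.\<close>

lemma sum_splits_snoc:
  fixes f :: "'a list \<Rightarrow> 'a list \<Rightarrow> 'b::comm_monoid_add"
  shows "(\<Sum>(u, v)\<leftarrow>splits (xs @ [x]). f u v) =
     (\<Sum>(u, v)\<leftarrow>splits xs. f (u @ [x]) v) + (\<Sum>(u, v)\<leftarrow>splits xs. f u (v @ [x]))"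
  unfolding sum_splits_append by (simp add: split_def sum_list_addf)

text \<open>Both sides distribute the letters over three subwords, and every letter gives the same
  three choices.\<close>

lemma splits_coassoc:
  fixes f :: "'a list \<Rightarrow> 'a list \<Rightarrow> 'a list \<Rightarrow> 'b::comm_monoid_add"
  shows "(\<Sum>(x, y)\<leftarrow>splits v. \<Sum>(x1, x2)\<leftarrow>splits x. f x1 x2 y) =
    (\<Sum>(x1, z)\<leftarrow>splits v. \<Sum>(x2, y)\<leftarrow>splits z. f x1 x2 y)"
proof (induction v arbitrary: f)
  case Nil
  then show ?case by simp
next
  case (Cons a v)
  have add: "(\<Sum>(x, y)\<leftarrow>splits v. g x y + h x y) =
     (\<Sum>(x, y)\<leftarrow>splits v. g x y) + (\<Sum>(x, y)\<leftarrow>splits v. h x y)"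
    for g h :: "'a list \<Rightarrow> 'a list \<Rightarrow> 'b"
    by (simp add: split_def sum_list_addf)
  show ?case
    unfolding sum_splits_Cons add Cons.IH by (simp only: ac_simps)
qed

lemma splits_cocomm:
  fixes f :: "'a list \<Rightarrow> 'a list \<Rightarrow> 'b::comm_monoid_add"
  shows "(\<Sum>(x, y)\<leftarrow>splits v. f x y) = (\<Sum>(x, y)\<leftarrow>splits v. f y x)"
proof (induction v arbitrary: f)
  case (Cons a v)
  show ?case
    unfolding sum_splits_Cons
    by (subst (1 2) Cons.IH) (rule add.commute)
qed simp

text \<open>The partitions of the positions of a word into nonempty blocks, ordered by their last
  positions; each block is given by the subword it carries.\<close>

function parts :: "'a list \<Rightarrow> 'a list list list" where
  "parts xs = (if xs = [] then [[]] else
     concat (map (\<lambda>(u, v). map (\<lambda>bs. bs @ [v @ [last xs]]) (parts u)) (splits (butlast xs))))"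
  by pat_completeness auto
termination
  by (relation "Wellfounded.measure length") (auto dest!: length_splits simp: less_eq_Suc_le[symmetric]
      neq_Nil_conv split: if_splits)

declare parts.simps [simp del]

lemma parts_Nil [simp]: "parts [] = [[]]"
  by (simp add: parts.simps)

lemma parts_snoc:
  "parts (xs @ [x]) =
     concat (map (\<lambda>(u, v). map (\<lambda>bs. bs @ [v @ [x]]) (parts u)) (splits xs))"
  by (subst parts.simps) simp

text \<open>Removing the last block of a partition leaves a subword and in general not a prefix, so
  the hypothesis has to cover every word that is not longer than \<open>xs\<close>.\<close>

lemma length_induct_snoc [case_names Nil snoc]:
  assumes "P []" and "\<And>x xs. (\<And>u. length u \<le> length xs \<Longrightarrow> P u) \<Longrightarrow> P (xs @ [x])"
  shows "P xs"
proof (induction xs rule: length_induct)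
  case (1 xs)
  show ?case
  proof (cases xs rule: rev_cases)
    case Nil
    then show ?thesis using assms(1) by simp
  next
    case (snoc ys y)
    then show ?thesis using assms(2) 1 by simp
  qed
qed

lemma sum_parts_snoc:
  fixes F :: "'a list list \<Rightarrow> 'b::comm_monoid_add"
  shows "(\<Sum>bs\<leftarrow>parts (xs @ [x]). F bs) = (\<Sum>(u, v)\<leftarrow>splits xs. \<Sum>bs\<leftarrow>parts u. F (bs @ [v @ [x]]))"
  unfolding parts_snoc sum_list_concat_map by (simp add: split_def o_def)

lemma sum_list_cong_splits:
  assumes "\<And>u v. length u \<le> length xs \<Longrightarrow> length v \<le> length xs \<Longrightarrow> f u v = g u v"
  shows "(\<Sum>(u, v)\<leftarrow>splits xs. f u v) = (\<Sum>(u, v)\<leftarrow>splits xs. g u v)"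
  using assms length_splits by (intro sum_list_cong) fastforce

text \<open>Partitions concern positions only. This naturality reduces words with repeated letters
  to \<open>[0..<n]\<close>.\<close>

lemma parts_map: "parts (map f xs) = map (map (map f)) (parts xs)"
proof (induction xs rule: length_induct_snoc)
  case (snoc x xs)
  have "parts (map f u) = map (map (map f)) (parts u)" if "(u, v) \<in> set (splits xs)" for u v
    using length_splits[OF that] by (intro snoc) simp
  then show ?case
    unfolding map_append list.map parts_snoc splits_map map_concat map_map
    by (auto intro!: arg_cong[of _ _ concat])
qed simp

lemma set_parts_snocE:
  assumes "bs \<in> set (parts (xs @ [x]))"
  obtains u v bs' where "(u, v) \<in> set (splits xs)" "bs' \<in> set (parts u)" "bs = bs' @ [v @ [x]]"
  using assms unfolding parts_snoc by auto

text \<open>The third fact holds because the other blocks use up at least one letter each. With two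
  or more blocks every block is therefore strictly shorter than the word, which keeps it within the
  degrees recorded by a controlled path.\<close>

lemma partsD:
  assumes "bs \<in> set (parts xs)"
  shows "length bs \<le> length xs" "[] \<notin> set bs"
    "\<And>b. b \<in> set bs \<Longrightarrow> length b + length bs \<le> Suc (length xs)"
    "(\<Union>b\<in>set bs. set b) = set xs" "bs = [] \<longleftrightarrow> xs = []"
proof -
  have "length bs \<le> length xs \<and> [] \<notin> set bs \<and>
    (\<forall>b\<in>set bs. length b + length bs \<le> Suc (length xs)) \<and>
    (\<Union>b\<in>set bs. set b) = set xs \<and> (bs = [] \<longleftrightarrow> xs = [])" (is "?P bs xs")
    using assms
  proof (induction xs arbitrary: bs rule: length_induct_snoc)
    case (snoc x xs)
    from snoc.prems obtain u v bs' where uv: "(u, v) \<in> set (splits xs)"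
      and bs': "bs' \<in> set (parts u)" and bs: "bs = bs' @ [v @ [x]]"
      by (rule set_parts_snocE)
    have l: "length u + length v = length xs" and s: "set u \<union> set v = set xs"
      using length_splits[OF uv] set_splits[OF uv] by auto
    have IH: "?P bs' u"
      using bs' l by (intro snoc.IH) auto
    show ?case
      using IH l s unfolding bs by fastforce
  qed simp
  then show "length bs \<le> length xs" "[] \<notin> set bs"
    "\<And>b. b \<in> set bs \<Longrightarrow> length b + length bs \<le> Suc (length xs)"
    "(\<Union>b\<in>set bs. set b) = set xs" "bs = [] \<longleftrightarrow> xs = []"
    by auto
qed

text \<open>The partitions of \<open>v @ w\<close> inducing the partition \<open>ds\<close> of \<open>w\<close>: the blocks inside \<open>v\<close> end
  before those meeting \<open>w\<close>, hence come first.\<close>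

function attach :: "'a list list \<Rightarrow> 'a list \<Rightarrow> 'a list list list" where
  "attach ds v = (if ds = [] then parts v else
     concat (map (\<lambda>(v1, v2). map (\<lambda>bs. bs @ [v2 @ last ds]) (attach (butlast ds) v1)) (splits v)))"
  by pat_completeness auto
termination
  by (relation "Wellfounded.measure (\<lambda>(ds, v). length ds)") auto

declare attach.simps [simp del]

lemma attach_Nil [simp]: "attach [] v = parts v"
  by (simp add: attach.simps)

lemma attach_snoc:
  "attach (ds @ [d]) v = concat (map (\<lambda>(v1, v2). map (\<lambda>bs. bs @ [v2 @ d]) (attach ds v1)) (splits v))"
  by (subst attach.simps) simp

lemma sum_attach_snoc:
  fixes F :: "'a list list \<Rightarrow> 'b::comm_monoid_add"
  shows "(\<Sum>bs\<leftarrow>attach (ds @ [d]) v. F bs) = (\<Sum>(v1, v2)\<leftarrow>splits v. \<Sum>bs\<leftarrow>attach ds v1. F (bs @ [v2 @ d]))"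
  unfolding attach_snoc sum_list_concat_map by (simp add: split_def o_def)

lemma attachD:
  assumes "bs \<in> set (attach ds v)"
  shows "length bs \<le> length v + length ds"
    "\<And>b. b \<in> set bs \<Longrightarrow> length b \<le> length v \<or> (\<exists>d\<in>set ds. length b \<le> length v + length d)"
    "(\<Union>b\<in>set bs. set b) = set v \<union> (\<Union>d\<in>set ds. set d)"
proof -
  have "length bs \<le> length v + length ds \<and>
    (\<forall>b\<in>set bs. length b \<le> length v \<or> (\<exists>d\<in>set ds. length b \<le> length v + length d)) \<and>
    (\<Union>b\<in>set bs. set b) = set v \<union> (\<Union>d\<in>set ds. set d)"
    using assms
  proof (induction ds arbitrary: bs v rule: rev_induct)
    case Nil
    then have "bs \<in> set (parts v)" by simp
    note p = partsD[OF this]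
    have "length b \<le> length v" if "b \<in> set bs" for b
    proof -
      have "length bs \<noteq> 0" using that by auto
      then show ?thesis using p(3)[OF that] by linarith
    qed
    then show ?case using p(1,4) by auto
  next
    case (snoc d ds)
    from snoc.prems obtain v1 v2 bs' where uv: "(v1, v2) \<in> set (splits v)"
      and bs': "bs' \<in> set (attach ds v1)" and bs: "bs = bs' @ [v2 @ d]"
      unfolding attach_snoc by auto
    have l: "length v1 + length v2 = length v" and s: "set v1 \<union> set v2 = set v"
      using length_splits[OF uv] set_splits[OF uv] by auto
    show ?case
      using snoc.IH[OF bs'] l s unfolding bs by fastforce
  qed
  then show "length bs \<le> length v + length ds"
    "\<And>b. b \<in> set bs \<Longrightarrow> length b \<le> length v \<or> (\<exists>d\<in>set ds. length b \<le> length v + length d)"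
    "(\<Union>b\<in>set bs. set b) = set v \<union> (\<Union>d\<in>set ds. set d)"
    by auto
qed

text \<open>Partitions of \<open>v @ w\<close> are sorted by what they induce on \<open>w\<close>.
  The block of the last letter of \<open>w\<close> takes a subword from \<open>v\<close> and one
  from \<open>w\<close> independently, and what remains is again of the shape
  \<open>v1 @ x\<close>.\<close>

lemma sum_parts_append:
  fixes F :: "'a list list \<Rightarrow> 'b::comm_monoid_add"
  shows "(\<Sum>bs\<leftarrow>parts (v @ w). F bs) = (\<Sum>ds\<leftarrow>parts w. \<Sum>bs\<leftarrow>attach ds v. F bs)"
proof (induction w arbitrary: v F rule: length_induct_snoc)
  case (snoc e w)
  have "(\<Sum>bs\<leftarrow>parts (v @ w @ [e]). F bs) = (\<Sum>bs\<leftarrow>parts ((v @ w) @ [e]). F bs)"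
    by simp
  also have "\<dots> = (\<Sum>(v1, v2)\<leftarrow>splits v. \<Sum>(x, y)\<leftarrow>splits w.
      \<Sum>bs\<leftarrow>parts (v1 @ x). F (bs @ [(v2 @ y) @ [e]]))"
    unfolding sum_parts_snoc sum_splits_append ..
  also have "\<dots> = (\<Sum>(v1, v2)\<leftarrow>splits v. \<Sum>(x, y)\<leftarrow>splits w.
      \<Sum>ds\<leftarrow>parts x. \<Sum>bs\<leftarrow>attach ds v1. F (bs @ [(v2 @ y) @ [e]]))"
    by (intro sum_list_cong_splits snoc)
  also have "\<dots> = (\<Sum>(x, y)\<leftarrow>splits w. \<Sum>ds\<leftarrow>parts x. \<Sum>(v1, v2)\<leftarrow>splits v.
      \<Sum>bs\<leftarrow>attach ds v1. F (bs @ [(v2 @ y) @ [e]]))"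
    unfolding split_def
    by (subst sum_list_swap_map[of _ "splits w" "splits v"]) (subst (2) sum_list_swap_map, rule refl)
  also have "\<dots> = (\<Sum>ds\<leftarrow>parts (w @ [e]). \<Sum>bs\<leftarrow>attach ds v. F bs)"
    unfolding sum_parts_snoc sum_attach_snoc by simp
  finally show ?case .
qed simp

section \<open>Partitions of the blocks of a partition\<close>

text \<open>Choosing some of the blocks amounts to choosing the letters they cover: the order of
  blocks is dictated by their last letters, so two partitions of complementary subwords merge in one
  way only. In other words, \<open>parts\<close> is compatible with the deshuffle coproducts of
  letters and of blocks.\<close>

lemma sum_parts_splits:
  fixes G :: "'a list list \<Rightarrow> 'a list list \<Rightarrow> 'b::comm_monoid_add"
  shows "(\<Sum>cs\<leftarrow>parts x. \<Sum>(p, q)\<leftarrow>splits cs. G p q) =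
    (\<Sum>(x1, x2)\<leftarrow>splits x. \<Sum>p\<leftarrow>parts x1. \<Sum>q\<leftarrow>parts x2. G p q)"
proof (induction x arbitrary: G rule: length_induct_snoc)
  case (snoc e x)
  have add: "(\<Sum>(x, y)\<leftarrow>splits x. g x y + h x y) =
     (\<Sum>(x, y)\<leftarrow>splits x. g x y) + (\<Sum>(x, y)\<leftarrow>splits x. h x y)"
    for g h :: "'a list \<Rightarrow> 'a list \<Rightarrow> 'b" and x
    by (simp add: split_def sum_list_addf)
  have "(\<Sum>cs\<leftarrow>parts (x @ [e]). \<Sum>(p, q)\<leftarrow>splits cs. G p q) =
    (\<Sum>(z, y)\<leftarrow>splits x. (\<Sum>c\<leftarrow>parts z. \<Sum>(p, q)\<leftarrow>splits c. G (p @ [y @ [e]]) q)) +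
    (\<Sum>(z, y)\<leftarrow>splits x. (\<Sum>c\<leftarrow>parts z. \<Sum>(p, q)\<leftarrow>splits c. G p (q @ [y @ [e]])))"
    unfolding sum_parts_snoc sum_splits_snoc sum_list_addf add ..
  also have "(\<Sum>(z, y)\<leftarrow>splits x. (\<Sum>c\<leftarrow>parts z. \<Sum>(p, q)\<leftarrow>splits c. G (p @ [y @ [e]]) q)) =
    (\<Sum>(z, y)\<leftarrow>splits x. (\<Sum>(x1, x2)\<leftarrow>splits z. \<Sum>p\<leftarrow>parts x1. \<Sum>q\<leftarrow>parts x2. G (p @ [y @ [e]]) q))"
    by (intro sum_list_cong_splits snoc)
  \<comment> \<open>The block ending in \<open>e\<close> goes to \<open>p\<close>, so
    \<open>y\<close> has to be grouped with \<open>x1\<close> rather than with \<open>x2\<close>.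
    Coassociativity regroups neighbours only, hence the cocommutations around it.\<close>
  also have "\<dots> = (\<Sum>(z, y)\<leftarrow>splits x. (\<Sum>(x2, x1)\<leftarrow>splits z. \<Sum>p\<leftarrow>parts x1. \<Sum>q\<leftarrow>parts x2. G (p @ [y @ [e]]) q))"
    by (intro sum_list_cong_splits splits_cocomm)
  also have "\<dots> = (\<Sum>(x2, z)\<leftarrow>splits x. (\<Sum>(x1, y)\<leftarrow>splits z. \<Sum>p\<leftarrow>parts x1. \<Sum>q\<leftarrow>parts x2. G (p @ [y @ [e]]) q))"
    by (rule splits_coassoc)
  also have "\<dots> = (\<Sum>(z, x2)\<leftarrow>splits x. (\<Sum>(x1, y)\<leftarrow>splits z. \<Sum>p\<leftarrow>parts x1. \<Sum>q\<leftarrow>parts x2. G (p @ [y @ [e]]) q))"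
    by (rule splits_cocomm)
  also have "(\<Sum>(z, y)\<leftarrow>splits x. (\<Sum>c\<leftarrow>parts z. \<Sum>(p, q)\<leftarrow>splits c. G p (q @ [y @ [e]]))) =
    (\<Sum>(z, y)\<leftarrow>splits x. (\<Sum>(x1, x2)\<leftarrow>splits z. \<Sum>p\<leftarrow>parts x1. \<Sum>q\<leftarrow>parts x2. G p (q @ [y @ [e]])))"
    by (intro sum_list_cong_splits snoc)
  also have "\<dots> = (\<Sum>(x1, z)\<leftarrow>splits x. (\<Sum>(x2, y)\<leftarrow>splits z. \<Sum>p\<leftarrow>parts x1. \<Sum>q\<leftarrow>parts x2. G p (q @ [y @ [e]])))"
    by (rule splits_coassoc)
  also have "\<dots> = (\<Sum>(x1, z)\<leftarrow>splits x. \<Sum>p\<leftarrow>parts x1. (\<Sum>(x2, y)\<leftarrow>splits z. \<Sum>q\<leftarrow>parts x2. G p (q @ [y @ [e]])))"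
    unfolding split_def by (subst (2) sum_list_swap_map) (rule refl)
  also have "(\<Sum>(z, x2)\<leftarrow>splits x. (\<Sum>(x1, y)\<leftarrow>splits z. \<Sum>p\<leftarrow>parts x1. \<Sum>q\<leftarrow>parts x2. G (p @ [y @ [e]]) q)) +
      (\<Sum>(x1, z)\<leftarrow>splits x. \<Sum>p\<leftarrow>parts x1. (\<Sum>(x2, y)\<leftarrow>splits z. \<Sum>q\<leftarrow>parts x2. G p (q @ [y @ [e]]))) =
    (\<Sum>(x1, x2)\<leftarrow>splits (x @ [e]). \<Sum>p\<leftarrow>parts x1. \<Sum>q\<leftarrow>parts x2. G p q)"
    unfolding sum_splits_snoc sum_parts_snoc ..
  finally show ?case .
qed simp

text \<open>Choices of one partition for each block, enumerated from the last block on to match the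
  recursion of \<open>parts\<close>.\<close>

function parts_product :: "'a list list \<Rightarrow> 'a list list list list" where
  "parts_product bs = (if bs = [] then [[]] else
     concat (map (\<lambda>ds. map (\<lambda>d. ds @ [d]) (parts (last bs))) (parts_product (butlast bs))))"
  by pat_completeness auto
termination
  by (relation "Wellfounded.measure length") auto

declare parts_product.simps [simp del]

lemma parts_product_Nil [simp]: "parts_product [] = [[]]"
  by (simp add: parts_product.simps)

lemma sum_parts_product_snoc:
  fixes F :: "'a list list list \<Rightarrow> 'b::comm_monoid_add"
  shows "(\<Sum>ds\<leftarrow>parts_product (bs @ [b]). F ds) = (\<Sum>ds\<leftarrow>parts_product bs. \<Sum>d\<leftarrow>parts b. F (ds @ [d]))"
  by (subst parts_product.simps) (simp add: sum_list_concat_map o_def)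

text \<open>The last coarse block consists of fine blocks \<open>q\<close> followed by
  \<open>y @ [e]\<close>. The letters under \<open>q\<close> form a subword \<open>x2\<close>, and
  coassociativity collects \<open>x2\<close> and \<open>y\<close> into \<open>z\<close>, so that
  \<open>q @ [y @ [e]]\<close> runs through the partitions of \<open>z @ [e]\<close>.\<close>

lemma sum_parts_parts:
  fixes F :: "'a list list list \<Rightarrow> 'b::comm_monoid_add"
  shows "(\<Sum>cs\<leftarrow>parts v. \<Sum>ds\<leftarrow>parts cs. F ds) = (\<Sum>bs\<leftarrow>parts v. \<Sum>ds\<leftarrow>parts_product bs. F ds)"
proof (induction v arbitrary: F rule: length_induct_snoc)
  case (snoc e v)
  have "(\<Sum>cs\<leftarrow>parts (v @ [e]). \<Sum>ds\<leftarrow>parts cs. F ds) =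
     (\<Sum>(x, y)\<leftarrow>splits v. \<Sum>cs\<leftarrow>parts x. \<Sum>(p, q)\<leftarrow>splits cs. \<Sum>ds\<leftarrow>parts p. F (ds @ [q @ [y @ [e]]]))"
    unfolding sum_parts_snoc ..
  also have "\<dots> = (\<Sum>(x, y)\<leftarrow>splits v. \<Sum>(x1, x2)\<leftarrow>splits x. \<Sum>p\<leftarrow>parts x1. \<Sum>q\<leftarrow>parts x2.
      \<Sum>ds\<leftarrow>parts p. F (ds @ [q @ [y @ [e]]]))"
    unfolding sum_parts_splits ..
  also have "\<dots> = (\<Sum>(x1, z)\<leftarrow>splits v. \<Sum>(x2, y)\<leftarrow>splits z. \<Sum>p\<leftarrow>parts x1. \<Sum>q\<leftarrow>parts x2.
      \<Sum>ds\<leftarrow>parts p. F (ds @ [q @ [y @ [e]]]))"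
    by (rule splits_coassoc)
  also have "\<dots> = (\<Sum>(x1, z)\<leftarrow>splits v. \<Sum>p\<leftarrow>parts x1. \<Sum>ds\<leftarrow>parts p. \<Sum>(x2, y)\<leftarrow>splits z. \<Sum>q\<leftarrow>parts x2.
      F (ds @ [q @ [y @ [e]]]))"
  proof (intro sum_list_cong_splits)
    fix x1 z :: "'a list"
    define f where "f = (\<lambda>(x2 :: 'a list) y (p :: 'a list list) q ds. F (ds @ [q @ [y @ [e]]]))"
    have "(\<Sum>(x2, y)\<leftarrow>splits z. \<Sum>p\<leftarrow>parts x1. \<Sum>q\<leftarrow>parts x2. \<Sum>ds\<leftarrow>parts p. f x2 y p q ds) =
      (\<Sum>(x2, y)\<leftarrow>splits z. \<Sum>p\<leftarrow>parts x1. \<Sum>ds\<leftarrow>parts p. \<Sum>q\<leftarrow>parts x2. f x2 y p q ds)"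
      by (subst (3) sum_list_swap_map) (rule refl)
    also have "\<dots> = (\<Sum>p\<leftarrow>parts x1. \<Sum>(x2, y)\<leftarrow>splits z. \<Sum>ds\<leftarrow>parts p. \<Sum>q\<leftarrow>parts x2. f x2 y p q ds)"
      unfolding split_def by (rule sum_list_swap_map)
    also have "\<dots> = (\<Sum>p\<leftarrow>parts x1. \<Sum>ds\<leftarrow>parts p. \<Sum>(x2, y)\<leftarrow>splits z. \<Sum>q\<leftarrow>parts x2. f x2 y p q ds)"
      unfolding split_def by (subst (2) sum_list_swap_map) (rule refl)
    finally show "(\<Sum>(x2, y)\<leftarrow>splits z. \<Sum>p\<leftarrow>parts x1. \<Sum>q\<leftarrow>parts x2. \<Sum>ds\<leftarrow>parts p. F (ds @ [q @ [y @ [e]]])) =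
      (\<Sum>p\<leftarrow>parts x1. \<Sum>ds\<leftarrow>parts p. \<Sum>(x2, y)\<leftarrow>splits z. \<Sum>q\<leftarrow>parts x2. F (ds @ [q @ [y @ [e]]]))"
      unfolding f_def .
  qed
  also have "\<dots> = (\<Sum>(x1, z)\<leftarrow>splits v. \<Sum>p\<leftarrow>parts x1. \<Sum>ds\<leftarrow>parts p. \<Sum>q\<leftarrow>parts (z @ [e]). F (ds @ [q]))"
    unfolding sum_parts_snoc ..
  also have "\<dots> = (\<Sum>(x1, z)\<leftarrow>splits v. \<Sum>bs\<leftarrow>parts x1. \<Sum>ds\<leftarrow>parts_product bs. \<Sum>q\<leftarrow>parts (z @ [e]). F (ds @ [q]))"
    by (intro sum_list_cong_splits snoc)
  also have "\<dots> = (\<Sum>bs\<leftarrow>parts (v @ [e]). \<Sum>ds\<leftarrow>parts_product bs. F ds)"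
    unfolding sum_parts_snoc sum_parts_product_snoc ..
  finally show ?case .
qed simp

text \<open>Serves the degree one part of a lift, which sees partitions with a single block
  only.\<close>

lemma parts_singleton:
  fixes F :: "'a list list \<Rightarrow> 'b::comm_monoid_add"
  assumes "w \<noteq> []"
  shows "(\<Sum>bs\<leftarrow>parts w. if length bs = 1 then F bs else 0) = F [w]"
proof -
  obtain v e where w: "w = v @ [e]" using assms by (cases w rule: rev_cases) auto
  have Nil: "(\<Sum>bs\<leftarrow>parts u. if bs = [] then F (bs @ [x]) else 0) = (if u = [] then F [x] else 0)" for u x
  proof (cases "u = []")
    case False
    then have "(\<Sum>bs\<leftarrow>parts u. if bs = [] then F (bs @ [x]) else 0) = (\<Sum>bs\<leftarrow>parts u. 0)"
      by (intro sum_list_cong) (use partsD(5) in auto)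
    then show ?thesis using False by simp
  qed simp
  have *: "(\<Sum>(u, v)\<leftarrow>splits v. if u = [] then G v else 0) = G v" for G :: "'a list \<Rightarrow> 'b" and v
  proof (induction v arbitrary: G)
    case (Cons a v)
    have "(\<Sum>(u, v)\<leftarrow>splits v. 0 :: 'b) = 0" by (simp add: split_def)
    then show ?case
      using Cons.IH by (simp add: sum_splits_Cons del: splits.simps(2) cong: if_cong)
  qed simp
  show ?thesis
    unfolding w sum_parts_snoc by (simp add: Nil *)
qed

section \<open>Ordered shuffles as ordered partitions\<close>

text \<open>On a word of distinct positions no deshuffle occurs twice, so the list can be exchanged
  for the set of pairs of complementary subsets.\<close>

lemma splits_strict_sorted:
  fixes xs :: "nat list"
  assumes "sorted_wrt (<) xs"
  shows "set (splits xs) = {(u, v). sorted_wrt (<) u \<and> sorted_wrt (<) v \<and>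
      set u \<inter> set v = {} \<and> set u \<union> set v = set xs} \<and> distinct (splits xs)"
  using assms
proof (induction xs)
  case (Cons x xs)
  let ?S = "\<lambda>xs :: nat list. {(u, v). sorted_wrt (<) u \<and> sorted_wrt (<) v \<and>
      set u \<inter> set v = {} \<and> set u \<union> set v = set xs}"
  have x: "x < y" if "y \<in> set xs" for y
    using Cons.prems that by auto
  have IH: "set (splits xs) = ?S xs" "distinct (splits xs)"
    using Cons by auto
  have sub: "set (splits (x # xs)) \<subseteq> ?S (x # xs)"
  proof -
    have "(x # u, v) \<in> ?S (x # xs) \<and> (u, x # v) \<in> ?S (x # xs)" if "(u, v) \<in> ?S xs" for u v
    proof -
      have "\<forall>y\<in>set u \<union> set v. x < y" using that x by auto
      then show ?thesis using that by fastforce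
    qed
    then show ?thesis using IH(1) by auto
  qed
  \<comment> \<open>The smallest position \<open>x\<close> heads whichever subword contains it.
    Stated for \<open>v\<close> and used with the two subwords in either role.\<close>
  have hd: "\<exists>v'. v = x # v' \<and> (u, v') \<in> ?S xs"
    if v: "sorted_wrt (<) v" and u: "sorted_wrt (<) u" and d: "set u \<inter> set v = {}"
      and un: "set u \<union> set v = insert x (set xs)" and "x \<in> set v" for u v
  proof -
    obtain y v' where v': "v = y # v'" using \<open>x \<in> set v\<close> by (cases v) auto
    have "y = x"
    proof (rule ccontr)
      assume "y \<noteq> x"
      then have "y < x" and "y \<in> set xs" using v un \<open>x \<in> set v\<close> unfolding v' by auto
      then show False using x[of y] by simp
    qed
    moreover have "x \<notin> set xs" using x by blast
    moreover have "x \<notin> set v'" using v \<open>y = x\<close> unfolding v' by auto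
    ultimately show ?thesis using v u d un unfolding v' by auto
  qed
  have "?S (x # xs) \<subseteq> set (splits (x # xs))"
  proof clarify
    fix u v assume a: "sorted_wrt (<) u" "sorted_wrt (<) v" "set u \<inter> set v = {}"
      "set u \<union> set v = set (x # xs)"
    then have "x \<in> set u \<or> x \<in> set v" by auto
    then show "(u, v) \<in> set (splits (x # xs))"
    proof
      assume "x \<in> set v"
      then obtain v' where "v = x # v'" "(u, v') \<in> ?S xs"
        using hd[of v u] a by auto
      then show ?thesis using IH(1) by force
    next
      assume "x \<in> set u"
      then obtain u' where "u = x # u'" "(v, u') \<in> ?S xs"
        using hd[of u v] a by auto
      then have "(u', v) \<in> set (splits xs)" using IH(1) by auto
      then show ?thesis using \<open>u = x # u'\<close> by force
    qed
  qed
  moreover have "distinct (splits (x # xs))"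
  proof -
    have "False" if "(x # u, v) \<in> ?S xs \<or> (v, x # u) \<in> ?S xs" for u v
      using that x[of x] by auto
    then show ?thesis
      using IH by (fastforce simp: distinct_map inj_on_def)
  qed
  ultimately show ?case using sub by blast
qed auto

text \<open>In an increasing block \<open>last\<close> is the maximum; every set partition of
  \<open>A\<close> into nonempty blocks is thus represented once, its blocks being sorted by their
  maxima.\<close>

definition ordered_partitions :: "nat set \<Rightarrow> nat list list set" where
  "ordered_partitions A = {bs. (\<forall>b\<in>set bs. b \<noteq> [] \<and> sorted_wrt (<) b) \<and> distinct (concat bs) \<and>
     set (concat bs) = A \<and> sorted_wrt (<) (map last bs)}"

text \<open>The recursion of \<open>parts\<close> on sets of positions. Every position is at most
  the last entry of its block and these entries increase, so the largest position \<open>x\<close>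
  ends the last block.\<close>

lemma bij_ordered_partitions:
  fixes xs :: "nat list"
  assumes s: "sorted_wrt (<) (xs @ [x])"
  shows "bij_betw (\<lambda>((u, v), bs). bs @ [v @ [x]])
    (SIGMA (u, v):set (splits xs). ordered_partitions (set u))
    (ordered_partitions (set (xs @ [x])))" (is "bij_betw ?f ?A ?B")
proof -
  have sx: "sorted_wrt (<) xs" and xx: "\<And>y. y \<in> set xs \<Longrightarrow> y < x"
    using s by (auto simp: sorted_wrt_append)
  note spl = splits_strict_sorted[OF sx, THEN conjunct1]
  have le_last: "y \<le> last b" if "sorted_wrt (<) b" "y \<in> set b" for b :: "nat list" and y
    using that by (cases b rule: rev_cases) (auto simp: sorted_wrt_append)
  show ?thesis
  proof (rule bij_betwI')
    fix p q assume p: "p \<in> ?A" and q: "q \<in> ?A"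
    obtain u v bs where p': "p = ((u, v), bs)" by (metis prod.exhaust)
    obtain u' v' bs' where q': "q = ((u', v'), bs')" by (metis prod.exhaust)
    show "?f p = ?f q \<longleftrightarrow> p = q"
    proof
      assume eq: "?f p = ?f q"
      then have "bs = bs'" "v = v'" by (auto simp: p' q')
      \<comment> \<open>\<open>u\<close> is recovered as the increasing list of the positions
        covered by the remaining blocks.\<close>
      moreover have "u = u'"
      proof (rule strict_sorted_equal)
        show "sorted_wrt (<) u" "sorted_wrt (<) u'"
          using p q spl unfolding p' q' by auto
        show "set u = set u'"
          using p q \<open>bs = bs'\<close> unfolding p' q' ordered_partitions_def by auto
      qed
      ultimately show "p = q" by (simp add: p' q')
    qed simp
  next
    fix p assume p: "p \<in> ?A"
    obtain u v bs where p': "p = ((u, v), bs)" by (metis prod.exhaust)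
    have uv: "sorted_wrt (<) u" "sorted_wrt (<) v" "set u \<inter> set v = {}" "set u \<union> set v = set xs"
      using p spl unfolding p' by auto
    have bs: "bs \<in> ordered_partitions (set u)" using p p' by auto
    have "last b < x" if "b \<in> set bs" for b
    proof -
      have "last b \<in> set u" using bs that last_in_set[of b] unfolding ordered_partitions_def
        by (metis (mono_tags, lifting) UN_I mem_Collect_eq set_concat)
      then show ?thesis using uv xx by auto
    qed
    moreover have "x \<notin> set u" "\<forall>y\<in>set v. y < x" "x \<notin> set v" using uv xx by blast+
    moreover have "distinct v" using uv(2) by (simp add: strict_sorted_iff)
    ultimately show "?f p \<in> ?B"
      using uv bs unfolding p' ordered_partitions_def
      by (auto simp: sorted_wrt_append)
  next
    fix bs assume bs: "bs \<in> ?B"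
    then have "bs \<noteq> []" by (auto simp: ordered_partitions_def)
    then obtain bs' b where b: "bs = bs' @ [b]" by (metis rev_exhaust)
    then have "b \<noteq> []" using bs by (auto simp: ordered_partitions_def)
    then obtain v y where v: "b = v @ [y]" by (metis rev_exhaust)
    note bs = bs[unfolded b v ordered_partitions_def, simplified]
    have less_y: "z < y" if "z \<in> set c" "c \<in> set bs'" for z c
    proof -
      have "last c < y" using bs that by (auto simp: sorted_wrt_append)
      moreover have "z \<le> last c" using bs that by (intro le_last) auto
      ultimately show ?thesis by simp
    qed
    have less_y': "z < y" if "z \<in> set v" for z
      using bs that by (auto simp: sorted_wrt_append)
    have un: "(\<Union>c\<in>set bs'. set c) \<union> set v \<union> {y} = insert x (set xs)"
      using bs by auto
    have "y = x"
    proof (rule ccontr)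
      assume "y \<noteq> x"
      then have "y < x" using un xx by auto
      moreover have "x < y" using un less_y less_y' \<open>y \<noteq> x\<close> by blast
      ultimately show False by simp
    qed
    define u where "u = sorted_list_of_set (set (concat bs'))"
    have set_u: "set u = set (concat bs')" unfolding u_def by simp
    have su: "sorted_wrt (<) u" unfolding u_def by simp
    have "set u \<inter> set v = {}" using bs set_u by auto
    moreover have "set u \<union> set v = set xs"
    proof -
      have "x \<notin> set u \<union> set v" using less_y less_y' set_u \<open>y = x\<close> by auto
      moreover have "x \<notin> set xs" using xx by blast
      ultimately show ?thesis using un set_u \<open>y = x\<close> by auto
    qed
    moreover have "sorted_wrt (<) v" using bs by (auto simp: sorted_wrt_append)
    ultimately have "(u, v) \<in> set (splits xs)" using spl su by auto
    moreover have "bs' \<in> ordered_partitions (set u)"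
      using bs set_u by (auto simp: ordered_partitions_def sorted_wrt_append)
    ultimately show "\<exists>p\<in>?A. bs = ?f p"
      using \<open>y = x\<close> b v by (intro bexI[of _ "((u, v), bs')"]) auto
  qed
qed

lemma sum_parts_ordered_partitions:
  fixes xs :: "nat list" and F :: "nat list list \<Rightarrow> 'b::comm_monoid_add"
  assumes "sorted_wrt (<) xs"
  shows "finite (ordered_partitions (set xs))"
    "(\<Sum>bs\<leftarrow>parts xs. F bs) = (\<Sum>bs\<in>ordered_partitions (set xs). F bs)"
proof -
  have "finite (ordered_partitions (set xs)) \<and>
      (\<Sum>bs\<leftarrow>parts xs. F bs) = (\<Sum>bs\<in>ordered_partitions (set xs). F bs)"
    using assms
  proof (induction xs arbitrary: F rule: length_induct_snoc)
    case Nil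
    have "ordered_partitions {} = {[]}"
      by (auto simp: ordered_partitions_def)
    then show ?case by simp
  next
    case (snoc x xs)
    note bij = bij_ordered_partitions[OF snoc.prems]
    have sx: "sorted_wrt (<) xs" using snoc.prems by (simp add: sorted_wrt_append)
    note spl = splits_strict_sorted[OF sx]
    have IH: "finite (ordered_partitions (set u))"
      "(\<Sum>bs\<leftarrow>parts u. G bs) = (\<Sum>bs\<in>ordered_partitions (set u). G bs)"
      if "(u, v) \<in> set (splits xs)" for u v and G :: "nat list list \<Rightarrow> 'b"
    proof -
      have "length u \<le> length xs" using length_splits[OF that] by simp
      moreover have "sorted_wrt (<) u" using that spl by auto
      ultimately show "finite (ordered_partitions (set u))"
        "(\<Sum>bs\<leftarrow>parts u. G bs) = (\<Sum>bs\<in>ordered_partitions (set u). G bs)"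
        using snoc.IH[of u G] by auto
    qed
    have fin: "finite (SIGMA (u, v):set (splits xs). ordered_partitions (set u))"
      using IH(1) by (intro finite_SigmaI) auto
    have "(\<Sum>bs\<leftarrow>parts (xs @ [x]). F bs) =
        (\<Sum>(u, v)\<leftarrow>splits xs. \<Sum>bs\<in>ordered_partitions (set u). F (bs @ [v @ [x]]))"
      unfolding sum_parts_snoc by (intro sum_list_cong) (auto simp: IH(2))
    also have "\<dots> = (\<Sum>(u, v)\<in>set (splits xs). \<Sum>bs\<in>ordered_partitions (set u). F (bs @ [v @ [x]]))"
      using spl by (intro sum_list_distinct_conv_sum_set) auto
    also have "\<dots> = (\<Sum>((u, v), bs)\<in>(SIGMA (u, v):set (splits xs). ordered_partitions (set u)).
        F (bs @ [v @ [x]]))"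
      unfolding split_def using IH(1) by (subst sum.Sigma) (auto simp: split_def)
    also have "\<dots> = (\<Sum>p\<in>(SIGMA (u, v):set (splits xs). ordered_partitions (set u)).
        F ((\<lambda>((u, v), bs). bs @ [v @ [x]]) p))"
      by (simp add: split_def)
    also have "\<dots> = (\<Sum>bs\<in>ordered_partitions (set (xs @ [x])). F bs)"
      by (rule sum.reindex_bij_betw[OF bij])
    finally show ?case using bij_betw_finite[OF bij] fin by simp
  qed
  then show "finite (ordered_partitions (set xs))"
    "(\<Sum>bs\<leftarrow>parts xs. F bs) = (\<Sum>bs\<in>ordered_partitions (set xs). F bs)" by auto
qed

section \<open>Shuffle permutations and their blocks of positions\<close>

definition shuffle_blocks :: "nat list \<Rightarrow> (nat \<Rightarrow> nat) \<Rightarrow> nat list list" where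
  "shuffle_blocks ns \<sigma> = map (\<lambda>j. map \<sigma> [offset ns j..<offset ns (Suc j)]) [0..<length ns]"

lemma split_shuffle_eq: "split_shuffle ns \<sigma> w = map (map ((!) w)) (shuffle_blocks ns \<sigma>)"
  by (simp add: split_shuffle_def shuffle_blocks_def)

lemma offset_Suc: "j < length ns \<Longrightarrow> offset ns (Suc j) = offset ns j + ns ! j"
  by (simp add: offset_def take_Suc_conv_app_nth)

lemma offset_le: "offset ns j \<le> sum_list ns"
  unfolding offset_def by (metis append_take_drop_id le_add1 sum_list_append)

lemma map_length_shuffle_blocks: "map length (shuffle_blocks ns \<sigma>) = ns"
  by (rule nth_equalityI) (simp_all add: shuffle_blocks_def offset_Suc)

lemma concat_shuffle_blocks: "concat (shuffle_blocks ns \<sigma>) = map \<sigma> [0..<sum_list ns]"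
proof -
  have "concat (map (\<lambda>j. [offset ns j..<offset ns (Suc j)]) [0..<k]) = [0..<offset ns k]"
    if "k \<le> length ns" for k
    using that
  proof (induction k)
    case (Suc k)
    then show ?case
      using upt_add_eq_append[of 0 "offset ns k" "ns ! k"] by (simp add: offset_Suc)
  qed (simp add: offset_def)
  from this[of "length ns"]
  have "concat (map (\<lambda>j. [offset ns j..<offset ns (Suc j)]) [0..<length ns]) = [0..<sum_list ns]"
    by (simp add: offset_def)
  then show ?thesis
    unfolding shuffle_blocks_def by (metis (no_types, lifting) map_concat map_map o_def map_cong)
qed

definition shuffle_images :: "nat list \<Rightarrow> nat list list set" where
  "shuffle_images ns = {bs. map length bs = ns \<and> (\<forall>b\<in>set bs. sorted_wrt (<) b) \<and>
     distinct (concat bs) \<and> set (concat bs) = {..<sum_list ns}}"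

lemma concat_nth_offset:
  assumes "j < length bs" "i < length (bs ! j)"
  shows "concat bs ! (offset (map length bs) j + i) = bs ! j ! i"
proof -
  have "concat bs = concat (take j bs) @ bs ! j @ concat (drop (Suc j) bs)"
    using id_take_nth_drop[OF assms(1)] by (metis concat.simps(2) concat_append)
  moreover have "offset (map length bs) j = length (concat (take j bs))"
    by (simp add: offset_def length_concat take_map)
  ultimately show ?thesis using assms(2) by (simp add: nth_append)
qed

text \<open>A shuffle increases on each block, so the increasing contents of the blocks determine
  it; conversely, the concatenated blocks are its one-line notation.\<close>

lemma bij_shuffle_blocks: "bij_betw (shuffle_blocks ns) (Sh ns) (shuffle_images ns)"
proof (rule bij_betw_imageI)
  show "inj_on (shuffle_blocks ns) (Sh ns)"
  proof (rule inj_onI)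
    fix \<sigma> \<tau> assume a: "\<sigma> \<in> Sh ns" "\<tau> \<in> Sh ns" "shuffle_blocks ns \<sigma> = shuffle_blocks ns \<tau>"
    then have "map \<sigma> [0..<sum_list ns] = map \<tau> [0..<sum_list ns]"
      by (metis concat_shuffle_blocks)
    then have "\<sigma> i = \<tau> i" if "i < sum_list ns" for i using that by auto
    moreover have "\<sigma> i = \<tau> i" if "\<not> i < sum_list ns" for i
      using a that unfolding Sh_def by (auto simp: permutes_def)
    ultimately show "\<sigma> = \<tau>" by blast
  qed
  have "shuffle_blocks ns \<sigma> \<in> shuffle_images ns" if "\<sigma> \<in> Sh ns" for \<sigma>
  proof -
    have p: "\<sigma> permutes {..<sum_list ns}" using that by (simp add: Sh_def)
    have "sorted_wrt (<) (map \<sigma> [offset ns j..<offset ns (Suc j)])" if "j < length ns" for j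
      using \<open>\<sigma> \<in> Sh ns\<close> that unfolding Sh_def
      by (auto simp: sorted_wrt_map strict_mono_on_def intro!: sorted_wrt_mono_rel[OF _ sorted_wrt_upt])
    moreover have "inj_on \<sigma> {0..<sum_list ns}" using p permutes_inj_on by blast
    moreover have "\<sigma> ` {0..<sum_list ns} = {..<sum_list ns}"
      using permutes_image[OF p] by (simp add: lessThan_atLeast0)
    ultimately show ?thesis
      unfolding shuffle_images_def
      by (simp add: map_length_shuffle_blocks concat_shuffle_blocks distinct_map del: set_concat)
         (auto simp: shuffle_blocks_def)
  qed
  moreover have "bs \<in> shuffle_blocks ns ` Sh ns" if bs: "bs \<in> shuffle_images ns" for bs
  proof -
    have ns: "ns = map length bs" using bs by (auto simp: shuffle_images_def)
    define n where "n = sum_list ns"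
    have ln: "length (concat bs) = n" by (simp add: ns n_def length_concat)
    \<comment> \<open>One-line notation, continued by the identity outside \<open>{..<n}\<close> as
      \<open>permutes\<close> demands.\<close>
    define \<sigma> where "\<sigma> = (\<lambda>i. if i < n then concat bs ! i else i)"
    have d: "distinct (concat bs)" and sc: "set (concat bs) = {..<n}"
      using bs by (auto simp: shuffle_images_def n_def)
    have "bij_betw ((!) (concat bs)) {..<n} {..<n}"
      by (rule bij_betw_nth[OF d]) (simp_all only: ln sc)
    then have "bij_betw \<sigma> {..<n} {..<n}"
      by (rule bij_betw_cong[THEN iffD1, rotated]) (auto simp: \<sigma>_def)
    then have perm: "\<sigma> permutes {..<n}"
      by (rule bij_imp_permutes) (auto simp: \<sigma>_def)
    have nth: "\<sigma> (offset ns j + i) = bs ! j ! i" if "j < length bs" "i < length (bs ! j)" for i j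
    proof -
      have "offset ns j + i < offset ns (Suc j)" using that by (simp add: ns offset_Suc)
      also have "\<dots> \<le> n" unfolding n_def by (rule offset_le)
      finally show ?thesis using concat_nth_offset[OF that] by (simp add: \<sigma>_def ns)
    qed
    have "\<sigma> \<in> Sh ns"
      unfolding Sh_def
    proof (intro CollectI conjI allI impI)
      show "\<sigma> permutes {..<sum_list ns}" using perm n_def by simp
      fix j assume j: "j < length ns"
      have sj: "sorted_wrt (<) (bs ! j)" using bs j by (auto simp: shuffle_images_def ns)
      show "strict_mono_on {offset ns j..<offset ns (Suc j)} \<sigma>"
      proof (rule strict_mono_onI)
        fix r s assume rs: "r \<in> {offset ns j..<offset ns (Suc j)}"
          "s \<in> {offset ns j..<offset ns (Suc j)}" "r < s"
        define r' s' where "r' = r - offset ns j" and "s' = s - offset ns j"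
        have "r = offset ns j + r'" "s = offset ns j + s'" "r' < s'" "s' < length (bs ! j)"
          using rs j by (auto simp: r'_def s'_def ns offset_Suc)
        then show "\<sigma> r < \<sigma> s"
          using sj j nth[of j r'] nth[of j s'] by (simp add: ns sorted_wrt_iff_nth_less)
      qed
    qed
    moreover have "bs = shuffle_blocks ns \<sigma>"
      by (intro nth_equalityI) (simp_all add: shuffle_blocks_def ns offset_Suc nth[unfolded ns])
    ultimately show ?thesis by blast
  qed
  ultimately show "shuffle_blocks ns ` Sh ns = shuffle_images ns" by blast
qed

lemma finite_Sh: "finite (Sh ns)"
  by (rule finite_subset[OF _ finite_permutations[of "{..<sum_list ns}"]]) (auto simp: Sh_def)

text \<open>For nonempty blocks \<open>offset ns (Suc j) - 1\<close> is the final position of block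
  \<open>j\<close>; for an empty block it would not lie in that block.\<close>

lemma oSh_iff:
  assumes \<sigma>: "\<sigma> \<in> Sh ns" and pos: "\<forall>n\<in>set ns. 1 \<le> n"
  shows "\<sigma> \<in> oSh ns \<longleftrightarrow> sorted_wrt (<) (map last (shuffle_blocks ns \<sigma>))"
proof -
  have last: "map last (shuffle_blocks ns \<sigma>) = map (\<lambda>j. \<sigma> (offset ns (Suc j) - 1)) [0..<length ns]"
  proof -
    have "last (map \<sigma> [offset ns j..<offset ns (Suc j)]) = \<sigma> (offset ns (Suc j) - 1)"
      if "j < length ns" for j
    proof -
      have "offset ns j < offset ns (Suc j)" using pos that nth_mem[OF that] by (auto simp: offset_Suc Suc_le_eq)
      then show ?thesis by (simp add: last_map)
    qed
    then show ?thesis by (simp add: shuffle_blocks_def)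
  qed
  show ?thesis
    unfolding last using \<sigma>
    by (simp add: oSh_def sorted_wrt_iff_nth_less)
       (auto simp: strict_mono_on_def monotone_on_def)
qed

definition compositions :: "nat \<Rightarrow> nat \<Rightarrow> nat list set" where
  "compositions m n = {ns. length ns = m \<and> (\<forall>n\<in>set ns. 1 \<le> n) \<and> sum_list ns = n}"

lemma finite_compositions: "finite (compositions m n)"
proof (rule finite_subset)
  show "compositions m n \<subseteq> {ns. set ns \<subseteq> {..n} \<and> length ns = m}"
    using member_le_sum_list by (fastforce simp: compositions_def)
qed (simp add: finite_lists_length_eq)

lemma map_nth_upt_length: "map (map (map ((!) w))) (parts [0..<length w]) = parts w"
  by (metis map_nth parts_map)

text \<open>A composition together with an ordered shuffle is the same as an ordered partition of
  the positions: the composition is recovered as the list of block sizes. The comparison takes place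
  on \<open>[0..<length w]\<close> and the letters are substituted at the end.\<close>

lemma sum_oSh:
  fixes F :: "'a list list \<Rightarrow> 'b::comm_monoid_add"
  shows "(\<Sum>ns\<in>compositions m (length w). \<Sum>\<sigma>\<in>oSh ns. F (split_shuffle ns \<sigma> w)) =
    (\<Sum>bs\<leftarrow>parts w. if length bs = m then F bs else 0)"
proof -
  let ?n = "length w"
  let ?G = "\<lambda>bs. F (map (map ((!) w)) bs)"
  let ?P = "{bs \<in> ordered_partitions {..<?n}. length bs = m}"
  have oSh_sub: "oSh ns \<subseteq> Sh ns" for ns by (auto simp: oSh_def)
  have fin: "finite (oSh ns)" for ns using oSh_sub finite_Sh by (rule finite_subset)
  have bij: "bij_betw (\<lambda>(ns, \<sigma>). shuffle_blocks ns \<sigma>) (SIGMA ns:compositions m ?n. oSh ns) ?P"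
  proof (rule bij_betw_imageI)
    show "inj_on (\<lambda>(ns, \<sigma>). shuffle_blocks ns \<sigma>) (SIGMA ns:compositions m ?n. oSh ns)"
    proof (rule inj_onI, clarify)
      fix ns \<sigma> ns' \<sigma>'
      assume a: "\<sigma> \<in> oSh ns" "\<sigma>' \<in> oSh ns'" "shuffle_blocks ns \<sigma> = shuffle_blocks ns' \<sigma>'"
      then have "ns = ns'" by (metis map_length_shuffle_blocks)
      moreover from this have "\<sigma> = \<sigma>'"
        using a oSh_sub inj_onD[OF bij_betw_imp_inj_on[OF bij_shuffle_blocks[of ns]]] by blast
      ultimately show "ns = ns' \<and> \<sigma> = \<sigma>'" by simp
    qed
    have "shuffle_blocks ns \<sigma> \<in> ?P" if ns: "ns \<in> compositions m ?n" and \<sigma>: "\<sigma> \<in> oSh ns" for ns \<sigma>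
    proof -
      have pos: "\<forall>n\<in>set ns. 1 \<le> n" "sum_list ns = ?n" "length ns = m"
        using ns by (auto simp: compositions_def)
      have "shuffle_blocks ns \<sigma> \<in> shuffle_images ns"
        using \<sigma> oSh_sub bij_betw_imp_surj_on[OF bij_shuffle_blocks[of ns]] by auto
      moreover have "sorted_wrt (<) (map last (shuffle_blocks ns \<sigma>))"
        using oSh_iff[of \<sigma> ns] \<sigma> oSh_sub pos by auto
      moreover have "b \<noteq> []" if "b \<in> set (shuffle_blocks ns \<sigma>)" for b
      proof -
        have "length b \<in> set (map length (shuffle_blocks ns \<sigma>))" using that by auto
        then have "1 \<le> length b" using pos by (simp only: map_length_shuffle_blocks)
        then show ?thesis by auto
      qed
      ultimately show ?thesis
        using pos by (auto simp: ordered_partitions_def shuffle_images_def shuffle_blocks_def)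
    qed
    moreover have "\<exists>ns\<in>compositions m ?n. \<exists>\<sigma>\<in>oSh ns. bs = shuffle_blocks ns \<sigma>" if bs: "bs \<in> ?P" for bs
    proof -
      let ?ns = "map length bs"
      have pos: "\<forall>n\<in>set ?ns. 1 \<le> n" using bs by (auto simp: ordered_partitions_def Suc_le_eq)
      have sum: "sum_list ?ns = ?n"
      proof -
        have "sum_list ?ns = card (set (concat bs))"
          using bs distinct_card[of "concat bs"]
          by (simp add: ordered_partitions_def length_concat del: set_concat)
        also have "\<dots> = ?n" using bs by (simp add: ordered_partitions_def del: set_concat)
        finally show ?thesis .
      qed
      have "bs \<in> shuffle_images ?ns"
        using bs sum by (auto simp: shuffle_images_def ordered_partitions_def)
      then obtain \<sigma> where \<sigma>: "\<sigma> \<in> Sh ?ns" "bs = shuffle_blocks ?ns \<sigma>"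
        using bij_betw_imp_surj_on[OF bij_shuffle_blocks[of ?ns]] by auto
      then have "\<sigma> \<in> oSh ?ns"
        using oSh_iff[OF \<sigma>(1) pos] bs by (simp add: ordered_partitions_def)
      moreover have "?ns \<in> compositions m ?n"
        using pos sum bs by (auto simp: compositions_def)
      ultimately show ?thesis using \<sigma>(2) by blast
    qed
    ultimately show "(\<lambda>(ns, \<sigma>). shuffle_blocks ns \<sigma>) ` (SIGMA ns:compositions m ?n. oSh ns) = ?P"
      by (force simp: image_iff)
  qed
  have fin2: "finite (ordered_partitions {..<?n})"
    using sum_parts_ordered_partitions(1)[of "[0..<?n]"] by (simp add: lessThan_atLeast0)
  have "(\<Sum>ns\<in>compositions m ?n. \<Sum>\<sigma>\<in>oSh ns. F (split_shuffle ns \<sigma> w)) =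
    (\<Sum>(ns, \<sigma>)\<in>(SIGMA ns:compositions m ?n. oSh ns). ?G (shuffle_blocks ns \<sigma>))"
    unfolding split_shuffle_eq by (rule sum.Sigma) (auto simp: fin finite_compositions)
  also have "\<dots> = (\<Sum>x\<in>(SIGMA ns:compositions m ?n. oSh ns). ?G ((\<lambda>(ns, \<sigma>). shuffle_blocks ns \<sigma>) x))"
    by (simp add: split_def)
  also have "\<dots> = (\<Sum>bs\<in>?P. ?G bs)"
    by (rule sum.reindex_bij_betw[OF bij])
  also have "\<dots> = (\<Sum>bs\<in>ordered_partitions {..<?n}. if length bs = m then ?G bs else 0)"
    by (rule sum.mono_neutral_cong_left) (use fin2 in auto)
  also have "\<dots> = (\<Sum>bs\<leftarrow>parts [0..<?n]. if length bs = m then ?G bs else 0)"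
    by (subst sum_parts_ordered_partitions(2)) (simp_all add: lessThan_atLeast0)
  also have "\<dots> = (\<Sum>bs\<leftarrow>map (map (map ((!) w))) (parts [0..<?n]). if length bs = m then F bs else 0)"
    by (simp add: o_def cong: if_cong)
  finally show ?thesis unfolding map_nth_upt_length .
qed

text \<open>The analogue for two blocks without the condition on last positions. Empty blocks are
  allowed, so deshuffles replace partitions.\<close>

lemma sum_Sh:
  fixes F :: "'a list list \<Rightarrow> 'b::comm_monoid_add"
  assumes ab: "a + b = length w"
  shows "(\<Sum>\<sigma>\<in>Sh [a, b]. F (split_shuffle [a, b] \<sigma> w)) =
    (\<Sum>(u, v)\<leftarrow>splits w. if length u = a then F [u, v] else 0)"
proof -
  let ?n = "length w"
  let ?G = "\<lambda>bs. F (map (map ((!) w)) bs)"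
  have spl: "set (splits [0..<?n]) = {(u, v). sorted_wrt (<) u \<and> sorted_wrt (<) v \<and>
      set u \<inter> set v = {} \<and> set u \<union> set v = {..<?n}}" "distinct (splits [0..<?n])"
    using splits_strict_sorted[of "[0..<?n]"] by (simp_all add: lessThan_atLeast0)
  have img: "bij_betw (\<lambda>(u, v). [u, v]) {(u, v) \<in> set (splits [0..<?n]). length u = a} (shuffle_images [a, b])"
  proof (rule bij_betw_imageI)
    have "length v = b" if "(u, v) \<in> set (splits [0..<?n])" "length u = a" for u v
      using length_splits[OF that(1)] that ab by simp
    then have "(\<lambda>(u, v). [u, v]) ` {(u, v) \<in> set (splits [0..<?n]). length u = a} \<subseteq> shuffle_images [a, b]"
      using ab unfolding spl
      by (auto simp: shuffle_images_def strict_sorted_iff)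
    moreover have "bs \<in> (\<lambda>(u, v). [u, v]) ` {(u, v) \<in> set (splits [0..<?n]). length u = a}"
      if bs: "bs \<in> shuffle_images [a, b]" for bs
    proof -
      have "length (map length bs) = length [a, b]" using bs unfolding shuffle_images_def by simp
      then obtain u v where "bs = [u, v]"
        by (auto simp: numeral_2_eq_2 length_Suc_conv)
      then show ?thesis
        using bs ab unfolding spl by (auto simp: shuffle_images_def)
    qed
    ultimately show "(\<lambda>(u, v). [u, v]) ` {(u, v) \<in> set (splits [0..<?n]). length u = a} = shuffle_images [a, b]"
      by blast
  qed (auto simp: inj_on_def)
  have "(\<Sum>\<sigma>\<in>Sh [a, b]. F (split_shuffle [a, b] \<sigma> w)) = (\<Sum>bs\<in>shuffle_images [a, b]. ?G bs)"
    unfolding split_shuffle_eq by (rule sum.reindex_bij_betw[OF bij_shuffle_blocks])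
  also have "\<dots> = (\<Sum>x\<in>{(u, v) \<in> set (splits [0..<?n]). length u = a}. ?G ((\<lambda>(u, v). [u, v]) x))"
    by (rule sum.reindex_bij_betw[OF img, symmetric])
  also have "\<dots> = (\<Sum>(u, v)\<in>set (splits [0..<?n]). if length u = a then ?G [u, v] else 0)"
    by (rule sum.mono_neutral_cong_left) (auto split: if_splits)
  also have "\<dots> = (\<Sum>(u, v)\<leftarrow>splits [0..<?n]. if length u = a then ?G [u, v] else 0)"
    by (rule sum_list_distinct_conv_sum_set[symmetric]) (rule spl)
  also have "\<dots> = (\<Sum>(u, v)\<leftarrow>splits (map ((!) w) [0..<?n]). if length u = a then F [u, v] else 0)"
    unfolding splits_map by (simp add: split_def o_def cong: if_cong)
  finally show ?thesis by (simp add: map_nth)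
qed

section \<open>Multilinear extension\<close>

lemma words_0 [simp]: "words 0 = {[]}"
  by (auto simp: words_def)

lemma words_Suc: "words (Suc n) = (\<lambda>(b, y). b # y) ` (vbasis \<times> words n)"
  by (auto simp: words_def image_iff length_Suc_conv)

lemma finite_words [simp]: "finite (words n)"
  unfolding words_def using finite_lists_length_eq[OF finite_vbasis] by (simp add: conj_commute)

lemma length_words: "w \<in> words n \<Longrightarrow> length w = n"
  by (simp add: words_def)

lemma sum_words_Suc:
  fixes f :: "'v::fin_dim_normed_vector list \<Rightarrow> 'b::comm_monoid_add"
  shows "(\<Sum>w\<in>words (Suc n). f w) = (\<Sum>b\<in>vbasis. \<Sum>y\<in>words n. f (b # y))"
proof -
  have "inj_on (\<lambda>(b, y). b # y) (vbasis \<times> words n :: ('v \<times> 'v list) set)"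
    by (auto simp: inj_on_def)
  then show ?thesis
    unfolding words_Suc by (simp add: sum.reindex o_def split_def sum.cartesian_product)
qed

abbreviation coord :: "'v::fin_dim_normed_vector \<Rightarrow> 'v \<Rightarrow> real" where
  "coord x b \<equiv> representation vbasis x b"

lemma coord_sum: "(\<Sum>b\<in>vbasis. coord x b *\<^sub>R b) = x"
  by (rule sum_representation_eq) (auto simp: independent_vbasis span_vbasis finite_vbasis)

lemma coord_add: "coord (x + y) b = coord x b + coord y b"
  by (simp add: representation_add independent_vbasis span_vbasis)

lemma coord_scaleR: "coord (c *\<^sub>R x) b = c * coord x b"
  by (simp add: representation_scale independent_vbasis span_vbasis)

lemma linear_coord: "linear (\<lambda>x. coord x b)"
  by (rule linearI) (simp_all add: coord_add coord_scaleR)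

text \<open>The multilinear extension of \<open>F\<close> from words of basis vectors to arbitrary vectors.\<close>

definition multilin :: "('v::fin_dim_normed_vector list \<Rightarrow> 'b::real_vector) \<Rightarrow> 'v list \<Rightarrow> 'b" where
  "multilin F us = pairing (length us) F (pure_tensor us)"

lemma pure_tensor_Cons:
  assumes "y \<in> words (length us)" "b \<in> vbasis"
  shows "pure_tensor (u # us) (b # y) = coord u b * pure_tensor us y"
  using assms unfolding pure_tensor_def
  by (simp add: words_def prod.lessThan_Suc_shift del: prod.lessThan_Suc)

lemma multilin_Nil [simp]: "multilin F [] = F []"
  by (simp add: multilin_def pairing_def pure_tensor_def)

lemma multilin_Cons: "multilin F (u # us) = (\<Sum>b\<in>vbasis. coord u b *\<^sub>R multilin (\<lambda>y. F (b # y)) us)"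
  unfolding multilin_def pairing_def length_Cons sum_words_Suc scaleR_sum_right
  by (intro sum.cong refl) (simp add: pure_tensor_Cons)

lemma multilin_add: "multilin (\<lambda>y. F y + G y) us = multilin F us + multilin G us"
  by (simp add: multilin_def pairing_def scaleR_add_right sum.distrib)

lemma multilin_zero: "multilin (\<lambda>y. 0) us = 0"
  by (simp add: multilin_def pairing_def)

lemma multilin_scaleR: "multilin (\<lambda>y. c *\<^sub>R F y) us = c *\<^sub>R multilin F us"
  by (simp add: multilin_def pairing_def scaleR_sum_right mult.commute)

lemma multilin_sum: "multilin (\<lambda>y. \<Sum>i\<in>A. F i y) us = (\<Sum>i\<in>A. multilin (F i) us)"
  unfolding multilin_def pairing_def scaleR_sum_right by (rule sum.swap)

lemma multilin_sum_list: "multilin (\<lambda>y. \<Sum>i\<leftarrow>xs. F i y) us = (\<Sum>i\<leftarrow>xs. multilin (F i) us)"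
  by (induction xs) (simp_all add: multilin_zero multilin_add)

lemma multilin_append: "multilin F (us @ vs) = multilin (\<lambda>y. multilin (\<lambda>z. F (y @ z)) vs) us"
  by (induction us arbitrary: F) (simp_all add: multilin_Cons)

lemma multilin_snoc: "multilin F (us @ [x]) = multilin (\<lambda>y. \<Sum>b\<in>vbasis. coord x b *\<^sub>R F (y @ [b])) us"
  by (simp add: multilin_append multilin_Cons)

text \<open>The last slot is singled out because partitions are built by appending their last
  block.\<close>

lemma linear_multilin_snoc: "linear (\<lambda>x. multilin F (us @ [x]))"
  unfolding multilin_snoc multilin_sum multilin_scaleR
  by (rule linearI)
    (simp_all add: coord_add coord_scaleR scaleR_add_left sum.distrib scaleR_sum_right)

lemma multilin_snoc_multilin: "multilin G (us @ [multilin F q]) = multilin (\<lambda>y. multilin G (us @ [F y])) q"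
  unfolding multilin_def[of F] multilin_def[of _ q] pairing_def
  by (simp add: linear_sum[OF linear_multilin_snoc] linear_scale[OF linear_multilin_snoc])

lemma multilin_snoc_sum_list:
  "multilin G (us @ [\<Sum>x\<leftarrow>xs. f x]) = (\<Sum>x\<leftarrow>xs. multilin G (us @ [f x]))"
  by (induction xs) (simp_all add: linear_add[OF linear_multilin_snoc] linear_0[OF linear_multilin_snoc])

text \<open>A coordinate of a pure tensor is the multilinear extension of an indicator; in this way
  the lemmas on \<open>multilin\<close> apply to lifts as well as to \<open>star\<close>.\<close>

lemma pure_tensor_eq_multilin:
  assumes "z \<in> words m"
  shows "pure_tensor us z = multilin (\<lambda>y. if y = z then 1 else 0) us"
proof -
  have "multilin (\<lambda>y. if y = z then 1 else 0 :: real) us =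
      (\<Sum>y\<in>words (length us). if y = z then pure_tensor us y else 0)"
    unfolding multilin_def pairing_def by (intro sum.cong) auto
  also have "\<dots> = pure_tensor us z"
    by (simp add: pure_tensor_def)
  finally show ?thesis by simp
qed

lemma multilin_splits:
  "multilin (\<lambda>y. \<Sum>(p, q)\<leftarrow>splits y. F p q) us = (\<Sum>(p, q)\<leftarrow>splits us. multilin (\<lambda>y. multilin (F y) q) p)"
proof (induction us arbitrary: F)
  case (Cons u us)
  have "multilin (\<lambda>y. \<Sum>(p, q)\<leftarrow>splits y. F p q) (u # us) =
    (\<Sum>b\<in>vbasis. coord u b *\<^sub>R ((\<Sum>(p, q)\<leftarrow>splits us. multilin (\<lambda>y. multilin (F (b # y)) q) p) +
      (\<Sum>(p, q)\<leftarrow>splits us. multilin (\<lambda>y. multilin (\<lambda>z. F y (b # z)) q) p)))"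
    by (simp only: multilin_Cons sum_splits_Cons multilin_add Cons.IH)
  also have "\<dots> = (\<Sum>(p, q)\<leftarrow>splits us. \<Sum>b\<in>vbasis. coord u b *\<^sub>R multilin (\<lambda>y. multilin (F (b # y)) q) p) +
      (\<Sum>(p, q)\<leftarrow>splits us. \<Sum>b\<in>vbasis. coord u b *\<^sub>R multilin (\<lambda>y. multilin (\<lambda>z. F y (b # z)) q) p)"
    by (simp add: scaleR_add_right sum.distrib scaleR_sum_list_right sum_sum_list_swap split_def)
  also have "\<dots> = (\<Sum>(p, q)\<leftarrow>splits (u # us). multilin (\<lambda>y. multilin (F y) q) p)"
    by (simp only: sum_splits_Cons multilin_Cons multilin_sum multilin_scaleR)
  finally show ?case .
qed simp

text \<open>Partitions act on positions and the expansion in a basis acts on letters, so the two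
  commute. This is needed for iterated lifts: the second one partitions words of basis vectors of
  the intermediate space, while the blocks of the first produce arbitrary vectors there.\<close>

lemma multilin_parts:
  fixes \<Phi> :: "'u::fin_dim_normed_vector list \<Rightarrow> 'b::real_vector"
  shows "multilin (\<lambda>y. \<Sum>ds\<leftarrow>parts y. multilin \<Phi> (map K ds)) us = (\<Sum>ds\<leftarrow>parts us. multilin \<Phi> (map (multilin K) ds))"
proof (induction us arbitrary: \<Phi> rule: length_induct_snoc)
  case (snoc x us)
  have inner: "(\<Sum>b\<in>vbasis. coord x b *\<^sub>R multilin \<Phi> (vs @ [K (z @ [b])])) =
      multilin \<Phi> (vs @ [multilin (\<lambda>l. K (z @ l)) [x]])" for vs z
    unfolding multilin_snoc_multilin by (simp add: multilin_Cons)
  have "multilin (\<lambda>y. \<Sum>ds\<leftarrow>parts y. multilin \<Phi> (map K ds)) (us @ [x]) =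
    multilin (\<lambda>y. \<Sum>(p, q)\<leftarrow>splits y. \<Sum>b\<in>vbasis. coord x b *\<^sub>R
      (\<Sum>ds\<leftarrow>parts p. multilin \<Phi> (map K ds @ [K (q @ [b])]))) us"
    unfolding multilin_snoc[of _ us] sum_parts_snoc
    by (simp add: sum_sum_list_swap scaleR_sum_list_right split_def)
  also have "\<dots> = multilin (\<lambda>y. \<Sum>(p, q)\<leftarrow>splits y. \<Sum>ds\<leftarrow>parts p.
      multilin \<Phi> (map K ds @ [multilin (\<lambda>l. K (q @ l)) [x]])) us"
    unfolding inner[symmetric] by (simp add: sum_sum_list_swap scaleR_sum_list_right)
  also have "\<dots> = (\<Sum>(p, q)\<leftarrow>splits us. multilin (\<lambda>y. \<Sum>ds\<leftarrow>parts y.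
      multilin \<Phi> (map K ds @ [multilin K (q @ [x])])) p)"
    unfolding multilin_splits multilin_sum_list multilin_append[of K] multilin_snoc_multilin ..
  also have "\<dots> = (\<Sum>(p, q)\<leftarrow>splits us. \<Sum>ds\<leftarrow>parts p. multilin \<Phi> (map (multilin K) ds @ [multilin K (q @ [x])]))"
    unfolding multilin_append[of \<Phi>] by (intro sum_list_cong_splits snoc)
  also have "\<dots> = (\<Sum>ds\<leftarrow>parts (us @ [x]). multilin \<Phi> (map (multilin K) ds))"
    unfolding sum_parts_snoc by simp
  finally show ?case .
qed simp

lemma sum_parts_product_multilin:
  fixes \<Phi> :: "'u::fin_dim_normed_vector list \<Rightarrow> 'b::real_vector"
  shows "(\<Sum>ds\<leftarrow>parts_product bs. multilin \<Phi> (map g ds)) = multilin \<Phi> (map (\<lambda>b. \<Sum>d\<leftarrow>parts b. g d) bs)"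
proof (induction bs arbitrary: \<Phi> rule: rev_induct)
  case (snoc b bs)
  have "(\<Sum>ds\<leftarrow>parts_product (bs @ [b]). multilin \<Phi> (map g ds)) =
    (\<Sum>ds\<leftarrow>parts_product bs. multilin \<Phi> (map g ds @ [\<Sum>d\<leftarrow>parts b. g d]))"
    unfolding sum_parts_product_snoc multilin_snoc_sum_list by simp
  also have "\<dots> = multilin \<Phi> (map (\<lambda>b. \<Sum>d\<leftarrow>parts b. g d) (bs @ [b]))"
    unfolding multilin_append[of \<Phi>] snoc.IH by (simp add: multilin_append)
  finally show ?case .
qed simp

section \<open>Ordered coproducts, \<open>star\<close> and the Leibniz product as sums over
  partitions and deshuffles\<close>

lemma listset_iff_list_all2: "xs \<in> listset As \<longleftrightarrow> list_all2 (\<in>) xs As"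
  by (induction As arbitrary: xs) (auto simp: set_Cons_def list_all2_Cons2)

lemma split_shuffle_in_listset:
  assumes "\<sigma> \<in> Sh ns" "w \<in> words (sum_list ns)"
  shows "split_shuffle ns \<sigma> w \<in> listset (map words ns)"
proof -
  have p: "\<sigma> permutes {..<sum_list ns}" using assms by (simp add: Sh_def)
  have "w ! \<sigma> i \<in> vbasis" if "j < length ns" "i < offset ns j + ns ! j" for i j
  proof -
    have "i < sum_list ns" using that offset_le[of ns "Suc j"] by (simp add: offset_Suc)
    then have "\<sigma> i < length w"
      using permutes_in_image[OF p, of i] assms(2) by (simp add: words_def)
    then have "w ! \<sigma> i \<in> set w" by simp
    then show ?thesis using assms(2) by (auto simp: words_def)
  qed
  then show ?thesis
    unfolding listset_iff_list_all2
    by (auto simp: list_all2_conv_all_nth split_shuffle_def words_def offset_Suc)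
qed

lemma finite_set_Cons: "finite A \<Longrightarrow> finite B \<Longrightarrow> finite (set_Cons A B)"
proof -
  have "set_Cons A B = (\<lambda>(x, xs). x # xs) ` (A \<times> B)" by (auto simp: set_Cons_def)
  then show "finite A \<Longrightarrow> finite B \<Longrightarrow> finite (set_Cons A B)" by simp
qed

lemma ext_map_coshuffle:
  assumes S: "S \<subseteq> Sh ns"
  shows "ext_map ns h (coshuffle S ns a) y =
    (\<Sum>w\<in>words (sum_list ns). a w * (\<Sum>\<sigma>\<in>S. pure_tensor (map h (split_shuffle ns \<sigma> w)) y))"
proof -
  have finS: "finite S" using S finite_Sh by (rule finite_subset)
  have fin: "finite (listset (map words ns))" by (induction ns) (auto simp: finite_set_Cons)
  have "ext_map ns h (coshuffle S ns a) y =
    (\<Sum>ws\<in>listset (map words ns). \<Sum>w\<in>words (sum_list ns). \<Sum>\<sigma>\<in>S.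
      if split_shuffle ns \<sigma> w = ws then a w * pure_tensor (map h ws) y else 0)"
    unfolding ext_map_def coshuffle_def sum_distrib_right by (intro sum.cong refl) auto
  also have "\<dots> = (\<Sum>w\<in>words (sum_list ns). \<Sum>\<sigma>\<in>S. \<Sum>ws\<in>listset (map words ns).
      if split_shuffle ns \<sigma> w = ws then a w * pure_tensor (map h ws) y else 0)"
    by (subst sum.swap) (intro sum.cong refl sum.swap)
  \<comment> \<open>Exactly one \<open>ws\<close> matches a given shuffle, and it lies in the index
    set because a shuffle only permutes the letters of \<open>w\<close>.\<close>
  also have "\<dots> = (\<Sum>w\<in>words (sum_list ns). \<Sum>\<sigma>\<in>S. a w * pure_tensor (map h (split_shuffle ns \<sigma> w)) y)"
    using S split_shuffle_in_listset by (intro sum.cong refl) (auto simp: fin)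
  finally show ?thesis by (simp add: sum_distrib_left)
qed

lemma sum_ext_map_Delta_osh:
  "(\<Sum>ns\<in>compositions m n. ext_map ns h (Delta_osh ns a) y) =
    (\<Sum>w\<in>words n. a w * (\<Sum>bs\<leftarrow>parts w. if length bs = m then pure_tensor (map h bs) y else 0))"
proof -
  have "(\<Sum>ns\<in>compositions m n. ext_map ns h (Delta_osh ns a) y) =
    (\<Sum>ns\<in>compositions m n. \<Sum>w\<in>words n. a w * (\<Sum>\<sigma>\<in>oSh ns. pure_tensor (map h (split_shuffle ns \<sigma> w)) y))"
    unfolding Delta_osh_def
    by (intro sum.cong refl, subst ext_map_coshuffle) (auto simp: oSh_def compositions_def)
  also have "\<dots> = (\<Sum>w\<in>words n. a w * (\<Sum>ns\<in>compositions m (length w). \<Sum>\<sigma>\<in>oSh ns. pure_tensor (map h (split_shuffle ns \<sigma> w)) y))"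
    by (subst sum.swap) (simp add: sum_distrib_left length_words)
  finally show ?thesis
    unfolding sum_oSh[where F = "\<lambda>bs. pure_tensor (map h bs) y"] .
qed

text \<open>The case distinction in \<open>star\<close> disappears: the empty word has the empty
  partition alone, contributing \<open>K t []\<close>, and a partition of any other word has between
  one and \<open>length w\<close> blocks.\<close>

lemma star_eq_parts:
  assumes w: "w \<in> words n"
  shows "star K H t w = (\<Sum>bs\<leftarrow>parts w. multilin (K t) (map (H t) bs))"
proof (cases "w = []")
  case False
  have ext: "(\<Sum>ns\<in>compositions m (length w). ext_map ns (H t) (Delta_osh ns (basis_tensor w)) y) =
    (\<Sum>bs\<leftarrow>parts w. if length bs = m then pure_tensor (map (H t) bs) y else 0)" for m y
    unfolding sum_ext_map_Delta_osh basis_tensor_def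
    using w by (simp add: length_words if_distrib[of "\<lambda>x. x * _"] cong: if_cong)
  have "pairing m (K t) (\<lambda>y. \<Sum>ns\<in>compositions m (length w). ext_map ns (H t) (Delta_osh ns (basis_tensor w)) y) =
    (\<Sum>bs\<leftarrow>parts w. if length bs = m then multilin (K t) (map (H t) bs) else 0)" for m
  proof -
    have "(\<Sum>y\<in>words m. (\<Sum>bs\<leftarrow>xs. if length bs = m then pure_tensor (map (H t) bs) y else 0) *\<^sub>R K t y) =
      (\<Sum>bs\<leftarrow>xs. if length bs = m then multilin (K t) (map (H t) bs) else 0)" for xs
      by (induction xs) (simp_all add: scaleR_add_left sum.distrib multilin_def pairing_def)
    then show ?thesis unfolding ext pairing_def .
  qed
  moreover have "pairing m (K t) (\<lambda>y. \<Sum>ns\<in>A. g ns y) = (\<Sum>ns\<in>A. pairing m (K t) (g ns))" for m A and g :: "nat list \<Rightarrow> _"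
    unfolding pairing_def scaleR_sum_left by (rule sum.swap)
  ultimately have "star K H t w = (\<Sum>m=1..length w. \<Sum>bs\<leftarrow>parts w. if length bs = m then multilin (K t) (map (H t) bs) else 0)"
    using False by (simp add: star_def compositions_def)
  also have "\<dots> = (\<Sum>bs\<leftarrow>parts w. \<Sum>m=1..length w. if length bs = m then multilin (K t) (map (H t) bs) else 0)"
    by (rule sum_sum_list_swap)
  also have "\<dots> = (\<Sum>bs\<leftarrow>parts w. multilin (K t) (map (H t) bs))"
  proof (rule sum_list_cong)
    fix bs assume bs: "bs \<in> set (parts w)"
    have "length bs \<in> {1..length w}"
      using partsD(1,5)[OF bs] False by (simp add: Suc_le_eq)
    then show "(\<Sum>m=1..length w. if length bs = m then multilin (K t) (map (H t) bs) else 0) = multilin (K t) (map (H t) bs)"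
      by simp
  qed
  finally show ?thesis .
qed (simp add: star_def)

lemma Delta_sh_basis:
  assumes w: "w \<in> words (a + b)"
  shows "Delta_sh a b (basis_tensor w) us = (\<Sum>(p, q)\<leftarrow>splits w. if length p = a \<and> [p, q] = us then 1 else 0)"
proof -
  have "Delta_sh a b (basis_tensor w) us = (\<Sum>\<sigma>\<in>Sh [a, b]. if split_shuffle [a, b] \<sigma> w = us then 1 else 0)"
  proof -
    have "(\<Sum>v\<in>words (a + b). if split_shuffle [a, b] \<sigma> v = us then if v = w then 1 else 0 else 0) =
      (\<Sum>v\<in>words (a + b). if v = w then if split_shuffle [a, b] \<sigma> w = us then 1 else 0 else 0 :: real)" for \<sigma>
      by (intro sum.cong) auto
    then show ?thesis
      unfolding Delta_sh_def coshuffle_def basis_tensor_def by (subst sum.swap) (simp add: w)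
  qed
  also have "\<dots> = (\<Sum>(p, q)\<leftarrow>splits w. if length p = a then if [p, q] = us then 1 else 0 else 0)"
    by (rule sum_Sh[where F = "\<lambda>ws. if ws = us then 1 else 0"]) (use w in \<open>simp add: words_def\<close>)
  finally show ?thesis by (simp add: if_if_eq_conj)
qed

lemma leibniz_eq_splits:
  fixes K :: "real \<Rightarrow> 'v::fin_dim_normed_vector list \<Rightarrow> 'b::real_normed_vector \<Rightarrow>\<^sub>L 'c::real_normed_vector"
    and H :: "real \<Rightarrow> 'v list \<Rightarrow> 'a::real_normed_vector \<Rightarrow>\<^sub>L 'b"
  assumes w: "w \<in> words n"
  shows "leibniz K H t w = (\<Sum>(u, v)\<leftarrow>splits w. K t u o\<^sub>L H t v)"
proof -
  \<comment> \<open>A coefficient of the coproduct counts the deshuffles that give the pair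
    \<open>u\<close>, \<open>v\<close>, so summing over all pairs of words restores a sum over
    deshuffles. Stated for an arbitrary list \<open>xs\<close> to allow induction.\<close>
  have pick: "(\<Sum>u\<in>words a. \<Sum>v\<in>words b.
      (\<Sum>(p, q)\<leftarrow>xs. if length p = a \<and> [p, q] = [u, v] then 1 else 0) *\<^sub>R f u v) =
     (\<Sum>(p, q)\<leftarrow>xs. if length p = a then f p q else 0)"
    if "\<forall>(p, q)\<in>set xs. length p = a \<longrightarrow> p \<in> words a \<and> q \<in> words b"
    for a b xs and f :: "'v list \<Rightarrow> 'v list \<Rightarrow> 'a \<Rightarrow>\<^sub>L 'c"
    using that
  proof (induction xs)
    case (Cons x xs)
    obtain p q where x: "x = (p, q)" by fastforce
    have ind: "(\<Sum>v\<in>words n. (if r = v then 1 else 0) *\<^sub>R g v) = (if r \<in> words n then g r else 0)"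
      for n r and g :: "'v list \<Rightarrow> 'a \<Rightarrow>\<^sub>L 'c"
      by (simp add: if_distrib[of "\<lambda>c. c *\<^sub>R _"] cong: if_cong)
    have "(\<Sum>u\<in>words a. \<Sum>v\<in>words b. (if length p = a \<and> [p, q] = [u, v] then 1 else 0) *\<^sub>R f u v) =
        (if length p = a then \<Sum>u\<in>words a. (if p = u then 1 else 0) *\<^sub>R (\<Sum>v\<in>words b. (if q = v then 1 else 0) *\<^sub>R f u v) else 0)"
      by (auto intro!: sum.cong)
    also have "\<dots> = (if length p = a then f p q else 0)"
      unfolding ind using Cons.prems by (simp add: x)
    finally have *: "(\<Sum>u\<in>words a. \<Sum>v\<in>words b. (if length p = a \<and> [p, q] = [u, v] then 1 else 0) *\<^sub>R f u v) =
        (if length p = a then f p q else 0)" .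
    have IH: "(\<Sum>u\<in>words a. \<Sum>v\<in>words b.
        (\<Sum>(p, q)\<leftarrow>xs. if length p = a \<and> [p, q] = [u, v] then 1 else 0) *\<^sub>R f u v) =
       (\<Sum>(p, q)\<leftarrow>xs. if length p = a then f p q else 0)"
      by (rule Cons.IH) (use Cons.prems in simp)
    show ?case
      unfolding x list.map sum_list.Cons split scaleR_add_left sum.distrib * IH ..
  qed simp
  have fin: "finite {(a, b). a + b = length w}"
    by (rule finite_subset[of _ "{..length w} \<times> {..length w}"]) auto
  have "leibniz K H t w = (\<Sum>(a, b) | a + b = length w. \<Sum>(p, q)\<leftarrow>splits w.
      if length p = a then K t p o\<^sub>L H t q else 0)"
    unfolding leibniz_def
  proof (intro sum.cong refl, clarify)
    fix a b assume ab: "a + b = length w"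
    then have w': "w \<in> words (a + b)" using w by (simp add: words_def)
    show "(\<Sum>u\<in>words a. \<Sum>v\<in>words b. Delta_sh a b (basis_tensor w) [u, v] *\<^sub>R (K t u o\<^sub>L H t v)) =
      (\<Sum>(p, q)\<leftarrow>splits w. if length p = a then K t p o\<^sub>L H t q else 0)"
      unfolding Delta_sh_basis[OF w']
    proof (rule pick, clarify)
      fix p q assume pq: "(p, q) \<in> set (splits w)" "a = length p"
      then show "p \<in> words (length p) \<and> q \<in> words b"
        using length_splits[OF pq(1)] set_splits[OF pq(1)] ab w by (auto simp: words_def)
    qed
  qed
  also have "\<dots> = (\<Sum>(p, q)\<leftarrow>splits w. \<Sum>(a, b) | a + b = length w.
      if length p = a then K t p o\<^sub>L H t q else 0)"
    unfolding split_def by (rule sum_sum_list_swap)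
  also have "\<dots> = (\<Sum>(p, q)\<leftarrow>splits w. K t p o\<^sub>L H t q)"
  proof (rule sum_list_cong, clarify)
    fix p q assume pq: "(p, q) \<in> set (splits w)"
    have "(\<Sum>(a, b) | a + b = length w. if length p = a then K t p o\<^sub>L H t q else 0) =
      (\<Sum>x\<in>{(a, b). a + b = length w}. if x = (length p, length q) then K t p o\<^sub>L H t q else 0)"
      using length_splits[OF pq] by (intro sum.cong) (auto split: if_splits)
    then show "(\<Sum>(a, b) | a + b = length w. if length p = a then K t p o\<^sub>L H t q else 0) = K t p o\<^sub>L H t q"
      using length_splits[OF pq] by (simp add: fin)
  qed
  finally show ?thesis .
qed

section \<open>The algebraic identity behind the theorem\<close>

lemma controlled_integral_Nil [simp]: "controlled_integral H I t [] = I t"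
  by (simp add: controlled_integral_def)

lemma controlled_integral_snoc [simp]: "controlled_integral H I t (w @ [e]) = blinfun_apply (H t w) e"
  by (simp add: controlled_integral_def uncurry_last_def)

lemma blinfun_apply_sum_list: "blinfun_apply (\<Sum>x\<leftarrow>xs. f x) e = (\<Sum>x\<leftarrow>xs. blinfun_apply (f x) e)"
  by (induction xs) (simp_all add: blinfun.add_left blinfun.zero_left)

lemma blinfun_apply_multilin: "blinfun_apply (multilin F us) e = multilin (\<lambda>y. blinfun_apply (F y) e) us"
  by (simp add: multilin_def pairing_def blinfun.sum_left blinfun.scaleR_left)

text \<open>Integrands take values in linear maps, so the last slot accepts an arbitrary vector
  although words carry basis vectors only.\<close>

lemma multilin_controlled_integral:
  "multilin (controlled_integral K J t) (us @ [x]) = blinfun_apply (multilin (K t) us) x"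
proof -
  have "blinfun_apply (multilin (K t) us) x = blinfun_apply (multilin (K t) us) (\<Sum>b\<in>vbasis. coord x b *\<^sub>R b)"
    by (simp add: coord_sum)
  also have "\<dots> = (\<Sum>b\<in>vbasis. coord x b *\<^sub>R multilin (\<lambda>y. blinfun_apply (K t y) b) us)"
    by (simp add: blinfun.sum_right blinfun.scaleR_right blinfun_apply_multilin)
  finally show ?thesis
    by (simp add: multilin_snoc multilin_sum multilin_scaleR)
qed

lemma words_splits: "(u, v) \<in> set (splits w) \<Longrightarrow> w \<in> words n \<Longrightarrow> u \<in> words (length u) \<and> v \<in> words (length v)"
  using set_splits by (fastforce simp: words_def)

text \<open>The last block \<open>v @ [e]\<close> contributes the vector \<open>H t v e\<close>,
  into which the value of \<open>K\<close> on the other blocks is applied. The identity is pointwise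
  in \<open>t\<close> and in every positive degree; the empty word is left to the analytic
  comparison of the traces.\<close>

lemma star_controlled_integral:
  assumes w: "w \<in> words n" "w \<noteq> []"
  shows "star (controlled_integral K J) (controlled_integral H I) t w =
    uncurry_last (leibniz (star K (controlled_integral H I)) H t) w"
proof -
  obtain x e where x: "w = x @ [e]" using w(2) by (cases w rule: rev_cases) auto
  have xw: "x \<in> words (length x)" using w unfolding x by (auto simp: words_def)
  have "star (controlled_integral K J) (controlled_integral H I) t w =
      (\<Sum>(u, v)\<leftarrow>splits x. \<Sum>bs\<leftarrow>parts u. blinfun_apply
        (multilin (K t) (map (controlled_integral H I t) bs)) (blinfun_apply (H t v) e))"
    unfolding star_eq_parts[OF w(1)] unfolding x sum_parts_snoc
    by (simp add: multilin_controlled_integral)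
  also have "\<dots> = (\<Sum>(u, v)\<leftarrow>splits x. blinfun_apply (star K (controlled_integral H I) t u) (blinfun_apply (H t v) e))"
    by (intro sum_list_cong) (auto simp: star_eq_parts[OF conjunct1[OF words_splits[OF _ xw]]] blinfun_apply_sum_list)
  also have "\<dots> = uncurry_last (leibniz (star K (controlled_integral H I)) H t) w"
    by (simp add: x uncurry_last_def leibniz_eq_splits[OF xw] blinfun_apply_sum_list split_def)
  finally show ?thesis .
qed

section \<open>Local expansions\<close>

text \<open>The induction adds one vector \<open>a\<close> at a time. It relies on completeness of
  the real coefficients and on neither an inner product nor completeness of the space.\<close>

lemma independent_coefficients_bounded:
  fixes B :: "'v::real_normed_vector set"
  assumes "finite B" "independent B"
  shows "\<exists>C\<ge>0. \<forall>c. \<forall>b\<in>B. \<bar>c b\<bar> \<le> C * norm (\<Sum>b\<in>B. c b *\<^sub>R b)"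
  using assms
proof (induction B rule: finite_induct)
  case (insert a B)
  have a: "a \<notin> span B" and ind: "independent B"
    using insert.prems insert.hyps by (auto simp: independent_insert)
  obtain C where C: "C \<ge> 0" "\<And>c b. b \<in> B \<Longrightarrow> \<bar>c b\<bar> \<le> C * norm (\<Sum>b\<in>B. c b *\<^sub>R b)"
    using insert.IH[OF ind] by blast
  \<comment> \<open>The span of \<open>B\<close> keeps a positive distance from \<open>-a\<close>:
    by the induction hypothesis, a sequence in the span that converges to \<open>-a\<close> would
    have Cauchy coefficients, and its limit would lie in the span.\<close>
  have "\<exists>\<delta>>0. \<forall>y\<in>span B. \<delta> \<le> norm (a + y)"
  proof (rule ccontr)
    assume "\<not> ?thesis"
    then have "\<forall>n. \<exists>y\<in>span B. norm (a + y) < inverse (real (Suc n))"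
      by (force simp: not_le)
    then obtain y where y: "\<And>n. y n \<in> span B" "\<And>n. norm (a + y n) < inverse (real (Suc n))"
      by metis
    have "\<exists>c. y n = (\<Sum>b\<in>B. c b *\<^sub>R b)" for n
      using y(1)[of n] span_finite[OF insert.hyps(1)] by auto
    then obtain c where c: "\<And>n. y n = (\<Sum>b\<in>B. c n b *\<^sub>R b)" by metis
    have "(\<lambda>n. a + y n) \<longlonglongrightarrow> 0"
      by (rule Lim_null_comparison[OF _ LIMSEQ_inverse_real_of_nat]) (use y(2) in \<open>auto intro!: always_eventually less_imp_le\<close>)
    then have ylim: "y \<longlonglongrightarrow> - a"
      using tendsto_add[of "\<lambda>n. a + y n" 0 sequentially "\<lambda>_. - a" "- a"] by simp
    then have Cy: "Cauchy y" by (rule LIMSEQ_imp_Cauchy)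
    have "convergent (\<lambda>n. c n b)" if b: "b \<in> B" for b
    proof (rule real_Cauchy_convergent, rule CauchyI)
      fix e :: real assume "0 < e"
      then have "0 < e / (C + 1)" using C(1) by simp
      then obtain M where M: "\<And>m n. m \<ge> M \<Longrightarrow> n \<ge> M \<Longrightarrow> norm (y m - y n) < e / (C + 1)"
        using CauchyD[OF Cy] by blast
      show "\<exists>M. \<forall>m\<ge>M. \<forall>n\<ge>M. norm (c m b - c n b) < e"
      proof (intro exI allI impI)
        fix m n assume mn: "M \<le> m" "M \<le> n"
        have "norm (c m b - c n b) \<le> C * norm (y m - y n)"
          using C(2)[OF b, of "\<lambda>b. c m b - c n b"] by (simp add: c scaleR_diff_left sum_subtractf)
        also have "\<dots> \<le> (C + 1) * norm (y m - y n)" by (simp add: mult_right_mono)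
        also have "\<dots> < (C + 1) * (e / (C + 1))"
          using M[OF mn] C(1) by (intro mult_strict_left_mono) auto
        also have "\<dots> = e" using C(1) by simp
        finally show "norm (c m b - c n b) < e" .
      qed
    qed
    then obtain l where l: "\<And>b. b \<in> B \<Longrightarrow> (\<lambda>n. c n b) \<longlonglongrightarrow> l b"
      unfolding convergent_def by metis
    have "y \<longlonglongrightarrow> (\<Sum>b\<in>B. l b *\<^sub>R b)"
      unfolding c by (intro tendsto_intros l)
    then have "- a = (\<Sum>b\<in>B. l b *\<^sub>R b)" using ylim LIMSEQ_unique by blast
    also have "\<dots> \<in> span B" by (intro span_sum span_scale span_base)
    finally show False using a span_neg[of "- a" B] by simp
  qed
  then obtain \<delta> where \<delta>: "\<delta> > 0" "\<And>y. y \<in> span B \<Longrightarrow> \<delta> \<le> norm (a + y)" by blast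
  \<comment> \<open>The first summand bounds the coefficient of \<open>a\<close>, the second is
    \<open>C\<close> times the factor by which the part of \<open>x\<close> along \<open>B\<close>
    can exceed \<open>x\<close> in norm.\<close>
  define D where "D = 1 / \<delta> + C * (1 + norm a / \<delta>)"
  have "\<bar>c b\<bar> \<le> D * norm (\<Sum>b\<in>insert a B. c b *\<^sub>R b)" if b: "b \<in> insert a B" for c b
  proof -
    define y where "y = (\<Sum>b\<in>B. c b *\<^sub>R b)"
    define x where "x = (\<Sum>b\<in>insert a B. c b *\<^sub>R b)"
    have x: "x = c a *\<^sub>R a + y" using insert.hyps by (simp add: x_def y_def)
    have ysp: "y \<in> span B" unfolding y_def by (intro span_sum span_scale span_base)
    have ca: "\<bar>c a\<bar> \<le> norm x / \<delta>"
    proof (cases "c a = 0")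
      case False
      have "\<delta> \<le> norm (a + (1 / c a) *\<^sub>R y)" by (intro \<delta> span_scale ysp)
      then have "\<bar>c a\<bar> * \<delta> \<le> norm (c a *\<^sub>R (a + (1 / c a) *\<^sub>R y))"
        by (simp add: mult_left_mono)
      also have "\<dots> = norm x" using False by (simp add: x scaleR_add_right)
      finally show ?thesis using \<delta>(1) by (simp add: field_simps)
    qed (use \<delta> in simp)
    have "norm y \<le> norm x + \<bar>c a\<bar> * norm a"
      using norm_triangle_ineq4[of x "c a *\<^sub>R a"] by (simp add: x)
    also have "\<dots> \<le> norm x + norm x / \<delta> * norm a" 
      using mult_right_mono[OF ca, of "norm a"] by simp
    finally have ny: "norm y \<le> norm x * (1 + norm a / \<delta>)" by (simp add: field_simps)
    have D: "1 / \<delta> \<le> D" "C * (1 + norm a / \<delta>) \<le> D" using C(1) \<delta>(1) by (auto simp: D_def)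
    show ?thesis
    proof (cases "b = a")
      case True
      have "\<bar>c a\<bar> \<le> (1 / \<delta>) * norm x" using ca by simp
      also have "\<dots> \<le> D * norm x" using D(1) by (rule mult_right_mono) simp
      finally show ?thesis using True x_def by simp
    next
      case False
      then have "\<bar>c b\<bar> \<le> C * norm y" using C(2)[of b c] b by (simp add: y_def)
      also have "\<dots> \<le> C * (norm x * (1 + norm a / \<delta>))" using ny C(1) by (rule mult_left_mono)
      also have "\<dots> = C * (1 + norm a / \<delta>) * norm x" by simp
      also have "\<dots> \<le> D * norm x" using D(2) by (rule mult_right_mono) simp
      finally show ?thesis using x_def by simp
    qed
  qed
  moreover have "D \<ge> 0" using C(1) \<delta>(1) by (simp add: D_def)
  ultimately show ?case by blast
qed auto

lemma bounded_linear_coord: "bounded_linear (\<lambda>x. coord x b)"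
proof (cases "b \<in> vbasis")
  case True
  obtain C where "C \<ge> 0" "\<And>c b. b \<in> vbasis \<Longrightarrow> \<bar>c b\<bar> \<le> C * norm (\<Sum>b\<in>vbasis. c b *\<^sub>R b :: 'a)"
    using independent_coefficients_bounded[OF finite_vbasis independent_vbasis] by blast
  from this(2)[OF True, of "\<lambda>b. coord _ b"] show ?thesis
    by (intro bounded_linear_intro[where K = C])
      (simp_all add: coord_add coord_scaleR coord_sum mult.commute)
next
  case False
  then have "(\<lambda>x. coord x b) = (\<lambda>x. 0)"
    using representation_ne_zero by blast
  then show ?thesis by (simp add: bounded_linear_zero)
qed

lemma compact_triangle: "compact (triangle T)"
proof -
  have "triangle T = ({0..T} \<times> {0..T}) \<inter> {x. fst x \<le> snd x}"
    by (auto simp: triangle_def)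
  moreover have "closed {x :: real \<times> real. fst x \<le> snd x}"
    by (intro closed_Collect_le continuous_intros)
  ultimately show ?thesis by (simp add: compact_Int_closed compact_Times)
qed

section \<open>Pairings with a truncated tensor series\<close>

definition wordsle :: "nat \<Rightarrow> 'v::fin_dim_normed_vector list set" where
  "wordsle n = {w. set w \<subseteq> vbasis \<and> length w \<le> n}"

lemma wordsle_eq: "wordsle n = (\<Union>k\<le>n. words k)"
  by (auto simp: wordsle_def words_def)

lemma finite_wordsle [simp]: "finite (wordsle n)"
  by (simp add: wordsle_def finite_lists_length_le finite_vbasis)

lemma sum_wordsle: "(\<Sum>w\<in>wordsle n. f w) = (\<Sum>k\<le>n. \<Sum>w\<in>words k. f w)"
  unfolding wordsle_eq by (rule sum.UNION_disjoint) (auto dest: length_words)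

lemma words_subset_wordsle: "k \<le> n \<Longrightarrow> words k \<subseteq> wordsle n"
  by (auto simp: words_def wordsle_def)

text \<open>The pairing of \<open>F\<close> with the truncation of \<open>X\<close> at degree
  \<open>n\<close>. All local expansions are brought to this form.\<close>

definition tensor_sum :: "'v::fin_dim_normed_vector tensor \<Rightarrow> nat \<Rightarrow> ('v list \<Rightarrow> 'b::real_vector) \<Rightarrow> 'b" where
  "tensor_sum X n F = (\<Sum>w\<in>wordsle n. X w *\<^sub>R F w)"

lemma sum_list_eq_sum_count:
  fixes f :: "'a \<Rightarrow> 'b::real_vector"
  assumes "finite D" "set xs \<subseteq> D"
  shows "(\<Sum>x\<leftarrow>xs. f x) = (\<Sum>x\<in>D. real (count_list xs x) *\<^sub>R f x)"
  using assms(2)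
proof (induction xs)
  case (Cons a xs)
  have "(\<Sum>x\<in>D. real (count_list (a # xs) x) *\<^sub>R f x) =
      (\<Sum>x\<in>D. (if x = a then f x else 0) + real (count_list xs x) *\<^sub>R f x)"
    by (intro sum.cong) (auto simp: scaleR_add_left)
  then show ?case using Cons assms(1) by (simp add: sum.distrib)
qed simp

text \<open>In coordinates the coproduct is described by multiplicities in \<open>splits\<close>;
  the shuffle relation then writes a product of two coordinates of \<open>X\<close> as a linear
  combination of coordinates.\<close>

lemma Delta_sh_eq_count:
  assumes "length u = a"
  shows "Delta_sh a b A [u, v] = (\<Sum>w\<in>words (a + b). A w * real (count_list (splits w) (u, v)))"
proof -
  have cnt: "(\<Sum>x\<leftarrow>xs. if x = z then c else 0) = c * real (count_list xs z)" for xs :: "('a list \<times> 'a list) list" and z and c :: real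
    by (induction xs) (simp_all add: distrib_left)
  have "(\<Sum>\<sigma>\<in>Sh [a, b]. if split_shuffle [a, b] \<sigma> w = [u, v] then A w else 0) =
      A w * real (count_list (splits w) (u, v))" if w: "w \<in> words (a + b)" for w
  proof -
    have "(\<Sum>\<sigma>\<in>Sh [a, b]. if split_shuffle [a, b] \<sigma> w = [u, v] then A w else 0) =
        (\<Sum>(p, q)\<leftarrow>splits w. if length p = a then if [p, q] = [u, v] then A w else 0 else 0)"
      by (rule sum_Sh[where F = "\<lambda>ws. if ws = [u, v] then A w else 0"]) (simp add: length_words[OF w])
    also have "\<dots> = (\<Sum>x\<leftarrow>splits w. if x = (u, v) then A w else 0)"
      using assms by (intro sum_list_cong) (auto split: if_splits)
    finally show ?thesis by (simp add: cnt)
  qed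
  then show ?thesis
    unfolding Delta_sh_def coshuffle_def by (auto intro!: sum.cong)
qed

lemma words_append_image: "words (k + n) = (\<lambda>(v, w). v @ w) ` (words k \<times> words n)"
proof -
  have "w \<in> (\<lambda>(v, w). v @ w) ` (words k \<times> words n)" if "w \<in> words (k + n)" for w :: "'a list"
    using that set_take_subset[of k w] set_drop_subset[of k w]
    by (intro image_eqI[of _ _ "(take k w, drop k w)"]) (auto simp: words_def)
  then show ?thesis by (auto simp: words_def)
qed

lemma pairing_tensor_prod_component:
  "pairing (n + k) h (tensor_prod (component k A) a) =
    (\<Sum>v\<in>words k. \<Sum>w\<in>words n. (A v * a w) *\<^sub>R h (v @ w))"
proof -
  have inj: "inj_on (\<lambda>(v, w). v @ w) (words k \<times> words n)"
    by (auto simp: inj_on_def words_def)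
  have prod: "tensor_prod (component k A) a (v @ w) = A v * a w"
    if v: "v \<in> words k" for v w
  proof -
    have "tensor_prod (component k A) a (v @ w) =
        (\<Sum>i\<le>length (v @ w). if i = k then A v * a w else 0)"
      unfolding tensor_prod_def
    proof (intro sum.cong refl)
      fix i assume i: "i \<in> {..length (v @ w)}"
      have "take i (v @ w) \<notin> words k" if "i \<noteq> k" using that i by (auto simp: words_def)
      then show "component k A (take i (v @ w)) * a (drop i (v @ w)) = (if i = k then A v * a w else 0)"
        using v by (auto simp: component_def length_words)
    qed
    then show ?thesis using v by (simp add: length_words)
  qed
  have "pairing (n + k) h (tensor_prod (component k A) a) =
      (\<Sum>(v, w)\<in>words k \<times> words n. tensor_prod (component k A) a (v @ w) *\<^sub>R h (v @ w))"
    unfolding pairing_def add.commute[of n] words_append_image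
    by (subst sum.reindex[OF inj]) (simp add: o_def split_def)
  also have "\<dots> = (\<Sum>v\<in>words k. \<Sum>w\<in>words n. (A v * a w) *\<^sub>R h (v @ w))"
    unfolding sum.cartesian_product[symmetric] by (intro sum.cong refl) (simp add: prod)
  finally show ?thesis .
qed

text \<open>Brings the expansion in the definition of a controlled path to the form
  \<open>tensor_sum\<close>.\<close>

lemma sum_pairing_tensor_prod:
  "(\<Sum>k=0..M. pairing (n + k) h (tensor_prod (component k A) a)) =
    (\<Sum>w\<in>words n. a w *\<^sub>R tensor_sum A M (\<lambda>v. h (v @ w)))"
proof -
  have "(\<Sum>w\<in>words n. a w *\<^sub>R tensor_sum A M (\<lambda>v. h (v @ w))) =
    (\<Sum>w\<in>words n. \<Sum>k=0..M. \<Sum>v\<in>words k. (A v * a w) *\<^sub>R h (v @ w))"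
    by (simp add: tensor_sum_def sum_wordsle scaleR_sum_right mult.commute atLeast0AtMost)
  also have "\<dots> = (\<Sum>k=0..M. \<Sum>v\<in>words k. \<Sum>w\<in>words n. (A v * a w) *\<^sub>R h (v @ w))"
    by (subst sum.swap) (intro sum.cong refl sum.swap)
  finally show ?thesis by (simp add: pairing_tensor_prod_component)
qed

lemma tensor_sum_cong:
  "(\<And>w. w \<in> wordsle M \<Longrightarrow> F w = G w) \<Longrightarrow> tensor_sum X M F = tensor_sum X M G"
  by (simp add: tensor_sum_def)

lemma tensor_sum_split_Nil:
  "tensor_sum X M F = X [] *\<^sub>R F [] + (\<Sum>w\<in>wordsle M - {[]}. X w *\<^sub>R F w)"
  unfolding tensor_sum_def by (rule sum.remove[OF finite_wordsle]) (simp add: wordsle_def)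

lemma tensor_sum_sum_list: "tensor_sum X M (\<lambda>w. \<Sum>x\<leftarrow>xs. F x w) = (\<Sum>x\<leftarrow>xs. tensor_sum X M (F x))"
  by (simp add: tensor_sum_def scaleR_sum_list_right sum_sum_list_swap)

lemma multilin_snoc_tensor_sum:
  "multilin G (us @ [tensor_sum X M F]) = tensor_sum X M (\<lambda>w. multilin G (us @ [F w]))"
  unfolding tensor_sum_def
  by (simp add: linear_sum[OF linear_multilin_snoc] linear_scale[OF linear_multilin_snoc])

lemma sum_pure_tensor_eq_multilin:
  assumes "length us \<le> M"
  shows "(\<Sum>y\<in>wordsle M. pure_tensor us y *\<^sub>R G y) = multilin G us"
  unfolding multilin_def pairing_def
  by (rule sum.mono_neutral_right) (use assms words_subset_wordsle in \<open>auto simp: pure_tensor_def\<close>)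

text \<open>A partition has at most as many blocks as the word has letters, so truncating the
  intermediate tensors at degree \<open>M\<close> loses nothing.\<close>

lemma tensor_sum_pure_parts:
  assumes "w \<in> wordsle M"
  shows "(\<Sum>y\<in>wordsle M. (\<Sum>bs\<leftarrow>parts w. pure_tensor (map h bs) y) *\<^sub>R G y) =
    (\<Sum>bs\<leftarrow>parts w. multilin G (map h bs))"
proof -
  have "(\<Sum>y\<in>wordsle M. (\<Sum>bs\<leftarrow>parts w. pure_tensor (map h bs) y) *\<^sub>R G y) =
      (\<Sum>bs\<leftarrow>parts w. \<Sum>y\<in>wordsle M. pure_tensor (map h bs) y *\<^sub>R G y)"
  proof -
    have "(\<Sum>bs\<leftarrow>xs. pure_tensor (map h bs) y) *\<^sub>R G y = (\<Sum>bs\<leftarrow>xs. pure_tensor (map h bs) y *\<^sub>R G y)" for xs y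
      by (induction xs) (simp_all add: scaleR_add_left)
    then show ?thesis by (simp add: sum_sum_list_swap)
  qed
  also have "\<dots> = (\<Sum>bs\<leftarrow>parts w. multilin G (map h bs))"
  proof (intro sum_list_cong sum_pure_tensor_eq_multilin)
    fix bs assume "bs \<in> set (parts w)"
    then show "length (map h bs) \<le> M" using partsD(1) assms by (fastforce simp: wordsle_def)
  qed
  finally show ?thesis .
qed

lemma star_eq_parts':
  "w \<in> wordsle n \<Longrightarrow> star K H t w = (\<Sum>bs\<leftarrow>parts w. multilin (K t) (map (H t) bs))"
  by (rule star_eq_parts[of _ "length w"]) (simp add: wordsle_def words_def)

lemma parts_wordsle:
  assumes "bs \<in> set (parts w)" "w \<in> wordsle M" "b \<in> set bs"
  shows "b \<in> wordsle (Suc M - length bs)" "b \<in> wordsle M"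
proof -
  have "length bs \<noteq> 0" using assms(3) by auto
  moreover have "length b + length bs \<le> Suc (length w)" by (rule partsD(3)[OF assms(1,3)])
  moreover have "length w \<le> M" using assms(2) by (simp add: wordsle_def)
  ultimately have "length b \<le> Suc M - length bs" "length b \<le> M" by linarith+
  moreover have "set b \<subseteq> set w" using partsD(4)[OF assms(1)] assms(3) by blast
  ultimately show "b \<in> wordsle (Suc M - length bs)" "b \<in> wordsle M"
    using assms(2) by (auto simp: wordsle_def)
qed

section \<open>Calculus of local errors for a control\<close>

locale control_on =
  fixes T p :: real and \<omega> :: "real \<Rightarrow> real \<Rightarrow> real"
  assumes T_pos: "0 < T" and p_ge: "1 \<le> p" and control: "control T \<omega>"
begin

text \<open>Boundedness cannot be expressed as \<open>small 0\<close> below, because \<open>0 powr 0 = 0\<close>.\<close>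

definition bdd :: "(real \<Rightarrow> real \<Rightarrow> 'a::real_normed_vector) \<Rightarrow> bool" where
  "bdd a \<longleftrightarrow> (\<exists>C. \<forall>(s, t)\<in>triangle T. norm (a s t) \<le> C)"

abbreviation small :: "nat \<Rightarrow> (real \<Rightarrow> real \<Rightarrow> 'a::real_normed_vector) \<Rightarrow> bool" where
  "small m a \<equiv> approx T p \<omega> m a (\<lambda>s t. 0)"

abbreviation near :: "nat \<Rightarrow> (real \<Rightarrow> real \<Rightarrow> 'a::real_normed_vector) \<Rightarrow> (real \<Rightarrow> real \<Rightarrow> 'a) \<Rightarrow> bool" where
  "near m a b \<equiv> approx T p \<omega> m a b"

lemma near_iff: "near m a b \<longleftrightarrow> small m (\<lambda>s t. a s t - b s t)"
  by (simp add: approx_def)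

lemma bddI: "(\<And>s t. (s, t) \<in> triangle T \<Longrightarrow> norm (a s t) \<le> C) \<Longrightarrow> bdd a"
  by (auto simp: bdd_def)

lemma bddE:
  assumes "bdd a"
  obtains C where "C \<ge> 0" "\<And>s t. (s, t) \<in> triangle T \<Longrightarrow> norm (a s t) \<le> C"
proof -
  obtain C where "\<And>s t. (s, t) \<in> triangle T \<Longrightarrow> norm (a s t) \<le> C"
    using assms by (auto simp: bdd_def)
  then show thesis by (intro that[of "max C 0"]) (auto intro: max.coboundedI1)
qed

lemma smallI: "(\<And>s t. (s, t) \<in> triangle T \<Longrightarrow> norm (a s t) \<le> C * \<omega> s t powr (real m / p)) \<Longrightarrow> small m a"
  by (auto simp: approx_def)

lemma smallE:
  assumes "small m a"
  obtains C where "C \<ge> 0" "\<And>s t. (s, t) \<in> triangle T \<Longrightarrow> norm (a s t) \<le> C * \<omega> s t powr (real m / p)"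
proof -
  obtain C where C: "\<And>s t. (s, t) \<in> triangle T \<Longrightarrow> norm (a s t) \<le> C * \<omega> s t powr (real m / p)"
    using assms by (auto simp: approx_def)
  have "norm (a s t) \<le> max C 0 * \<omega> s t powr (real m / p)" if "(s, t) \<in> triangle T" for s t
    using C[OF that] by (rule order_trans) (simp add: mult_right_mono)
  then show thesis by (intro that[of "max C 0"]) auto
qed

lemma control_nonneg: "(s, t) \<in> triangle T \<Longrightarrow> 0 \<le> \<omega> s t"
  using control by (auto simp: control_def)

lemma bdd_continuous:
  fixes f :: "real \<Rightarrow> real \<Rightarrow> 'a::real_normed_vector"
  assumes "continuous_on (triangle T) (\<lambda>(s, t). f s t)"
  shows "bdd f"
proof -
  have "bounded ((\<lambda>(s, t). f s t) ` triangle T)"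
    by (intro compact_imp_bounded compact_continuous_image assms compact_triangle)
  then show ?thesis unfolding bounded_iff bdd_def by auto
qed

lemma bdd_control: "bdd \<omega>"
  using control by (intro bdd_continuous) (simp add: control_def)

lemma bdd_cong: "(\<And>s t. (s, t) \<in> triangle T \<Longrightarrow> a s t = b s t) \<Longrightarrow> bdd a \<longleftrightarrow> bdd b"
  unfolding bdd_def by (intro ex_cong1 ball_cong) auto

lemma near_cong:
  "(\<And>s t. (s, t) \<in> triangle T \<Longrightarrow> a s t = a' s t) \<Longrightarrow>
   (\<And>s t. (s, t) \<in> triangle T \<Longrightarrow> b s t = b' s t) \<Longrightarrow> near m a b \<longleftrightarrow> near m a' b'"
  unfolding approx_def by (intro ex_cong1 ball_cong) auto

lemma bdd_const: "bdd (\<lambda>s t. c)"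
  by (rule bddI[of _ "norm c"]) simp

text \<open>\<open>\<omega>\<close> is bounded on the compact triangle, so surplus powers go into
  the constant.\<close>

lemma small_mono:
  assumes "m \<le> n" "small n a"
  shows "small m a"
proof -
  obtain C where C: "C \<ge> 0" "\<And>s t. (s, t) \<in> triangle T \<Longrightarrow> norm (a s t) \<le> C * \<omega> s t powr (real n / p)"
    using assms(2) by (rule smallE) blast
  obtain B where B: "B \<ge> 0" "\<And>s t. (s, t) \<in> triangle T \<Longrightarrow> norm (\<omega> s t) \<le> B"
    using bdd_control by (rule bddE) blast
  show ?thesis
  proof (rule smallI)
    fix s t assume st: "(s, t) \<in> triangle T"
    have e: "real n / p = real (n - m) / p + real m / p"
      using assms(1) by (simp add: of_nat_diff diff_divide_distrib)
    have "\<omega> s t powr (real (n - m) / p) \<le> (B + 1) powr (real (n - m) / p)"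
      using control_nonneg[OF st] B(2)[OF st] p_ge by (intro powr_mono2) auto
    then have "\<omega> s t powr (real n / p) \<le> (B + 1) powr (real (n - m) / p) * \<omega> s t powr (real m / p)"
      unfolding e powr_add by (rule mult_right_mono) simp
    then have "C * \<omega> s t powr (real n / p) \<le> C * ((B + 1) powr (real (n - m) / p) * \<omega> s t powr (real m / p))"
      using C(1) by (rule mult_left_mono)
    then show "norm (a s t) \<le> (C * (B + 1) powr (real (n - m) / p)) * \<omega> s t powr (real m / p)"
      using C(2)[OF st] by (simp add: mult.assoc)
  qed
qed

lemma small_imp_bdd:
  assumes "small m a"
  shows "bdd a"
proof -
  obtain C where C: "C \<ge> 0" "\<And>s t. (s, t) \<in> triangle T \<Longrightarrow> norm (a s t) \<le> C * \<omega> s t powr (real m / p)"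
    using assms by (rule smallE) blast
  obtain B where B: "B \<ge> 0" "\<And>s t. (s, t) \<in> triangle T \<Longrightarrow> norm (\<omega> s t) \<le> B"
    using bdd_control by (rule bddE) blast
  show ?thesis
  proof (rule bddI)
    fix s t assume st: "(s, t) \<in> triangle T"
    have "\<omega> s t powr (real m / p) \<le> (B + 1) powr (real m / p)"
      using control_nonneg[OF st] B(2)[OF st] p_ge by (intro powr_mono2) auto
    then show "norm (a s t) \<le> C * (B + 1) powr (real m / p)"
      using C(2)[OF st] C(1) by (meson mult_left_mono order_trans)
  qed
qed

lemma small_zero [simp]: "small m (\<lambda>s t. 0)"
  by (rule smallI[of _ 0]) simp

lemma near_refl [simp]: "near m a a"
  by (simp add: near_iff[of _ a])

lemma near_sym: "near m a b \<Longrightarrow> near m b a"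
  by (simp add: approx_def norm_minus_commute)

lemma small_add:
  assumes "small m a" "small m b"
  shows "small m (\<lambda>s t. a s t + b s t)"
proof -
  obtain C where C: "\<And>s t. (s, t) \<in> triangle T \<Longrightarrow> norm (a s t) \<le> C * \<omega> s t powr (real m / p)"
    using assms(1) by (rule smallE) blast
  obtain D where D: "\<And>s t. (s, t) \<in> triangle T \<Longrightarrow> norm (b s t) \<le> D * \<omega> s t powr (real m / p)"
    using assms(2) by (rule smallE) blast
  show ?thesis
    by (rule smallI[of _ "C + D"]) (auto simp: distrib_right intro!: norm_triangle_le add_mono C D)
qed

lemma near_trans [trans]:
  assumes "near m a b" "near m b c"
  shows "near m a c"
  using small_add[OF assms(1)[unfolded near_iff[of m a]] assms(2)[unfolded near_iff[of m b]]]
  by (simp add: near_iff[of m a c])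

lemma near_mono: "m \<le> n \<Longrightarrow> near n a b \<Longrightarrow> near m a b"
  unfolding near_iff[of m a b] near_iff[of n a b] by (rule small_mono)

lemma near_add: "near m a b \<Longrightarrow> near m c d \<Longrightarrow> near m (\<lambda>s t. a s t + c s t) (\<lambda>s t. b s t + d s t)"
  unfolding near_iff[of m a] near_iff[of m c] near_iff[of m "\<lambda>s t. a s t + c s t"]
  by (drule (1) small_add) (simp add: algebra_simps)

lemma near_sum:
  "(\<And>i. i \<in> A \<Longrightarrow> near m (a i) (b i)) \<Longrightarrow> near m (\<lambda>s t. \<Sum>i\<in>A. a i s t) (\<lambda>s t. \<Sum>i\<in>A. b i s t)"
  by (induction A rule: infinite_finite_induct) (auto intro: near_add)

lemma near_sum_list:
  "(\<And>i. i \<in> set xs \<Longrightarrow> near m (a i) (b i)) \<Longrightarrow> near m (\<lambda>s t. \<Sum>i\<leftarrow>xs. a i s t) (\<lambda>s t. \<Sum>i\<leftarrow>xs. b i s t)"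
  by (induction xs) (auto intro: near_add)

lemma bdd_add: "bdd a \<Longrightarrow> bdd b \<Longrightarrow> bdd (\<lambda>s t. a s t + b s t)"
proof -
  assume "bdd a" "bdd b"
  obtain C where C: "\<And>s t. (s, t) \<in> triangle T \<Longrightarrow> norm (a s t) \<le> C"
    using \<open>bdd a\<close> by (rule bddE) blast
  obtain D where D: "\<And>s t. (s, t) \<in> triangle T \<Longrightarrow> norm (b s t) \<le> D"
    using \<open>bdd b\<close> by (rule bddE) blast
  show ?thesis
    by (rule bddI[of _ "C + D"]) (auto intro!: norm_triangle_le add_mono C D)
qed

lemma bdd_sum: "(\<And>i. i \<in> A \<Longrightarrow> bdd (a i)) \<Longrightarrow> bdd (\<lambda>s t. \<Sum>i\<in>A. a i s t)"
  by (induction A rule: infinite_finite_induct) (auto intro: bdd_add bdd_const)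

lemma bdd_sum_list: "(\<And>i. i \<in> set xs \<Longrightarrow> bdd (a i)) \<Longrightarrow> bdd (\<lambda>s t. \<Sum>i\<leftarrow>xs. a i s t)"
  by (induction xs) (auto intro: bdd_add bdd_const)

lemma bdd_bounded_linear: "bounded_linear f \<Longrightarrow> bdd a \<Longrightarrow> bdd (\<lambda>s t. f (a s t))"
proof -
  assume f: "bounded_linear f" and "bdd a"
  obtain C where C: "\<And>s t. (s, t) \<in> triangle T \<Longrightarrow> norm (a s t) \<le> C"
    using \<open>bdd a\<close> by (rule bddE) blast
  obtain K where K: "K \<ge> 0" "\<And>x. norm (f x) \<le> norm x * K"
    using bounded_linear.nonneg_bounded[OF f] by blast
  show ?thesis
    by (rule bddI[of _ "C * K"]) (use K C in \<open>meson mult_right_mono order_trans\<close>)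
qed

lemma small_bounded_linear: "bounded_linear f \<Longrightarrow> small m a \<Longrightarrow> small m (\<lambda>s t. f (a s t))"
proof -
  assume f: "bounded_linear f" and "small m a"
  obtain C where C: "\<And>s t. (s, t) \<in> triangle T \<Longrightarrow> norm (a s t) \<le> C * \<omega> s t powr (real m / p)"
    using \<open>small m a\<close> by (rule smallE) blast
  obtain K where K: "K \<ge> 0" "\<And>x. norm (f x) \<le> norm x * K"
    using bounded_linear.nonneg_bounded[OF f] by blast
  show ?thesis
  proof (rule smallI[of _ "C * K"])
    fix s t assume "(s, t) \<in> triangle T"
    then have "norm (a s t) * K \<le> (C * \<omega> s t powr (real m / p)) * K"
      using K C by (intro mult_right_mono)
    then show "norm (f (a s t)) \<le> C * K * \<omega> s t powr (real m / p)"
      using K(2)[of "a s t"] by (simp add: ac_simps)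
  qed
qed

lemma near_bounded_linear:
  assumes "bounded_linear f" "near m a b"
  shows "near m (\<lambda>s t. f (a s t)) (\<lambda>s t. f (b s t))"
proof -
  interpret bounded_linear f by fact
  show ?thesis
    using small_bounded_linear[OF assms(1), of m "\<lambda>s t. a s t - b s t"] assms(2)
    by (simp add: near_iff[of m a] near_iff[of m "\<lambda>s t. f (a s t)"] diff)
qed

lemma bdd_scaleR:
  assumes "bdd a" "bdd b"
  shows "bdd (\<lambda>s t. a s t *\<^sub>R b s t)"
proof -
  obtain C where C: "C \<ge> 0" "\<And>s t. (s, t) \<in> triangle T \<Longrightarrow> norm (a s t) \<le> C"
    using assms(1) by (rule bddE) blast
  obtain D where D: "\<And>s t. (s, t) \<in> triangle T \<Longrightarrow> norm (b s t) \<le> D"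
    using assms(2) by (rule bddE) blast
  show ?thesis
    by (rule bddI[of _ "C * D"]) (use C D in \<open>auto intro!: mult_mono\<close>)
qed

lemma small_scaleR:
  assumes "small m a" "small n b"
  shows "small (m + n) (\<lambda>s t. a s t *\<^sub>R b s t)"
proof -
  obtain C where C: "C \<ge> 0" "\<And>s t. (s, t) \<in> triangle T \<Longrightarrow> norm (a s t) \<le> C * \<omega> s t powr (real m / p)"
    using assms(1) by (rule smallE) blast
  obtain D where D: "\<And>s t. (s, t) \<in> triangle T \<Longrightarrow> norm (b s t) \<le> D * \<omega> s t powr (real n / p)"
    using assms(2) by (rule smallE) blast
  show ?thesis
  proof (rule smallI[of _ "C * D"])
    fix s t assume st: "(s, t) \<in> triangle T"
    have "norm (a s t *\<^sub>R b s t) \<le> (C * \<omega> s t powr (real m / p)) * (D * \<omega> s t powr (real n / p))"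
      using C(1) C(2)[OF st] D[OF st] by (auto intro!: mult_mono)
    then show "norm (a s t *\<^sub>R b s t) \<le> C * D * \<omega> s t powr (real (m + n) / p)"
      by (simp add: powr_add add_divide_distrib ac_simps)
  qed
qed

lemma small_scaleR_bdd:
  assumes "small m a" "bdd b"
  shows "small m (\<lambda>s t. a s t *\<^sub>R b s t)"
proof -
  obtain C where C: "C \<ge> 0" "\<And>s t. (s, t) \<in> triangle T \<Longrightarrow> norm (a s t) \<le> C * \<omega> s t powr (real m / p)"
    using assms(1) by (rule smallE) blast
  obtain D where D: "\<And>s t. (s, t) \<in> triangle T \<Longrightarrow> norm (b s t) \<le> D"
    using assms(2) by (rule bddE) blast
  show ?thesis
  proof (rule smallI[of _ "C * D"])
    fix s t assume st: "(s, t) \<in> triangle T"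
    have "norm (a s t *\<^sub>R b s t) \<le> (C * \<omega> s t powr (real m / p)) * D"
      using C(1) C(2)[OF st] D[OF st] by (auto intro!: mult_mono)
    then show "norm (a s t *\<^sub>R b s t) \<le> C * D * \<omega> s t powr (real m / p)"
      by (simp add: ac_simps)
  qed
qed

lemma small_bdd_scaleR:
  assumes "bdd a" "small m b"
  shows "small m (\<lambda>s t. a s t *\<^sub>R b s t)"
proof -
  obtain C where C: "C \<ge> 0" "\<And>s t. (s, t) \<in> triangle T \<Longrightarrow> norm (a s t) \<le> C"
    using assms(1) by (rule bddE) blast
  obtain D where D: "\<And>s t. (s, t) \<in> triangle T \<Longrightarrow> norm (b s t) \<le> D * \<omega> s t powr (real m / p)"
    using assms(2) by (rule smallE) blast
  show ?thesis
  proof (rule smallI[of _ "C * D"])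
    fix s t assume st: "(s, t) \<in> triangle T"
    have "norm (a s t *\<^sub>R b s t) \<le> C * (D * \<omega> s t powr (real m / p))"
      using C(1) C(2)[OF st] D[OF st] by (auto intro!: mult_mono)
    then show "norm (a s t *\<^sub>R b s t) \<le> C * D * \<omega> s t powr (real m / p)"
      by (simp add: ac_simps)
  qed
qed

text \<open>By \<open>a b - a' b' = (a - a') b + a' (b - b')\<close>, which is why boundedness is
  asked of \<open>a'\<close> and \<open>b\<close>.\<close>

lemma near_scaleR:
  assumes a: "near m a a'" and b: "near m b b'" and "bdd a'" "bdd b"
  shows "near m (\<lambda>s t. a s t *\<^sub>R b s t) (\<lambda>s t. a' s t *\<^sub>R b' s t)"
proof -
  have "small m (\<lambda>s t. (a s t - a' s t) *\<^sub>R b s t + a' s t *\<^sub>R (b s t - b' s t))"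
    using assms unfolding near_iff[of m a] near_iff[of m b]
    by (intro small_add small_scaleR_bdd small_bdd_scaleR)
  then show ?thesis
    unfolding near_iff[of m "\<lambda>s t. a s t *\<^sub>R b s t"] by (simp add: algebra_simps)
qed

lemma bdd_multilin:
  assumes "\<And>f. f \<in> set fs \<Longrightarrow> bdd f" "\<And>y. y \<in> words (length fs) \<Longrightarrow> bdd (\<lambda>s t. G s t y)"
  shows "bdd (\<lambda>s t. multilin (G s t) (map (\<lambda>f. f s t) fs))"
  using assms
proof (induction fs arbitrary: G)
  case (Cons f fs)
  show ?case
    unfolding list.map multilin_Cons
  proof (intro bdd_sum bdd_scaleR Cons.IH bdd_bounded_linear[OF bounded_linear_coord])
    show "bdd (\<lambda>s t. G s t (b # y))" if "b \<in> vbasis" "y \<in> words (length fs)" for b y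
      using that Cons.prems(2)[of "b # y"] by (auto simp: words_def)
  qed (use Cons.prems in auto)
qed simp

lemma bdd_multilin_map:
  assumes "\<And>b. b \<in> set bs \<Longrightarrow> bdd (\<lambda>s t. h s t b)" "\<And>y. y \<in> words (length bs) \<Longrightarrow> bdd (\<lambda>s t. G s t y)"
  shows "bdd (\<lambda>s t. multilin (G s t) (map (h s t) bs))"
  using bdd_multilin[of "map (\<lambda>b s t. h s t b) bs" G] assms by (auto simp: o_def)

text \<open>Only the last argument is perturbed, since factors are expanded one at a time from the
  right.\<close>

lemma near_multilin_snoc:
  fixes x x' :: "real \<Rightarrow> real \<Rightarrow> 'w::fin_dim_normed_vector"
  assumes x: "near m x x'" and us: "\<And>b. b \<in> set bs \<Longrightarrow> bdd (\<lambda>s t. h s t b)"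
    and G: "\<And>y. y \<in> words (Suc (length bs)) \<Longrightarrow> bdd (\<lambda>s t. G s t y)"
  shows "near m (\<lambda>s t. multilin (G s t) (map (h s t) bs @ [x s t])) (\<lambda>s t. multilin (G s t) (map (h s t) bs @ [x' s t]))"
proof -
  have "near m (\<lambda>s t. coord (x s t) b *\<^sub>R multilin (\<lambda>y. G s t (y @ [b])) (map (h s t) bs))
      (\<lambda>s t. coord (x' s t) b *\<^sub>R multilin (\<lambda>y. G s t (y @ [b])) (map (h s t) bs))" if "b \<in> vbasis" for b
  proof -
    have "bdd (\<lambda>s t. multilin (\<lambda>y. G s t (y @ [b])) (map (h s t) bs))"
    proof (rule bdd_multilin_map[OF us])
      fix y :: "'w list" assume "y \<in> words (length bs)"
      then show "bdd (\<lambda>s t. G s t (y @ [b]))" using that by (intro G) (simp add: words_def)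
    qed
    moreover have "small m (\<lambda>s t. coord (x s t - x' s t) b)"
      using x unfolding near_iff[of m x] by (rule small_bounded_linear[OF bounded_linear_coord])
    ultimately have "small m (\<lambda>s t. coord (x s t - x' s t) b *\<^sub>R multilin (\<lambda>y. G s t (y @ [b])) (map (h s t) bs))"
      by (rule small_scaleR_bdd[rotated])
    then show ?thesis
      unfolding near_iff[of m "\<lambda>s t. coord (x s t) b *\<^sub>R _ s t"]
      by (simp add: linear_diff[OF linear_coord] scaleR_diff_left)
  qed
  then show ?thesis
    unfolding multilin_snoc multilin_sum multilin_scaleR by (rule near_sum)
qed

lemma near_eqI:
  "near m a b \<Longrightarrow> (\<And>s t. (s, t) \<in> triangle T \<Longrightarrow> a' s t = a s t) \<Longrightarrow>
    (\<And>s t. (s, t) \<in> triangle T \<Longrightarrow> b' s t = b s t) \<Longrightarrow> near m a' b'"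
  by (subst near_cong[of a' a b' b m])

lemma level_pos: "1 \<le> level p"
  using p_ge by (simp add: le_nat_floor)

section \<open>Hoelder paths\<close>

lemma holder_pathD:
  assumes "holder_path T p \<omega> f"
  shows "bdd (\<lambda>s t. f s)" "bdd (\<lambda>s t. f t)" "near 1 (\<lambda>s t. f t) (\<lambda>s t. f s)"
proof -
  have c: "continuous_on {0..T} f" using assms by (simp add: holder_path_def)
  have "continuous_on (triangle T) (\<lambda>x. f (fst x))" "continuous_on (triangle T) (\<lambda>x. f (snd x))"
    by (rule continuous_on_compose2[OF c]; force simp: triangle_def intro: continuous_intros)+
  then show "bdd (\<lambda>s t. f s)" "bdd (\<lambda>s t. f t)"
    by (auto intro!: bdd_continuous simp: split_def)
qed (use assms in \<open>simp add: holder_path_def\<close>)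

lemma holder_path_add:
  "holder_path T p \<omega> f \<Longrightarrow> holder_path T p \<omega> g \<Longrightarrow> holder_path T p \<omega> (\<lambda>t. f t + g t)"
  unfolding holder_path_def by (auto intro!: continuous_intros near_add)

lemma holder_path_const: "holder_path T p \<omega> (\<lambda>t. c)"
  unfolding holder_path_def by (auto intro!: continuous_intros)

lemma holder_path_sum:
  "(\<And>i. i \<in> A \<Longrightarrow> holder_path T p \<omega> (f i)) \<Longrightarrow> holder_path T p \<omega> (\<lambda>t. \<Sum>i\<in>A. f i t)"
  by (induction A rule: infinite_finite_induct) (auto intro: holder_path_add holder_path_const)

lemma holder_path_sum_list:
  "(\<And>i. i \<in> set xs \<Longrightarrow> holder_path T p \<omega> (f i)) \<Longrightarrow> holder_path T p \<omega> (\<lambda>t. \<Sum>i\<leftarrow>xs. f i t)"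
  by (induction xs) (auto intro: holder_path_add holder_path_const)

lemma holder_path_bounded_linear:
  "bounded_linear g \<Longrightarrow> holder_path T p \<omega> f \<Longrightarrow> holder_path T p \<omega> (\<lambda>t. g (f t))"
  unfolding holder_path_def by (auto intro: near_bounded_linear bounded_linear.continuous_on)

lemma holder_path_scaleR:
  assumes "holder_path T p \<omega> f" "holder_path T p \<omega> g"
  shows "holder_path T p \<omega> (\<lambda>t. f t *\<^sub>R g t)"
  using assms holder_pathD[OF assms(1)] holder_pathD[OF assms(2)]
  unfolding holder_path_def by (auto intro!: continuous_intros near_scaleR)

lemma holder_path_multilin:
  fixes h :: "real \<Rightarrow> 'a \<Rightarrow> 'b::fin_dim_normed_vector"
  assumes "\<And>b. b \<in> set bs \<Longrightarrow> holder_path T p \<omega> (\<lambda>t. h t b)"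
    and "\<And>y. y \<in> words (length bs) \<Longrightarrow> holder_path T p \<omega> (\<lambda>t. G t y)"
  shows "holder_path T p \<omega> (\<lambda>t. multilin (G t) (map (h t) bs))"
  using assms
proof (induction bs arbitrary: G)
  case (Cons c bs)
  show ?case
    unfolding list.map multilin_Cons
  proof (intro holder_path_sum holder_path_scaleR Cons.IH holder_path_bounded_linear[OF bounded_linear_coord])
    fix b :: 'b and y :: "'b list" assume "b \<in> vbasis" "y \<in> words (length bs)"
    then show "holder_path T p \<omega> (\<lambda>t. G t (b # y))"
      by (intro Cons.prems(2)) (simp add: words_def)
  qed (use Cons.prems in auto)
qed simp

section \<open>Degree estimates and the shuffle relation for rough paths\<close>

lemma rough_path_Nil: "rough_path T p \<omega> X \<Longrightarrow> (s, t) \<in> triangle T \<Longrightarrow> X s t [] = 1"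
  unfolding rough_path_def by auto

lemma rough_path_small:
  "rough_path T p \<omega> X \<Longrightarrow> w \<in> wordsle (level p) \<Longrightarrow> w \<noteq> [] \<Longrightarrow> small (length w) (\<lambda>s t. X s t w)"
  unfolding rough_path_def by (auto simp: wordsle_def words_def Suc_le_eq)

lemma rough_path_bdd:
  assumes "rough_path T p \<omega> X" "w \<in> wordsle (level p)"
  shows "bdd (\<lambda>s t. X s t w)"
proof (cases "w = []")
  case True
  have "bdd (\<lambda>s t. X s t []) \<longleftrightarrow> bdd (\<lambda>s t. 1 :: real)"
    by (rule bdd_cong) (rule rough_path_Nil[OF assms(1)])
  then show ?thesis using True by (simp add: bdd_const)
qed (use rough_path_small[OF assms] small_imp_bdd in blast)

text \<open>Words of the wrong length do not deshuffle into \<open>u\<close> and \<open>v\<close>,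
  so the sum can run over all words up to length \<open>M\<close>. This common range permits
  interchanging it with the sum over pairs.\<close>

lemma rough_path_count:
  fixes X :: "real \<Rightarrow> real \<Rightarrow> 'a::fin_dim_normed_vector tensor"
  assumes X: "rough_path T p \<omega> X" and st: "(s, t) \<in> triangle T"
    and u: "u \<in> wordsle M" and v: "v \<in> wordsle M" and "length u + length v \<le> M" "M \<le> level p"
  shows "X s t u * X s t v = (\<Sum>w\<in>wordsle M. X s t w * real (count_list (splits w) (u, v)))"
proof -
  have "X s t u * X s t v = Delta_sh (length u) (length v) (X s t) [u, v]"
  proof -
    have "\<forall>(s, t)\<in>triangle T. \<forall>a b. a + b \<le> level p \<longrightarrow>
        (\<forall>u\<in>words a. \<forall>v\<in>words b. X s t u * X s t v = Delta_sh a b (X s t) [u, v])"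
      using X unfolding rough_path_def by blast
    moreover have "u \<in> words (length u)" "v \<in> words (length v)"
      using u v by (simp_all add: wordsle_def words_def)
    moreover have "length u + length v \<le> level p" using assms(5,6) by simp
    ultimately show ?thesis using st by blast
  qed
  also have "\<dots> = (\<Sum>w\<in>words (length u + length v). X s t w * real (count_list (splits w) (u, v)))"
    by (rule Delta_sh_eq_count) simp
  also have "\<dots> = (\<Sum>w\<in>wordsle M. X s t w * real (count_list (splits w) (u, v)))"
  proof (rule sum.mono_neutral_left)
    show "\<forall>w\<in>wordsle M - words (length u + length v). X s t w * real (count_list (splits w) (u, v)) = 0"
    proof
      fix w :: "'a list" assume w: "w \<in> wordsle M - words (length u + length v)"
      have "(u, v) \<notin> set (splits w)"
        using w length_splits[of u v w] by (auto simp: wordsle_def words_def)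
      then show "X s t w * real (count_list (splits w) (u, v)) = 0" by simp
    qed
  qed (use assms words_subset_wordsle in auto)
  finally show ?thesis .
qed

lemma near_tensor_sum:
  assumes X: "rough_path T p \<omega> X" and M: "M \<le> level p"
    and "\<And>w. w \<in> wordsle M \<Longrightarrow> near m (\<lambda>s t. F s t w) (\<lambda>s t. G s t w)"
  shows "near m (\<lambda>s t. tensor_sum (X s t) M (F s t)) (\<lambda>s t. tensor_sum (X s t) M (G s t))"
  unfolding tensor_sum_def
proof (rule near_sum)
  fix w :: "'a list" assume w: "w \<in> wordsle M"
  have "small m (\<lambda>s t. F s t w - G s t w)"
    using assms(3)[OF w] unfolding near_iff[of m "\<lambda>s t. F s t w"] .
  moreover have "bdd (\<lambda>s t. X s t w)"
    using w M by (intro rough_path_bdd[OF X]) (auto simp: wordsle_def)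
  ultimately have "small m (\<lambda>s t. X s t w *\<^sub>R (F s t w - G s t w))"
    by (rule small_bdd_scaleR[rotated])
  then show "near m (\<lambda>s t. X s t w *\<^sub>R F s t w) (\<lambda>s t. X s t w *\<^sub>R G s t w)"
    unfolding near_iff[of m "\<lambda>s t. X s t w *\<^sub>R F s t w"] by (simp add: scaleR_diff_right)
qed

lemma near_sum_subset:
  assumes "finite A" "B \<subseteq> A" "\<And>x. x \<in> A - B \<Longrightarrow> small m (f x)"
  shows "near m (\<lambda>s t. \<Sum>x\<in>A. f x s t) (\<lambda>s t. \<Sum>x\<in>B. f x s t)"
proof -
  have "near m (\<lambda>s t. \<Sum>x\<in>A - B. f x s t) (\<lambda>s t. \<Sum>x\<in>A - B. 0)"
    by (rule near_sum) (rule assms(3))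
  then have "near m (\<lambda>s t. (\<Sum>x\<in>A - B. f x s t) + (\<Sum>x\<in>B. f x s t)) (\<lambda>s t. (\<Sum>x\<in>A - B. 0) + (\<Sum>x\<in>B. f x s t))"
    by (rule near_add) simp
  then show ?thesis
    unfolding sum.subset_diff[OF assms(2,1)] by simp
qed

text \<open>Every dropped word has at least \<open>Suc M'\<close> letters, and a coordinate of
  \<open>X\<close> has the order of its word length.\<close>

lemma tensor_sum_truncate:
  fixes X :: "real \<Rightarrow> real \<Rightarrow> 'a::fin_dim_normed_vector tensor"
  assumes X: "rough_path T p \<omega> X" and M: "M' \<le> M" "M \<le> level p"
    and G: "\<And>w. w \<in> wordsle M \<Longrightarrow> bdd (\<lambda>s t. G s t w)"
  shows "near (Suc M') (\<lambda>s t. tensor_sum (X s t) M (G s t)) (\<lambda>s t. tensor_sum (X s t) M' (G s t))"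
  unfolding tensor_sum_def
proof (rule near_sum_subset)
  fix w :: "'a list" assume w: "w \<in> wordsle M - wordsle M'"
  have "small (length w) (\<lambda>s t. X s t w)"
    using w M by (intro rough_path_small[OF X]) (auto simp: wordsle_def)
  then have "small (Suc M') (\<lambda>s t. X s t w)"
    by (rule small_mono[rotated]) (use w in \<open>auto simp: wordsle_def\<close>)
  then show "small (Suc M') (\<lambda>s t. X s t w *\<^sub>R G s t w)"
    by (rule small_scaleR_bdd) (use w G in auto)
next
  show "wordsle M' \<subseteq> (wordsle M :: 'a list set)" using M by (auto simp: wordsle_def)
qed simp

text \<open>Here an expression quadratic in \<open>X\<close> becomes linear. Pairs of words of total
  length above \<open>M\<close> have order \<open>Suc M\<close> and are dropped; for the others the
  shuffle relation is available, their total degree being at most \<open>level p\<close>.\<close>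

lemma tensor_sum_shuffle:
  assumes X: "rough_path T p \<omega> X" and M: "M \<le> level p"
    and F: "\<And>u v. u \<in> wordsle M \<Longrightarrow> v \<in> wordsle M \<Longrightarrow> bdd (\<lambda>s t. F s t u v)"
  shows "near (Suc M) (\<lambda>s t. tensor_sum (X s t) M (\<lambda>u. tensor_sum (X s t) M (F s t u)))
    (\<lambda>s t. tensor_sum (X s t) M (\<lambda>w. \<Sum>(u, v)\<leftarrow>splits w. F s t u v))"
proof -
  let ?A = "wordsle M \<times> wordsle M :: ('a list \<times> 'a list) set"
  define D where "D = {(u, v) \<in> ?A. length u + length v \<le> M}"
  have finD: "finite D" unfolding D_def by (rule finite_subset[of _ ?A]) auto
  have near: "near (Suc M) (\<lambda>s t. \<Sum>x\<in>?A. (case x of (u, v) \<Rightarrow> X s t u *\<^sub>R X s t v *\<^sub>R F s t u v))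
    (\<lambda>s t. \<Sum>x\<in>D. (case x of (u, v) \<Rightarrow> X s t u *\<^sub>R X s t v *\<^sub>R F s t u v))"
  proof (rule near_sum_subset)
    fix x assume x: "x \<in> ?A - D"
    obtain u v where uv: "x = (u, v)" by fastforce
    have l: "Suc M \<le> length u + length v" and u: "u \<in> wordsle M" "v \<in> wordsle M"
      using x by (auto simp: uv D_def)
    then have "u \<noteq> []" "v \<noteq> []" by (auto simp: wordsle_def)
    moreover have "u \<in> wordsle (level p)" "v \<in> wordsle (level p)"
      using u M by (auto simp: wordsle_def)
    ultimately have "small (length u + length v) (\<lambda>s t. X s t u *\<^sub>R X s t v *\<^sub>R F s t u v)"
      by (intro small_scaleR small_scaleR_bdd rough_path_small[OF X] F u)
    then show "small (Suc M) (\<lambda>s t. (case x of (u, v) \<Rightarrow> X s t u *\<^sub>R X s t v *\<^sub>R F s t u v))"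
      using l by (auto simp: uv intro: small_mono)
  qed (auto simp: D_def)
  have left: "(\<Sum>x\<in>?A. (case x of (u, v) \<Rightarrow> X s t u *\<^sub>R X s t v *\<^sub>R F s t u v)) =
      tensor_sum (X s t) M (\<lambda>u. tensor_sum (X s t) M (F s t u))" for s t
    unfolding tensor_sum_def scaleR_sum_right by (simp add: sum.cartesian_product)
  have right: "(\<Sum>x\<in>D. (case x of (u, v) \<Rightarrow> X s t u *\<^sub>R X s t v *\<^sub>R F s t u v)) =
      tensor_sum (X s t) M (\<lambda>w. \<Sum>(u, v)\<leftarrow>splits w. F s t u v)" if st: "(s, t) \<in> triangle T" for s t
  proof -
    have "(\<Sum>x\<in>D. (case x of (u, v) \<Rightarrow> X s t u *\<^sub>R X s t v *\<^sub>R F s t u v)) =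
      (\<Sum>x\<in>D. \<Sum>w\<in>wordsle M. X s t w *\<^sub>R real (count_list (splits w) x) *\<^sub>R (case x of (u, v) \<Rightarrow> F s t u v))"
    proof (intro sum.cong refl)
      fix x assume x: "x \<in> D"
      obtain u v where uv: "x = (u, v)" by fastforce
      have "X s t u * X s t v = (\<Sum>w\<in>wordsle M. X s t w * real (count_list (splits w) (u, v)))"
        using x M by (intro rough_path_count[OF X st]) (auto simp: uv D_def)
      then show "(case x of (u, v) \<Rightarrow> X s t u *\<^sub>R X s t v *\<^sub>R F s t u v) =
        (\<Sum>w\<in>wordsle M. X s t w *\<^sub>R real (count_list (splits w) x) *\<^sub>R (case x of (u, v) \<Rightarrow> F s t u v))"
        by (simp add: uv scaleR_sum_left[symmetric])
    qed
    also have "\<dots> = (\<Sum>w\<in>wordsle M. X s t w *\<^sub>R (\<Sum>x\<in>D. real (count_list (splits w) x) *\<^sub>R (case x of (u, v) \<Rightarrow> F s t u v)))"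
      by (subst sum.swap) (simp add: scaleR_sum_right)
    also have "\<dots> = (\<Sum>w\<in>wordsle M. X s t w *\<^sub>R (\<Sum>(u, v)\<leftarrow>splits w. F s t u v))"
    proof (intro sum.cong refl arg_cong[of _ _ "scaleR _"] sum_list_eq_sum_count[symmetric] finD subsetI)
      fix w :: "'a list" and x assume w: "w \<in> wordsle M" and x: "x \<in> set (splits w)"
      obtain u v where uv: "x = (u, v)" by fastforce
      show "x \<in> D"
        using w length_splits[of u v w] set_splits[of u v w] x
        by (auto simp: uv D_def wordsle_def)
    qed
    finally show ?thesis by (simp add: tensor_sum_def)
  qed
  show ?thesis
    using near by (rule near_eqI) (rule left[symmetric], rule right[symmetric])
qed

section \<open>Expansions of controlled paths\<close>

lemma controlled_path_iff:
  "controlled_path T p \<omega> X H \<longleftrightarrow>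
    (\<forall>n<level p. \<forall>w\<in>words n. holder_path T p \<omega> (\<lambda>t. H t w)) \<and>
    (\<forall>n. n + 2 \<le> level p \<longrightarrow> (\<forall>w\<in>words n. near (level p - n) (\<lambda>s t. H t w)
       (\<lambda>s t. tensor_sum (X s t) (level p - 1 - n) (\<lambda>v. H s (v @ w)))))"
proof -
  have "(\<forall>a\<in>tensors n. near m (\<lambda>s t. pairing n (H t) a)
      (\<lambda>s t. \<Sum>w\<in>words n. a w *\<^sub>R f s t w)) \<longleftrightarrow>
    (\<forall>w\<in>words n. near m (\<lambda>s t. H t w) (\<lambda>s t. f s t w))" (is "?L = ?R") for n m and f :: "_ \<Rightarrow> _ \<Rightarrow> _ \<Rightarrow> 'b"
  proof
    assume ?L
    show ?R
    proof
      fix w :: "'a list" assume w: "w \<in> words n"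
      have b: "(\<Sum>v\<in>words n. basis_tensor w v *\<^sub>R g v) = g w" for g :: "'a list \<Rightarrow> 'b"
      proof -
        have "(\<Sum>v\<in>words n. basis_tensor w v *\<^sub>R g v) = (\<Sum>v\<in>words n. if v = w then g v else 0)"
          by (intro sum.cong) (auto simp: basis_tensor_def)
        then show ?thesis using w by simp
      qed
      have "basis_tensor w \<in> tensors n" using w by (auto simp: tensors_def basis_tensor_def)
      from \<open>?L\<close>[rule_format, OF this] show "near m (\<lambda>s t. H t w) (\<lambda>s t. f s t w)"
        unfolding pairing_def b .
    qed
  next
    assume ?R
    show ?L
    proof
      fix a :: "'a tensor"
      show "near m (\<lambda>s t. pairing n (H t) a) (\<lambda>s t. \<Sum>w\<in>words n. a w *\<^sub>R f s t w)"
        unfolding pairing_def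
        by (rule near_sum, rule near_bounded_linear[OF bounded_linear_scaleR_right]) (use \<open>?R\<close> in blast)
    qed
  qed
  then show ?thesis
    unfolding controlled_path_def sum_pairing_tensor_prod by (simp only:)
qed

text \<open>Lets the integral of the Leibniz product inherit control from \<open>star\<close>, in
  place of a separate estimate for the Leibniz product.\<close>

lemma controlled_path_cong:
  assumes "\<And>t w. t \<in> {0..T} \<Longrightarrow> w \<in> wordsle (level p - 1) \<Longrightarrow> H t w = H' t w"
    and "controlled_path T p \<omega> X H"
  shows "controlled_path T p \<omega> X H'"
proof -
  note H = assms(2)[unfolded controlled_path_iff]
  have holder: "holder_path T p \<omega> (\<lambda>t. H' t w)" if "n < level p" "w \<in> words n" for n w
  proof -
    have "w \<in> wordsle (level p - 1)" using that by (auto simp: words_def wordsle_def)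
    then have eq: "H' t w = H t w" if "t \<in> {0..T}" for t using assms(1) that by simp
    have "holder_path T p \<omega> (\<lambda>t. H t w)" using H that by blast
    moreover have "near 1 (\<lambda>s t. H' t w) (\<lambda>s t. H' s w) \<longleftrightarrow> near 1 (\<lambda>s t. H t w) (\<lambda>s t. H s w)"
      by (rule near_cong) (auto simp: triangle_def eq)
    ultimately show ?thesis
      unfolding holder_path_def using continuous_on_cong[of "{0..T}" "{0..T}" "\<lambda>t. H' t w" "\<lambda>t. H t w"] eq by auto
  qed
  moreover have "near (level p - n) (\<lambda>s t. H' t w) (\<lambda>s t. tensor_sum (X s t) (level p - 1 - n) (\<lambda>v. H' s (v @ w)))"
    if n: "n + 2 \<le> level p" and w: "w \<in> words n" for n w
  proof -
    have "near (level p - n) (\<lambda>s t. H t w) (\<lambda>s t. tensor_sum (X s t) (level p - 1 - n) (\<lambda>v. H s (v @ w)))"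
      using H n w by blast
    moreover have "H' t w = H t w" if "(s, t) \<in> triangle T" for s t
      using that n w by (intro assms(1)[symmetric]) (auto simp: triangle_def wordsle_def words_def)
    moreover have "tensor_sum (X s t) (level p - 1 - n) (\<lambda>v. H' s (v @ w)) =
        tensor_sum (X s t) (level p - 1 - n) (\<lambda>v. H s (v @ w))" if "(s, t) \<in> triangle T" for s t
    proof (rule tensor_sum_cong)
      fix v :: "'a list" assume "v \<in> wordsle (level p - 1 - n)"
      then have "v @ w \<in> wordsle (level p - 1)" using n w by (auto simp: wordsle_def words_def)
      then show "H' s (v @ w) = H s (v @ w)" using that by (intro assms(1)[symmetric]) (auto simp: triangle_def)
    qed
    ultimately show ?thesis
      by (rule near_eqI) simp_all
  qed
  ultimately show ?thesis unfolding controlled_path_iff by blast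
qed

lemma controlled_path_bdd:
  assumes "controlled_path T p \<omega> X H" "w \<in> wordsle (level p - 1)"
  shows "bdd (\<lambda>s t. H s w)" "bdd (\<lambda>s t. H t w)"
proof -
  have "w \<in> words (length w)" "length w < level p"
    using assms(2) level_pos by (auto simp: wordsle_def words_def)
  then have "holder_path T p \<omega> (\<lambda>t. H t w)"
    using assms(1) unfolding controlled_path_iff by blast
  then show "bdd (\<lambda>s t. H s w)" "bdd (\<lambda>s t. H t w)" using holder_pathD by blast+
qed

text \<open>Includes the top degree \<open>level p - 1\<close>, for which the definition has no
  expansion: there the sum reduces to the empty word and the claim is the Hoelder bound.\<close>

lemma controlled_path_near:
  assumes X: "rough_path T p \<omega> X" and H: "controlled_path T p \<omega> X H"
    and w: "w \<in> wordsle (level p - 1)"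
  shows "near (level p - length w) (\<lambda>s t. H t w)
    (\<lambda>s t. tensor_sum (X s t) (level p - 1 - length w) (\<lambda>v. H s (v @ w)))"
proof (cases "length w + 2 \<le> level p")
  case True
  moreover have "w \<in> words (length w)" using w by (auto simp: wordsle_def words_def)
  ultimately show ?thesis using H unfolding controlled_path_iff by blast
next
  case False
  then have l: "level p = Suc (length w)" using w level_pos by (auto simp: wordsle_def)
  have ww: "w \<in> words (length w)" using w by (auto simp: wordsle_def words_def)
  have "wordsle 0 = {[] :: 'a list}" by (auto simp: wordsle_def)
  then have eq: "tensor_sum (X s t) (level p - 1 - length w) (\<lambda>v. H s (v @ w)) = H s w" if "(s, t) \<in> triangle T" for s t
    using rough_path_Nil[OF X that] by (simp add: tensor_sum_def l)
  have "near 1 (\<lambda>s t. H t w) (\<lambda>s t. H s w)"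
    using H ww l unfolding controlled_path_iff by (intro holder_pathD(3)) auto
  then have "near (level p - length w) (\<lambda>s t. H t w) (\<lambda>s t. H s w)" using l by simp
  then show ?thesis by (rule near_eqI) (simp_all only: eq)
qed

lemma bdd_pure_tensor:
  assumes "\<And>b. b \<in> set bs \<Longrightarrow> bdd (\<lambda>s t. h s t b)"
  shows "bdd (\<lambda>s t. pure_tensor (map (h s t) bs) z)"
proof (cases "z \<in> words (length z)")
  case True
  show ?thesis
    unfolding pure_tensor_eq_multilin[OF True] by (intro bdd_multilin_map assms bdd_const)
next
  case False
  then have "pure_tensor us z = 0" for us :: "'b list" by (auto simp: pure_tensor_def words_def)
  then show ?thesis by (simp add: bdd_const)
qed

lemma near_multilin:
  assumes "\<And>b. b \<in> set bs \<Longrightarrow> bdd (\<lambda>s t. h s t b)"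
    and "\<And>z. z \<in> words (length bs) \<Longrightarrow> near m (\<lambda>s t. F s t z) (\<lambda>s t. G s t z)"
  shows "near m (\<lambda>s t. multilin (F s t) (map (h s t) bs)) (\<lambda>s t. multilin (G s t) (map (h s t) bs))"
proof -
  have "near m (\<lambda>s t. pure_tensor (map (h s t) bs) z *\<^sub>R F s t z) (\<lambda>s t. pure_tensor (map (h s t) bs) z *\<^sub>R G s t z)"
    if "z \<in> words (length bs)" for z
  proof -
    have "small m (\<lambda>s t. pure_tensor (map (h s t) bs) z *\<^sub>R (F s t z - G s t z))"
      using assms(2)[OF that] unfolding near_iff[of m "\<lambda>s t. F s t z"]
      by (intro small_bdd_scaleR bdd_pure_tensor assms(1))
    then show ?thesis
      unfolding near_iff[of m "\<lambda>s t. pure_tensor (map (h s t) bs) z *\<^sub>R F s t z"] by (simp add: scaleR_diff_right)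
  qed
  then show ?thesis
    unfolding multilin_def pairing_def by (simp add: near_sum)
qed

section \<open>Inserting the expansion of a lift\<close>

lemma multilin_tensor_sum:
  "multilin (\<lambda>z. tensor_sum A M (\<lambda>y. F y z)) us = tensor_sum A M (\<lambda>y. multilin (F y) us)"
  unfolding tensor_sum_def multilin_sum multilin_scaleR ..

text \<open>Each coordinate of \<open>Y\<close> is replaced by its expansion along \<open>X\<close>.
  After interchanging the sums, the words \<open>y\<close> of the intermediate space assemble the
  multilinear extension of \<open>G\<close> on the blocks.\<close>

lemma tensor_sum_lift:
  assumes X: "rough_path T p \<omega> X" and M: "M \<le> level p"
    and Y: "\<And>y. y \<in> wordsle M \<Longrightarrow> near (Suc M) (\<lambda>s t. Y s t y)
      (\<lambda>s t. tensor_sum (X s t) M (\<lambda>w. \<Sum>bs\<leftarrow>parts w. pure_tensor (map (H s) bs) y))"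
    and G: "\<And>y. y \<in> wordsle M \<Longrightarrow> bdd (\<lambda>s t. G s t y)"
  shows "near (Suc M) (\<lambda>s t. tensor_sum (Y s t) M (G s t))
    (\<lambda>s t. tensor_sum (X s t) M (\<lambda>w. \<Sum>bs\<leftarrow>parts w. multilin (G s t) (map (H s) bs)))"
proof -
  have "near (Suc M) (\<lambda>s t. \<Sum>y\<in>wordsle M. Y s t y *\<^sub>R G s t y)
    (\<lambda>s t. \<Sum>y\<in>wordsle M. tensor_sum (X s t) M (\<lambda>w. \<Sum>bs\<leftarrow>parts w. pure_tensor (map (H s) bs) y) *\<^sub>R G s t y)"
  proof (rule near_sum)
    fix y :: "'b list" assume y: "y \<in> wordsle M"
    let ?Z = "\<lambda>s t. tensor_sum (X s t) M (\<lambda>w. \<Sum>bs\<leftarrow>parts w. pure_tensor (map (H s) bs) y)"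
    have "small (Suc M) (\<lambda>s t. (Y s t y - ?Z s t) *\<^sub>R G s t y)"
      using Y[OF y] unfolding near_iff[of "Suc M" "\<lambda>s t. Y s t y"] by (rule small_scaleR_bdd) (rule G[OF y])
    then show "near (Suc M) (\<lambda>s t. Y s t y *\<^sub>R G s t y) (\<lambda>s t. ?Z s t *\<^sub>R G s t y)"
      unfolding near_iff[of "Suc M" "\<lambda>s t. Y s t y *\<^sub>R G s t y"] by (simp add: scaleR_diff_left)
  qed
  then show ?thesis
  proof (rule near_eqI)
    fix s t
    have "(\<Sum>y\<in>wordsle M. tensor_sum (X s t) M (\<lambda>w. \<Sum>bs\<leftarrow>parts w. pure_tensor (map (H s) bs) y) *\<^sub>R G s t y) =
      tensor_sum (X s t) M (\<lambda>w. \<Sum>y\<in>wordsle M. (\<Sum>bs\<leftarrow>parts w. pure_tensor (map (H s) bs) y) *\<^sub>R G s t y)"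
      unfolding tensor_sum_def scaleR_sum_left scaleR_sum_right by (subst sum.swap) simp
    also have "\<dots> = tensor_sum (X s t) M (\<lambda>w. \<Sum>bs\<leftarrow>parts w. multilin (G s t) (map (H s) bs))"
      by (intro tensor_sum_cong tensor_sum_pure_parts)
    finally show "tensor_sum (X s t) M (\<lambda>w. \<Sum>bs\<leftarrow>parts w. multilin (G s t) (map (H s) bs)) =
      (\<Sum>y\<in>wordsle M. tensor_sum (X s t) M (\<lambda>w. \<Sum>bs\<leftarrow>parts w. pure_tensor (map (H s) bs) y) *\<^sub>R G s t y)" ..
  qed (simp add: tensor_sum_def)
qed

text \<open>The factors \<open>H t d\<close> are expanded one at a time from the right; the shuffle relation merges
  each new factor \<open>X s t\<close> with the one already produced.\<close>

lemma tensor_sum_attach: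
  fixes G :: "real \<Rightarrow> real \<Rightarrow> 'w::fin_dim_normed_vector list \<Rightarrow> 'u::real_normed_vector"
  assumes X: "rough_path T p \<omega> X" and M: "M \<le> level p"
    and Y: "\<And>y. y \<in> wordsle M \<Longrightarrow> near (Suc M) (\<lambda>s t. Y s t y)
      (\<lambda>s t. tensor_sum (X s t) M (\<lambda>w. \<Sum>bs\<leftarrow>parts w. pure_tensor (map (H s) bs) y))"
    and H: "\<And>w. w \<in> wordsle q \<Longrightarrow> bdd (\<lambda>s t. H s w)" "M \<le> q"
    and "\<And>d. d \<in> set ds \<Longrightarrow> set d \<subseteq> vbasis \<and> M + length d \<le> q \<and>
      near (Suc M) (\<lambda>s t. H t d) (\<lambda>s t. tensor_sum (X s t) M (\<lambda>v. H s (v @ d)))"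
    and "\<And>d. d \<in> set ds \<Longrightarrow> bdd (\<lambda>s t. H t d)"
    and "\<And>y. y \<in> wordsle (M + length ds) \<Longrightarrow> bdd (\<lambda>s t. G s t y)"
  shows "near (Suc M) (\<lambda>s t. tensor_sum (Y s t) M (\<lambda>y. multilin (\<lambda>z. G s t (y @ z)) (map (H t) ds)))
    (\<lambda>s t. tensor_sum (X s t) M (\<lambda>v. \<Sum>bs\<leftarrow>attach ds v. multilin (G s t) (map (H s) bs)))"
  using assms(6-)
proof (induction ds arbitrary: G rule: rev_induct)
  case Nil
  have "near (Suc M) (\<lambda>s t. tensor_sum (Y s t) M (G s t))
    (\<lambda>s t. tensor_sum (X s t) M (\<lambda>w. \<Sum>bs\<leftarrow>parts w. multilin (G s t) (map (H s) bs)))"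
    by (rule tensor_sum_lift[OF X M Y]) (use Nil.prems(3) in auto)
  then show ?case by simp
next
  case (snoc d ds)
  have d: "set d \<subseteq> vbasis" "M + length d \<le> q"
    "near (Suc M) (\<lambda>s t. H t d) (\<lambda>s t. tensor_sum (X s t) M (\<lambda>v. H s (v @ d)))" "bdd (\<lambda>s t. H t d)"
    using snoc.prems(1,2)[of d] by auto
  \<comment> \<open>The last factor stays at time \<open>t\<close> and is absorbed into the
    coefficient, so that the induction hypothesis handles the other factors. This is why
    \<open>G\<close> may depend on both times.\<close>
  define G' where "G' = (\<lambda>s t y. multilin (\<lambda>z. G s t (y @ z)) [H t d])"
  have G'_app: "multilin (G' s t) us = multilin (G s t) (us @ [H t d])" for s t us
    unfolding G'_def multilin_append ..
  have blocks: "bdd (\<lambda>s t. H s b)" if "v \<in> wordsle M" "bs \<in> set (attach ds v)" "b \<in> set bs" for v bs b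
  proof (rule H(1))
    have "\<forall>d\<in>set ds. set d \<subseteq> vbasis \<and> M + length d \<le> q" using snoc.prems(1) by auto
    then have "length b \<le> q" "set b \<subseteq> vbasis"
      using attachD(2)[OF that(2,3)] attachD(3)[OF that(2)] that(1,3) H(2)
      by (fastforce simp: wordsle_def)+
    then show "b \<in> wordsle q" by (simp add: wordsle_def)
  qed
  have len: "length bs \<le> M + length ds" if "v \<in> wordsle M" "bs \<in> set (attach ds v)" for v bs
    using attachD(1)[OF that(2)] that(1) by (simp add: wordsle_def)
  have Gb: "bdd (\<lambda>s t. G s t y)" if "y \<in> words (Suc (length bs))" "v \<in> wordsle M" "bs \<in> set (attach ds v)" for y v bs
    using that(1) len[OF that(2,3)] by (intro snoc.prems(3)) (simp add: words_def wordsle_def)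
  have "near (Suc M) (\<lambda>s t. tensor_sum (Y s t) M (\<lambda>y. multilin (\<lambda>z. G' s t (y @ z)) (map (H t) ds)))
    (\<lambda>s t. tensor_sum (X s t) M (\<lambda>v. \<Sum>bs\<leftarrow>attach ds v. multilin (G' s t) (map (H s) bs)))"
  proof (rule snoc.IH)
    fix y :: "'w list" assume y: "y \<in> wordsle (M + length ds)"
    show "bdd (\<lambda>s t. G' s t y)"
      unfolding G'_def
    proof (rule bdd_multilin_map[where bs = "[d]" and h = "\<lambda>s. H", simplified])
      show "bdd (\<lambda>s t. H t d)" by (rule d)
      fix z :: "'w list" assume "z \<in> words (Suc 0)"
      then show "bdd (\<lambda>s t. G s t (y @ z))" using y by (intro snoc.prems(3)) (simp add: words_def wordsle_def)
    qed
  qed (use snoc.prems in auto)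
  also have "near (Suc M) (\<lambda>s t. tensor_sum (X s t) M (\<lambda>v. \<Sum>bs\<leftarrow>attach ds v. multilin (G' s t) (map (H s) bs)))
    (\<lambda>s t. tensor_sum (X s t) M (\<lambda>v. \<Sum>bs\<leftarrow>attach ds v.
       multilin (G s t) (map (H s) bs @ [tensor_sum (X s t) M (\<lambda>v. H s (v @ d))])))"
    unfolding G'_app
    by (intro near_tensor_sum[OF X M] near_sum_list near_multilin_snoc d(3)) (blast intro: blocks Gb)+
  also have "(\<lambda>s t. tensor_sum (X s t) M (\<lambda>v. \<Sum>bs\<leftarrow>attach ds v.
       multilin (G s t) (map (H s) bs @ [tensor_sum (X s t) M (\<lambda>v. H s (v @ d))]))) =
    (\<lambda>s t. tensor_sum (X s t) M (\<lambda>v1. tensor_sum (X s t) M (\<lambda>v2. \<Sum>bs\<leftarrow>attach ds v1.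
       multilin (G s t) (map (H s) (bs @ [v2 @ d])))))"
    unfolding multilin_snoc_tensor_sum tensor_sum_sum_list by simp
  also have "near (Suc M) \<dots> (\<lambda>s t. tensor_sum (X s t) M (\<lambda>v. \<Sum>(v1, v2)\<leftarrow>splits v. \<Sum>bs\<leftarrow>attach ds v1.
       multilin (G s t) (map (H s) (bs @ [v2 @ d]))))"
  proof (intro tensor_sum_shuffle[OF X M] bdd_sum_list bdd_multilin_map)
    fix v1 v2 :: "'a list" and bs b
    assume v: "v1 \<in> wordsle M" "v2 \<in> wordsle M" and bs: "bs \<in> set (attach ds v1)"
      and b: "b \<in> set (bs @ [v2 @ d])"
    have "v2 @ d \<in> wordsle q" using v(2) d(1,2) by (auto simp: wordsle_def)
    then show "bdd (\<lambda>s t. H s b)" using b blocks[OF v(1) bs] H(1) by auto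
  next
    fix v1 v2 :: "'a list" and bs and y :: "'w list"
    assume v: "v1 \<in> wordsle M" "v2 \<in> wordsle M" and bs: "bs \<in> set (attach ds v1)"
      and y: "y \<in> words (length (bs @ [v2 @ d]))"
    show "bdd (\<lambda>s t. G s t y)" using y by (intro Gb[OF _ v(1) bs]) simp
  qed
  finally show ?case
    unfolding sum_attach_snoc G'_def by (simp add: multilin_append[of _ "map _ ds"])
qed

lemma is_lift_rough_path: "is_lift T p \<omega> X H Y \<Longrightarrow> rough_path T p \<omega> Y"
  by (simp add: is_lift_def)

text \<open>In degree one the definition of a lift gives the increments of the trace and no
  expansion, hence the hypothesis \<open>trace\<close>. It is available for
  \<open>M < level p\<close> if \<open>H\<close> is merely controlled, and for
  \<open>M = level p\<close> if \<open>H\<close> comes from a rough integral.\<close>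

lemma is_lift_near:
  assumes X: "rough_path T p \<omega> X" and Y: "is_lift T p \<omega> X H Y" and M: "M \<le> level p"
    and H: "\<And>w. w \<in> wordsle (level p - 1) \<Longrightarrow> bdd (\<lambda>s t. H s w)"
    and trace: "near (Suc M) (\<lambda>s t. H t []) (\<lambda>s t. tensor_sum (X s t) M (H s))"
    and y: "y \<in> wordsle M"
  shows "near (Suc M) (\<lambda>s t. Y s t y)
      (\<lambda>s t. tensor_sum (X s t) M (\<lambda>w. \<Sum>bs\<leftarrow>parts w. pure_tensor (map (H s) bs) y))"
proof -
  have yw: "y \<in> words (length y)" using y by (auto simp: wordsle_def words_def)
  have filter: "(\<Sum>bs\<leftarrow>parts w. if length bs = length y then pure_tensor (map (H s) bs) y else 0) =
      (\<Sum>bs\<leftarrow>parts w. pure_tensor (map (H s) bs) y)" for w s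
    by (intro sum_list_cong) (auto simp: pure_tensor_def words_def)
  consider "length y = 0" | "length y = 1" | "2 \<le> length y" by linarith
  then show ?thesis
  proof cases
    case 1
    then have y0: "y = []" by simp
    have p0: "(\<Sum>bs\<leftarrow>parts w. pure_tensor (map (H s) bs) []) = (if w = [] then 1 else 0)" for w s
    proof (cases "w = []")
      case False
      then have "(\<Sum>bs\<leftarrow>parts w. pure_tensor (map (H s) bs) []) = (\<Sum>bs\<leftarrow>parts w. 0)"
        using partsD(5) by (intro sum_list_cong) (auto simp: pure_tensor_def words_def)
      then show ?thesis using False by simp
    qed (simp add: pure_tensor_def)
    have lhs: "Y s t y = 1" if "(s, t) \<in> triangle T" for s t
      using rough_path_Nil[OF is_lift_rough_path[OF Y] that] y0 by simp
    have rhs: "tensor_sum (X s t) M (\<lambda>w. \<Sum>bs\<leftarrow>parts w. pure_tensor (map (H s) bs) y) = 1"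
      if "(s, t) \<in> triangle T" for s t
      unfolding y0 p0 tensor_sum_split_Nil using rough_path_Nil[OF X that] by (auto intro!: sum.neutral)
    show ?thesis
      by (rule near_eqI[OF near_refl[of _ "\<lambda>s t. 1"]]) (rule lhs, assumption, rule rhs, assumption)
  next
    case 2
    then obtain b where b: "y = [b]" "b \<in> vbasis" using yw by (auto simp: length_Suc_conv words_def)
    have p1: "(\<Sum>bs\<leftarrow>parts w. pure_tensor (map (H s) bs) y) = (if w = [] then 0 else coord (H s w) b)" for w s
    proof (cases "w = []")
      case False
      have "pure_tensor [h] y = coord h b" for h
        using b pure_tensor_Cons[of "[]" "[]" b h] by (simp add: pure_tensor_def)
      then show ?thesis
        using parts_singleton[OF False, of "\<lambda>bs. pure_tensor (map (H s) bs) y"] filter[of s w] False 2 by simp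
    qed (simp add: pure_tensor_def words_def b)
    have "near (Suc M) (\<lambda>s t. coord (H t []) b) (\<lambda>s t. coord (tensor_sum (X s t) M (H s)) b)"
      by (rule near_bounded_linear[OF bounded_linear_coord trace])
    then have "near (Suc M) (\<lambda>s t. coord (H t []) b + - coord (H s []) b)
        (\<lambda>s t. coord (tensor_sum (X s t) M (H s)) b + - coord (H s []) b)"
      by (intro near_add near_refl)
    then show ?thesis
    proof (rule near_eqI)
      fix s t assume st: "(s, t) \<in> triangle T"
      have "y \<in> words 1" using yw 2 by simp
      then have "Y s t y = pure_tensor [H t [] - H s []] y"
        using Y st unfolding is_lift_def by blast
      then show "Y s t y = coord (H t []) b + - coord (H s []) b"
        using b pure_tensor_Cons[of "[]" "[]" b] linear_diff[OF linear_coord] by (simp add: pure_tensor_def)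
      show "tensor_sum (X s t) M (\<lambda>w. \<Sum>bs\<leftarrow>parts w. pure_tensor (map (H s) bs) y) =
        coord (tensor_sum (X s t) M (H s)) b + - coord (H s []) b"
        unfolding p1 tensor_sum_split_Nil
        by (simp add: rough_path_Nil[OF X st] coord_add linear_sum[OF linear_coord] coord_scaleR)
    qed
  next
    case 3
    let ?m = "length y"
    have "near (level p + 1) (\<lambda>s t. Y s t y)
      (\<lambda>s t. \<Sum>ns | length ns = ?m \<and> (\<forall>n\<in>set ns. 1 \<le> n) \<and> sum_list ns \<le> level p.
             ext_map ns (H s) (Delta_osh ns (X s t)) y)"
      using Y 3 y yw M unfolding is_lift_def wordsle_def by auto
    also have "(\<lambda>s t. \<Sum>ns | length ns = ?m \<and> (\<forall>n\<in>set ns. 1 \<le> n) \<and> sum_list ns \<le> level p.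
             ext_map ns (H s) (Delta_osh ns (X s t)) y) =
      (\<lambda>s t. tensor_sum (X s t) (level p) (\<lambda>w. \<Sum>bs\<leftarrow>parts w. if length bs = ?m then pure_tensor (map (H s) bs) y else 0))"
    proof (intro ext)
      fix s t
      have "{ns. length ns = ?m \<and> (\<forall>n\<in>set ns. 1 \<le> n) \<and> sum_list ns \<le> level p} = (\<Union>n\<le>level p. compositions ?m n)"
        by (auto simp: compositions_def)
      moreover have "(\<Sum>ns\<in>(\<Union>n\<le>level p. compositions ?m n). f ns) = (\<Sum>n\<le>level p. \<Sum>ns\<in>compositions ?m n. f ns)" for f :: "nat list \<Rightarrow> real"
        by (rule sum.UNION_disjoint) (auto simp: finite_compositions, auto simp: compositions_def)
      ultimately show "(\<Sum>ns | length ns = ?m \<and> (\<forall>n\<in>set ns. 1 \<le> n) \<and> sum_list ns \<le> level p.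
             ext_map ns (H s) (Delta_osh ns (X s t)) y) =
        tensor_sum (X s t) (level p) (\<lambda>w. \<Sum>bs\<leftarrow>parts w. if length bs = ?m then pure_tensor (map (H s) bs) y else 0)"
        unfolding tensor_sum_def sum_wordsle by (simp add: sum_ext_map_Delta_osh)
    qed
    finally have "near (Suc M) (\<lambda>s t. Y s t y) (\<lambda>s t. tensor_sum (X s t) (level p) (\<lambda>w. \<Sum>bs\<leftarrow>parts w. if length bs = ?m then pure_tensor (map (H s) bs) y else 0))"
      by (rule near_mono[rotated]) (use M in simp)
    also have "near (Suc M) \<dots> (\<lambda>s t. tensor_sum (X s t) M (\<lambda>w. \<Sum>bs\<leftarrow>parts w. if length bs = ?m then pure_tensor (map (H s) bs) y else 0))"
    proof (intro tensor_sum_truncate[OF X M] order_refl bdd_sum_list)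
      fix w :: "'a list" and bs assume w: "w \<in> wordsle (level p)" and bs: "bs \<in> set (parts w)"
      show "bdd (\<lambda>s t. if length bs = ?m then pure_tensor (map (H s) bs) y else 0)"
      proof (cases "length bs = ?m")
        case True
        \<comment> \<open>There are at least two blocks, so each is shorter than
          \<open>level p\<close> and within the range where \<open>H\<close> is known to be
          bounded.\<close>
        have "bdd (\<lambda>s t. H s b)" if "b \<in> set bs" for b
        proof (rule H)
          show "b \<in> wordsle (level p - 1)"
            using parts_wordsle(1)[OF bs w that] True 3 by (auto simp: wordsle_def)
        qed
        then have "bdd (\<lambda>s t. pure_tensor (map (H s) bs) y)" by (rule bdd_pure_tensor)
        then show ?thesis using True by simp
      qed (simp add: bdd_const)
    qed
    finally show ?thesis unfolding filter .
  qed
qed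

section \<open>Local expansions of rough integrals\<close>

text \<open>The constant term of \<open>X\<close> is one, so \<open>I s\<close> becomes the term of
  the empty word. The expansion reaches degree \<open>level p\<close>, since a word of that length
  evaluates the top level of \<open>H\<close> at its last letter.\<close>

lemma rough_integral_near:
  assumes X: "rough_path T p \<omega> X" and I: "is_rough_integral T p \<omega> X H I"
  shows "near (Suc (level p)) (\<lambda>s t. I t) (\<lambda>s t. tensor_sum (X s t) (level p) (controlled_integral H I s))"
proof -
  have "near (level p + 1) (\<lambda>s t. I t - I s) (\<lambda>s t. \<Sum>n=1..level p. pairing n (uncurry_last (H s)) (X s t))"
    using I by (simp add: is_rough_integral_def)
  then have "near (level p + 1) (\<lambda>s t. (I t - I s) + I s)
      (\<lambda>s t. (\<Sum>n=1..level p. pairing n (uncurry_last (H s)) (X s t)) + I s)"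
    by (intro near_add near_refl)
  moreover have "tensor_sum (X s t) (level p) (controlled_integral H I s) =
      (\<Sum>n=1..level p. pairing n (uncurry_last (H s)) (X s t)) + I s" if st: "(s, t) \<in> triangle T" for s t
  proof -
    have "wordsle (level p) - {[]} = (\<Union>n\<in>{1..level p}. words n :: 'a list set)"
      by (auto simp: wordsle_def words_def Suc_le_eq)
    moreover have "(\<Sum>w\<in>(\<Union>n\<in>{1..level p}. words n). X s t w *\<^sub>R controlled_integral H I s w) =
        (\<Sum>n=1..level p. \<Sum>w\<in>words n. X s t w *\<^sub>R controlled_integral H I s w)"
      by (rule sum.UNION_disjoint) (auto dest: length_words)
    moreover have "(\<Sum>w\<in>words n. X s t w *\<^sub>R controlled_integral H I s w) = pairing n (uncurry_last (H s)) (X s t)"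
      if "n \<in> {1..level p}" for n
      unfolding pairing_def by (intro sum.cong refl) (use that in \<open>auto simp: controlled_integral_def words_def\<close>)
    ultimately show ?thesis
      by (simp add: tensor_sum_split_Nil rough_path_Nil[OF X st])
  qed
  ultimately have "near (level p + 1) (\<lambda>s t. I t) (\<lambda>s t. tensor_sum (X s t) (level p) (controlled_integral H I s))"
    by - (erule near_eqI, simp_all)
  then show ?thesis by simp
qed

lemma wordsle_snoc: "x @ [e] \<in> wordsle n \<longleftrightarrow> x \<in> wordsle (n - 1) \<and> e \<in> vbasis \<and> 1 \<le> n"
  by (auto simp: wordsle_def)

lemma bdd_controlled_integral:
  assumes H: "controlled_path T p \<omega> X H" and I: "is_rough_integral T p \<omega> Y K I"
    and w: "w \<in> wordsle (level p)"
  shows "bdd (\<lambda>s t. controlled_integral H I s w)"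
proof (cases w rule: rev_cases)
  case Nil
  then show ?thesis using I holder_pathD(1) by (auto simp: is_rough_integral_def)
next
  case (snoc x e)
  then have "x \<in> wordsle (level p - 1)" using w wordsle_snoc by blast
  then have "bdd (\<lambda>s t. H s x)" by (rule controlled_path_bdd(1)[OF H])
  then have "bdd (\<lambda>s t. blinfun_apply (H s x) e)"
    by (rule bdd_bounded_linear[OF blinfun.bounded_linear_left])
  then show ?thesis using snoc by simp
qed

text \<open>On a word \<open>x @ [e]\<close> the expansion is that of \<open>H\<close> on
  \<open>x\<close>, applied to \<open>e\<close>; on the empty word it is the defining expansion of
  the integral.\<close>

lemma controlled_integral_controlled:
  fixes X :: "real \<Rightarrow> real \<Rightarrow> 'v::fin_dim_normed_vector tensor"
  assumes X: "rough_path T p \<omega> X" and H: "controlled_path T p \<omega> X H"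
    and I: "is_rough_integral T p \<omega> X H I"
  shows "controlled_path T p \<omega> X (controlled_integral H I)"
  unfolding controlled_path_iff
proof (intro conjI allI impI ballI)
  fix n and w :: "'v list" assume n: "n < level p" and w: "w \<in> words n"
  show "holder_path T p \<omega> (\<lambda>t. controlled_integral H I t w)"
  proof (cases w rule: rev_cases)
    case Nil
    then show ?thesis using I by (simp add: is_rough_integral_def)
  next
    case (snoc x e)
    then have "x \<in> words (n - 1)" using w by (auto simp: words_def)
    then have "holder_path T p \<omega> (\<lambda>t. H t x)"
      using H n unfolding controlled_path_iff by (meson less_imp_diff_less)
    then have "holder_path T p \<omega> (\<lambda>t. blinfun_apply (H t x) e)"
      by (rule holder_path_bounded_linear[OF blinfun.bounded_linear_left])
    then show ?thesis using snoc by simp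
  qed
next
  fix n and w :: "'v list" assume n: "n + 2 \<le> level p" and w: "w \<in> words n"
  let ?I = "controlled_integral H I"
  have bdd: "bdd (\<lambda>s t. ?I s (v @ w))" if "v \<in> wordsle (level p - n)" for v
    using that n w by (intro bdd_controlled_integral[OF H I]) (auto simp: wordsle_def words_def)
  \<comment> \<open>In both cases the known expansion goes one degree beyond what is asked for,
    because a word for the integral is one letter longer than for \<open>H\<close>. The surplus
    degree has the order of the admissible error.\<close>
  have trunc: "near (Suc (level p - 1 - n)) (\<lambda>s t. tensor_sum (X s t) (level p - n) (\<lambda>v. ?I s (v @ w)))
      (\<lambda>s t. tensor_sum (X s t) (level p - 1 - n) (\<lambda>v. ?I s (v @ w)))"
    by (rule tensor_sum_truncate[OF X _ _ bdd]) auto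
  have S: "Suc (level p - 1 - n) = level p - n" using n by simp
  have "near (level p - n) (\<lambda>s t. ?I t w) (\<lambda>s t. tensor_sum (X s t) (level p - n) (\<lambda>v. ?I s (v @ w)))"
  proof (cases w rule: rev_cases)
    case Nil
    then have "n = 0" using w by (auto simp: words_def)
    then show ?thesis using near_mono[OF _ rough_integral_near[OF X I]] Nil by simp
  next
    case (snoc x e)
    then have x: "x \<in> words (n - 1)" "n = Suc (n - 1)" using w by (auto simp: words_def)
    have "near (level p - length x) (\<lambda>s t. H t x) (\<lambda>s t. tensor_sum (X s t) (level p - 1 - length x) (\<lambda>v. H s (v @ x)))"
      using x n by (intro controlled_path_near[OF X H]) (auto simp: wordsle_def words_def)
    then have "near (level p - n) (\<lambda>s t. H t x) (\<lambda>s t. tensor_sum (X s t) (level p - n) (\<lambda>v. H s (v @ x)))"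
      using x length_words[OF x(1)] by (intro near_mono[of "level p - n" "level p - length x"]) auto
    then have "near (level p - n) (\<lambda>s t. blinfun_apply (H t x) e)
        (\<lambda>s t. blinfun_apply (tensor_sum (X s t) (level p - n) (\<lambda>v. H s (v @ x))) e)"
      by (rule near_bounded_linear[OF blinfun.bounded_linear_left])
    moreover have app: "blinfun_apply (tensor_sum A M F) e = tensor_sum A M (\<lambda>v. blinfun_apply (F v) e)"
      for A :: "'v tensor" and M F
      by (simp add: tensor_sum_def blinfun.sum_left blinfun.scaleR_left)
    moreover have "?I s (v @ w) = blinfun_apply (H s (v @ x)) e" for s v
      using controlled_integral_snoc[of H I s "v @ x" e] snoc by simp
    ultimately show ?thesis unfolding snoc app by simp
  qed
  also note trunc[unfolded S]
  finally show "near (level p - n) (\<lambda>s t. ?I t w) (\<lambda>s t. tensor_sum (X s t) (level p - 1 - n) (\<lambda>v. ?I s (v @ w)))" .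
qed

section \<open>Change of controlling path\<close>

lemma controlled_path_near_multilin:
  fixes Y :: "real \<Rightarrow> real \<Rightarrow> 'w::fin_dim_normed_vector tensor"
  assumes Y: "rough_path T p \<omega> Y" and K: "controlled_path T p \<omega> Y K"
    and bs: "\<And>b. b \<in> set bs \<Longrightarrow> bdd (\<lambda>s t. h s t b)" "length bs < level p"
  shows "near (level p - length bs) (\<lambda>s t. multilin (K t) (map (h s t) bs))
    (\<lambda>s t. tensor_sum (Y s t) (level p - 1 - length bs) (\<lambda>y. multilin (\<lambda>z. K s (y @ z)) (map (h s t) bs)))"
proof -
  have "near (level p - length bs) (\<lambda>s t. multilin (K t) (map (h s t) bs))
    (\<lambda>s t. multilin (\<lambda>z. tensor_sum (Y s t) (level p - 1 - length bs) (\<lambda>y. K s (y @ z))) (map (h s t) bs))"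
  proof (rule near_multilin[OF bs(1)])
    fix z :: "'w list" assume z: "z \<in> words (length bs)"
    then have "near (level p - length z) (\<lambda>s t. K t z)
        (\<lambda>s t. tensor_sum (Y s t) (level p - 1 - length z) (\<lambda>y. K s (y @ z)))"
      using bs(2) by (intro controlled_path_near[OF Y K]) (auto simp: wordsle_def words_def)
    then show "near (level p - length bs) (\<lambda>s t. K t z)
        (\<lambda>s t. tensor_sum (Y s t) (level p - 1 - length bs) (\<lambda>y. K s (y @ z)))"
      using length_words[OF z] by simp
  qed
  then show ?thesis unfolding multilin_tensor_sum .
qed

text \<open>\<open>star K H t w\<close> is a sum over partitions \<open>ds\<close> of
  \<open>w\<close> with all factors at time \<open>t\<close>. Expanding \<open>K\<close> along
  \<open>Y\<close> and the factors \<open>H t d\<close> along \<open>X\<close> produces, for fixed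
  \<open>ds\<close>, the partitions of \<open>v @ w\<close> that induce \<open>ds\<close> on
  \<open>w\<close>; together these are all partitions of \<open>v @ w\<close>.\<close>

lemma star_controlled:
  fixes X :: "real \<Rightarrow> real \<Rightarrow> 'v::fin_dim_normed_vector tensor"
    and Y :: "real \<Rightarrow> real \<Rightarrow> 'w::fin_dim_normed_vector tensor"
  assumes X: "rough_path T p \<omega> X" and H: "controlled_path T p \<omega> X H"
    and Y: "is_lift T p \<omega> X H Y" and K: "controlled_path T p \<omega> Y K"
  shows "controlled_path T p \<omega> X (star K H)"
  unfolding controlled_path_iff
proof (intro conjI allI impI ballI)
  fix n and w :: "'v list" assume n: "n < level p" and w: "w \<in> words n"
  have "holder_path T p \<omega> (\<lambda>t. \<Sum>bs\<leftarrow>parts w. multilin (K t) (map (H t) bs))"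
  proof (intro holder_path_sum_list holder_path_multilin)
    fix bs b assume bs: "bs \<in> set (parts w)" "b \<in> set bs"
    have "w \<in> wordsle n" using w by (simp add: wordsle_def words_def)
    then have "b \<in> wordsle n" using parts_wordsle(2)[OF bs(1) _ bs(2)] by blast
    then have "length b < level p" "b \<in> words (length b)" using n by (auto simp: wordsle_def words_def)
    then show "holder_path T p \<omega> (\<lambda>t. H t b)" using H unfolding controlled_path_iff by blast
  next
    fix bs and y :: "'w list" assume bs: "bs \<in> set (parts w)" and y: "y \<in> words (length bs)"
    have "length bs < level p" using partsD(1)[OF bs] length_words[OF w] n by simp
    then show "holder_path T p \<omega> (\<lambda>t. K t y)" using K y unfolding controlled_path_iff by blast
  qed
  then show "holder_path T p \<omega> (\<lambda>t. star K H t w)" by (simp add: star_eq_parts[OF w])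
next
  fix n and w :: "'v list" assume n: "n + 2 \<le> level p" and w: "w \<in> words n"
  \<comment> \<open>A common degree for all expansions: \<open>length ds\<close> and every
    \<open>length d\<close> are at most \<open>n\<close>, so \<open>K\<close> and \<open>H\<close>
    are known on them at least to order \<open>Suc M\<close>.\<close>
  define M where "M = level p - 1 - n"
  have M: "M \<le> level p" "M + n = level p - 1" "level p - n = Suc M" using n by (auto simp: M_def)
  note rY = is_lift_rough_path[OF Y]
  have trunc: "near (Suc M) (\<lambda>s t. H t d) (\<lambda>s t. tensor_sum (X s t) M (\<lambda>v. H s (v @ d)))"
    if "set d \<subseteq> vbasis" "length d \<le> n" for d
  proof -
    have "near (level p - length d) (\<lambda>s t. H t d) (\<lambda>s t. tensor_sum (X s t) (level p - 1 - length d) (\<lambda>v. H s (v @ d)))"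
      using that n by (intro controlled_path_near[OF X H]) (auto simp: wordsle_def)
    then have "near (Suc M) (\<lambda>s t. H t d) (\<lambda>s t. tensor_sum (X s t) (level p - 1 - length d) (\<lambda>v. H s (v @ d)))"
      by (rule near_mono[rotated]) (use that n in \<open>simp add: M_def\<close>)
    also have "near (Suc M) \<dots> (\<lambda>s t. tensor_sum (X s t) M (\<lambda>v. H s (v @ d)))"
    proof (rule tensor_sum_truncate[OF X])
      fix v :: "'v list" assume "v \<in> wordsle (level p - 1 - length d)"
      then show "bdd (\<lambda>s t. H s (v @ d))"
        using that n by (intro controlled_path_bdd(1)[OF H]) (auto simp: wordsle_def)
    qed (use that n in \<open>auto simp: M_def\<close>)
    finally show ?thesis .
  qed
  have lift: "near (Suc M) (\<lambda>s t. Y s t y)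
      (\<lambda>s t. tensor_sum (X s t) M (\<lambda>w. \<Sum>bs\<leftarrow>parts w. pure_tensor (map (H s) bs) y))"
    if "y \<in> wordsle M" for y
    using trunc[of "[]"] by (intro is_lift_near[OF X Y M(1) _ _ that] controlled_path_bdd(1)[OF H]) simp_all
  have "near (Suc M) (\<lambda>s t. \<Sum>ds\<leftarrow>parts w. multilin (K t) (map (H t) ds))
    (\<lambda>s t. \<Sum>ds\<leftarrow>parts w. tensor_sum (X s t) M (\<lambda>v. \<Sum>bs\<leftarrow>attach ds v. multilin (K s) (map (H s) bs)))"
  proof (rule near_sum_list)
    fix ds assume ds: "ds \<in> set (parts w)"
    have lds: "length ds \<le> n" using partsD(1)[OF ds] length_words[OF w] by simp
    have d: "set d \<subseteq> vbasis" "length d \<le> n" if "d \<in> set ds" for d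
      using parts_wordsle(2)[OF ds _ that, of n] w by (auto simp: wordsle_def words_def)
    have bd: "bdd (\<lambda>s t. H t d)" if "d \<in> set ds" for d
      using d[OF that] n by (intro controlled_path_bdd(2)[OF H]) (auto simp: wordsle_def)
    have "near (level p - length ds) (\<lambda>s t. multilin (K t) (map (H t) ds))
      (\<lambda>s t. tensor_sum (Y s t) (level p - 1 - length ds) (\<lambda>y. multilin (\<lambda>z. K s (y @ z)) (map (H t) ds)))"
      by (rule controlled_path_near_multilin[OF rY K bd]) (use lds n in simp_all)
    then have "near (Suc M) (\<lambda>s t. multilin (K t) (map (H t) ds))
      (\<lambda>s t. tensor_sum (Y s t) (level p - 1 - length ds) (\<lambda>y. multilin (\<lambda>z. K s (y @ z)) (map (H t) ds)))"
      by (rule near_mono[rotated]) (use lds n in \<open>simp add: M_def\<close>)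
    also have "near (Suc M) \<dots> (\<lambda>s t. tensor_sum (Y s t) M (\<lambda>y. multilin (\<lambda>z. K s (y @ z)) (map (H t) ds)))"
    proof (intro tensor_sum_truncate[OF rY] bdd_multilin_map bd)
      fix y z :: "'w list" assume "y \<in> wordsle (level p - 1 - length ds)" "z \<in> words (length ds)"
      then show "bdd (\<lambda>s t. K s (y @ z))"
        using lds n by (intro controlled_path_bdd(1)[OF K]) (auto simp: wordsle_def words_def)
    qed (use lds n in \<open>auto simp: M_def\<close>)
    also have "near (Suc M) \<dots> (\<lambda>s t. tensor_sum (X s t) M (\<lambda>v. \<Sum>bs\<leftarrow>attach ds v. multilin (K s) (map (H s) bs)))"
    proof (rule tensor_sum_attach[where q = "level p - 1", OF X M(1) lift])
      fix y :: "'w list" assume "y \<in> wordsle (M + length ds)"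
      then show "bdd (\<lambda>s t. K s y)"
        using lds M(2) by (intro controlled_path_bdd(1)[OF K]) (auto simp: wordsle_def)
    next
      fix d assume "d \<in> set ds"
      from d[OF this] show "set d \<subseteq> vbasis \<and> M + length d \<le> level p - 1 \<and>
          near (Suc M) (\<lambda>s t. H t d) (\<lambda>s t. tensor_sum (X s t) M (\<lambda>v. H s (v @ d)))"
        using trunc[of d] M(2) by auto
    qed (use M bd controlled_path_bdd(1)[OF H] in auto)
    finally show "near (Suc M) (\<lambda>s t. multilin (K t) (map (H t) ds))
      (\<lambda>s t. tensor_sum (X s t) M (\<lambda>v. \<Sum>bs\<leftarrow>attach ds v. multilin (K s) (map (H s) bs)))" .
  qed
  moreover have "(\<Sum>ds\<leftarrow>parts w. tensor_sum (X s t) M (\<lambda>v. \<Sum>bs\<leftarrow>attach ds v. multilin (K s) (map (H s) bs))) =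
      tensor_sum (X s t) M (\<lambda>v. star K H s (v @ w))" for s t
    unfolding tensor_sum_sum_list[symmetric] sum_parts_append[symmetric]
  proof (rule tensor_sum_cong)
    fix v :: "'v list" assume "v \<in> wordsle M"
    then have "v @ w \<in> wordsle (M + n)" using w by (auto simp: wordsle_def words_def)
    then show "(\<Sum>bs\<leftarrow>parts (v @ w). multilin (K s) (map (H s) bs)) = star K H s (v @ w)"
      by (rule star_eq_parts'[symmetric])
  qed
  ultimately show "near (level p - n) (\<lambda>s t. star K H t w)
      (\<lambda>s t. tensor_sum (X s t) (level p - 1 - n) (\<lambda>v. star K H s (v @ w)))"
    unfolding M(3) M_def[symmetric] by (simp add: star_eq_parts[OF w])
qed

section \<open>Uniqueness by superadditivity of the control\<close>

lemma sum_control_le: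
  assumes "t \<in> {0..T}" "0 < n" "k \<le> n"
  shows "(\<Sum>i<k. \<omega> (real i * t / real n) (real (Suc i) * t / real n)) \<le> \<omega> 0 (real k * t / real n)"
  using assms(3)
proof (induction k)
  case 0
  then show ?case using control T_pos by (auto simp: control_def)
next
  case (Suc k)
  let ?x = "\<lambda>k. real k * t / real n"
  have "real (Suc k) * t \<le> real n * t" using Suc.prems assms(1) by (intro mult_right_mono) auto
  then have "?x (Suc k) \<le> t" using assms(2) by (simp add: field_simps)
  moreover have "0 \<le> ?x k" using assms(1) by simp
  moreover have "?x k \<le> ?x (Suc k)" using assms(1,2) by (simp add: divide_right_mono mult_right_mono)
  ultimately have "\<omega> 0 (?x k) + \<omega> (?x k) (?x (Suc k)) \<le> \<omega> 0 (?x (Suc k))"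
    using control assms(1) by (auto simp: control_def)
  then show ?case using Suc by simp
qed

text \<open>The exponent \<open>\<theta>\<close> exceeds one because \<open>p < level p + 1\<close>.
  Over fine subdivisions the sum of \<open>\<omega> powr \<theta>\<close> tends to zero, while the
  sum of \<open>\<omega>\<close> itself stays below \<open>\<omega> 0 t\<close>.\<close>

lemma small_increments_imp_constant:
  fixes f :: "real \<Rightarrow> 'a::real_normed_vector"
  assumes f: "near (Suc (level p)) (\<lambda>s t. f t) (\<lambda>s t. f s)" and t: "t \<in> {0..T}"
  shows "f t = f 0"
proof (rule ccontr)
  assume ne: "f t \<noteq> f 0"
  define \<theta> where "\<theta> = real (Suc (level p)) / p"
  have "p < real (Suc (level p))" using p_ge by linarith
  then have \<theta>: "1 < \<theta>" using p_ge by (simp add: \<theta>_def)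
  obtain C where C: "C \<ge> 0" "\<And>s t. (s, t) \<in> triangle T \<Longrightarrow> norm (f t - f s) \<le> C * \<omega> s t powr \<theta>"
    using f unfolding near_iff[of _ "\<lambda>s t. f t"] by (rule smallE) (auto simp: \<theta>_def)
  define W where "W = \<omega> 0 t"
  have W: "0 \<le> W" using t by (auto simp: W_def triangle_def intro!: control_nonneg)
  define d where "d = norm (f t - f 0)"
  have d: "0 < d" using ne by (simp add: d_def)
  \<comment> \<open>Chosen so that \<open>C * r * W\<close> falls below \<open>d\<close>; the added
    ones keep the denominator positive. Up to the threshold \<open>e\<close>, defined by
    \<open>e powr (\<theta> - 1) = r\<close>, one has
    \<open>\<omega> powr \<theta> \<le> r * \<omega>\<close>.\<close>
  define r where "r = d / (2 * (C + 1) * (W + 1))"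
  have r: "0 < r" using d C(1) W by (simp add: r_def)
  define e where "e = r powr (1 / (\<theta> - 1))"
  have e: "0 < e" "e powr (\<theta> - 1) = r" using r \<theta> by (auto simp: e_def powr_powr)
  \<comment> \<open>\<open>\<omega>\<close> vanishes on the diagonal, so uniform continuity brings
    it below \<open>e\<close> on all sufficiently short subintervals at once.\<close>
  have "uniformly_continuous_on (triangle T) (\<lambda>(s, t). \<omega> s t)"
    using control compact_triangle by (intro compact_uniformly_continuous) (auto simp: control_def)
  then obtain \<delta> where \<delta>: "0 < \<delta>"
    "\<And>x x'. x \<in> triangle T \<Longrightarrow> x' \<in> triangle T \<Longrightarrow> dist x' x < \<delta> \<Longrightarrow> dist ((\<lambda>(s, t). \<omega> s t) x') ((\<lambda>(s, t). \<omega> s t) x) < e"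
    using e(1) unfolding uniformly_continuous_on_def by meson
  obtain n where n: "T / \<delta> < real n" using reals_Archimedean2 by blast
  then have n0: "0 < n" using T_pos \<delta>(1) by (cases n) (auto simp: divide_less_0_iff)
  let ?x = "\<lambda>k. real k * t / real n"
  have step: "norm (f (?x (Suc i)) - f (?x i)) \<le> C * r * \<omega> (?x i) (?x (Suc i))" if i: "i < n" for i
  proof -
    have le: "?x i \<le> ?x (Suc i)" using t n0 by (simp add: divide_right_mono mult_right_mono)
    have "real (Suc i) * t \<le> real n * t" using i t by (intro mult_right_mono) auto
    then have "?x (Suc i) \<le> t" using n0 by (simp add: field_simps)
    then have tri: "(?x i, ?x (Suc i)) \<in> triangle T" "(?x i, ?x i) \<in> triangle T"
      using le t by (auto simp: triangle_def)
    have "?x (Suc i) - ?x i = t / real n" by (simp add: diff_divide_distrib[symmetric] algebra_simps)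
    also have "\<dots> \<le> T / real n" using t n0 by (simp add: divide_right_mono)
    also have "\<dots> < \<delta>" using n n0 \<delta>(1) by (simp add: field_simps)
    finally have "dist (?x i, ?x (Suc i)) (?x i, ?x i) < \<delta>"
      using le by (simp add: dist_Pair_Pair dist_real_def)
    from \<delta>(2)[OF tri(2,1) this] have "\<bar>\<omega> (?x i) (?x (Suc i)) - \<omega> (?x i) (?x i)\<bar> < e"
      by (simp add: dist_real_def)
    moreover have "\<omega> (?x i) (?x i) = 0" using control tri(2) by (auto simp: control_def triangle_def)
    ultimately have small: "\<omega> (?x i) (?x (Suc i)) \<le> e" by simp
    have nn: "0 \<le> \<omega> (?x i) (?x (Suc i))" by (rule control_nonneg[OF tri(1)])
    have "\<omega> (?x i) (?x (Suc i)) powr \<theta> = \<omega> (?x i) (?x (Suc i)) powr (\<theta> - 1) * \<omega> (?x i) (?x (Suc i)) powr 1"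
      by (simp only: powr_add[symmetric]) simp
    also have "\<dots> \<le> r * \<omega> (?x i) (?x (Suc i))"
      using powr_mono2[OF _ nn small, of "\<theta> - 1"] \<theta> e(2) nn by (intro mult_mono) auto
    finally have "C * \<omega> (?x i) (?x (Suc i)) powr \<theta> \<le> C * (r * \<omega> (?x i) (?x (Suc i)))"
      using C(1) by (rule mult_left_mono)
    then show ?thesis using C(2)[OF tri(1)] by (simp add: mult.assoc)
  qed
  have "f t - f 0 = (\<Sum>i<n. f (?x (Suc i)) - f (?x i))"
    by (subst sum_lessThan_telescope) (use n0 in simp)
  then have "d \<le> (\<Sum>i<n. norm (f (?x (Suc i)) - f (?x i)))" unfolding d_def by (simp add: norm_sum)
  also have "\<dots> \<le> (\<Sum>i<n. C * r * \<omega> (?x i) (?x (Suc i)))" by (intro sum_mono step) simp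
  also have "\<dots> = C * r * (\<Sum>i<n. \<omega> (?x i) (?x (Suc i)))" by (simp add: sum_distrib_left)
  also have "\<dots> \<le> C * r * W"
    using sum_control_le[OF t n0 order_refl] n0 C(1) r by (intro mult_left_mono) (auto simp: W_def)
  also have "\<dots> \<le> (C + 1) * r * (W + 1)" using C(1) r W by (intro mult_mono) auto
  also have "\<dots> = d / 2"
  proof -
    have "a * (d / (2 * a * b)) * b = d / 2" if "0 < a" "0 < b" for a b :: real
      using that by (simp add: field_simps)
    from this[of "C + 1" "W + 1"] show ?thesis unfolding r_def using C(1) W by linarith
  qed
  finally show False using d by simp
qed

text \<open>Induction on the degree. Once the lower degrees agree, the mixed terms in Chen's
  relation cancel and the difference in degree \<open>n\<close> is additive over adjacent intervals;
  being of order \<open>Suc (level p)\<close>, it vanishes.\<close>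

lemma rough_path_unique:
  fixes X :: "real \<Rightarrow> real \<Rightarrow> 'v::fin_dim_normed_vector tensor"
  assumes X: "rough_path T p \<omega> X" and Y: "rough_path T p \<omega> Y"
    and near: "\<And>w. w \<in> wordsle (level p) \<Longrightarrow> near (Suc (level p)) (\<lambda>s t. X s t w) (\<lambda>s t. Y s t w)"
  shows "rough_path_eq T p X Y"
proof -
  have "\<forall>w\<in>words n. \<forall>(s, t)\<in>triangle T. X s t w = Y s t w" if "n \<le> level p" for n
    using that
  proof (induction n rule: less_induct)
    case (less n)
    show ?case
    proof (intro ballI, clarify)
      fix w :: "'v list" and s t assume w: "w \<in> words n" and st: "(s, t) \<in> triangle T"
      show "X s t w = Y s t w"
      proof (cases "n = 0")
        case True
        then show ?thesis using w rough_path_Nil[OF X st] rough_path_Nil[OF Y st] by simp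
      next
        case False
        let ?D = "\<lambda>s t. X s t w - Y s t w"
        have chen: "?D s t = ?D s u + ?D u t" if sut: "0 \<le> s" "s \<le> u" "u \<le> t" "t \<le> T" for s u t
        proof -
          have tri: "(s, u) \<in> triangle T" "(u, t) \<in> triangle T" using sut by (auto simp: triangle_def)
          have prod: "X s t w = tensor_prod (X s u) (X u t) w" "Y s t w = tensor_prod (Y s u) (Y u t) w"
          proof -
            have "\<forall>s u t. 0 \<le> s \<and> s \<le> u \<and> u \<le> t \<and> t \<le> T \<longrightarrow>
                (\<forall>n\<le>level p. \<forall>w\<in>words n. Z s t w = tensor_prod (Z s u) (Z u t) w)"
              if "rough_path T p \<omega> Z" for Z :: "real \<Rightarrow> real \<Rightarrow> 'v tensor"
              using that unfolding rough_path_def by blast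
            from this[OF X] this[OF Y]
            show "X s t w = tensor_prod (X s u) (X u t) w" "Y s t w = tensor_prod (Y s u) (Y u t) w"
              using sut w less.prems by simp_all
          qed
          have lw: "length w = n" using w by (rule length_words)
          have take: "take i w \<in> words i" "drop i w \<in> words (n - i)" if "i \<le> n" for i
            using that w set_take_subset[of i w] set_drop_subset[of i w] by (auto simp: words_def)
          have "?D s t = (\<Sum>i\<le>n. X s u (take i w) * X u t (drop i w) - Y s u (take i w) * Y u t (drop i w))"
            unfolding prod tensor_prod_def lw sum_subtractf ..
          also have "\<dots> = (\<Sum>i\<in>{0, n}. X s u (take i w) * X u t (drop i w) - Y s u (take i w) * Y u t (drop i w))"
          proof (rule sum.mono_neutral_right)
            show "\<forall>i\<in>{..n} - {0, n}. X s u (take i w) * X u t (drop i w) - Y s u (take i w) * Y u t (drop i w) = 0"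
            proof
              fix i assume i: "i \<in> {..n} - {0, n}"
              then have "i < n" "n - i < n" by auto
              then have IH: "\<forall>w\<in>words i. \<forall>(s, t)\<in>triangle T. X s t w = Y s t w"
                "\<forall>w\<in>words (n - i). \<forall>(s, t)\<in>triangle T. X s t w = Y s t w"
                using less.IH[of i] less.IH[of "n - i"] less.prems by simp_all
              have "i \<le> n" using \<open>i < n\<close> by simp
              have "X s u (take i w) = Y s u (take i w)" "X u t (drop i w) = Y u t (drop i w)"
                using bspec[OF bspec[OF IH(1) take(1)[OF \<open>i \<le> n\<close>]] tri(1)]
                  bspec[OF bspec[OF IH(2) take(2)[OF \<open>i \<le> n\<close>]] tri(2)] by simp_all
              then show "X s u (take i w) * X u t (drop i w) - Y s u (take i w) * Y u t (drop i w) = 0" by simp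
            qed
          qed auto
          also have "\<dots> = ?D s u + ?D u t"
            using False tri lw by (simp add: rough_path_Nil[OF X] rough_path_Nil[OF Y])
          finally show ?thesis .
        qed
        have "w \<in> wordsle (level p)" using w less.prems by (auto simp: wordsle_def words_def)
        from near[OF this] have "near (Suc (level p)) ?D (\<lambda>s t. 0)" unfolding near_iff[of _ "\<lambda>s t. X s t w"] .
        \<comment> \<open>Additivity makes \<open>?D s t\<close> the increment of the path
          \<open>?D 0\<close>.\<close>
        then have "near (Suc (level p)) (\<lambda>s t. ?D s t + ?D 0 s) (\<lambda>s t. 0 + ?D 0 s)" by (intro near_add near_refl)
        then have "near (Suc (level p)) (\<lambda>s t. ?D 0 t) (\<lambda>s t. ?D 0 s)"
        proof (rule near_eqI)
          fix s t assume "(s, t) \<in> triangle T"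
          then show "?D 0 t = ?D s t + ?D 0 s" using chen[of 0 s t] by (simp add: triangle_def)
        qed simp
        then have const: "?D 0 t = ?D 0 0" if "t \<in> {0..T}" for t
          using small_increments_imp_constant[of "\<lambda>t. ?D 0 t"] that by blast
        have "?D 0 s = ?D 0 0" "?D 0 t = ?D 0 0" using st by (auto intro!: const simp: triangle_def)
        moreover have "?D 0 t = ?D 0 s + ?D s t" using st by (intro chen) (auto simp: triangle_def)
        ultimately show ?thesis by simp
      qed
    qed
  qed
  then show ?thesis unfolding rough_path_eq_def by blast
qed

end

section \<open>Equality of the controlled integrals and of their lifts\<close>

theorem theorem2p21:
  fixes T p :: real
    and \<omega> :: "real \<Rightarrow> real \<Rightarrow> real"
    and X :: "real \<Rightarrow> real \<Rightarrow> 'v::fin_dim_normed_vector tensor"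
    and H :: "real \<Rightarrow> 'v list \<Rightarrow> 'v \<Rightarrow>\<^sub>L 'w::fin_dim_normed_vector"
    and I :: "real \<Rightarrow> 'w"
    and II :: "real \<Rightarrow> real \<Rightarrow> 'w tensor"
    and K :: "real \<Rightarrow> 'w list \<Rightarrow> 'w \<Rightarrow>\<^sub>L 'u::fin_dim_normed_vector"
    and J L :: "real \<Rightarrow> 'u"
  assumes "0 < T" and "1 \<le> p" and "control T \<omega>"
    and "rough_path T p \<omega> X"
    and "controlled_path T p \<omega> X H"
    and "is_rough_integral T p \<omega> X H I"
    and "is_lift T p \<omega> X (controlled_integral H I) II"
    and "controlled_path T p \<omega> II K"
    and "is_rough_integral T p \<omega> II K J"
    and "is_rough_integral T p \<omega> X (leibniz (star K (controlled_integral H I)) H) L"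
  shows "controlled_path T p \<omega> X
           (star (controlled_integral K J) (controlled_integral H I)) \<and>
         controlled_path T p \<omega> X
           (controlled_integral (leibniz (star K (controlled_integral H I)) H) L) \<and>
         controlled_path_eq T p
           (star (controlled_integral K J) (controlled_integral H I))
           (controlled_integral (leibniz (star K (controlled_integral H I)) H) L) \<and>
         (\<forall>JJ LL. is_lift T p \<omega> II (controlled_integral K J) JJ \<longrightarrow>
            is_lift T p \<omega> X
              (controlled_integral (leibniz (star K (controlled_integral H I)) H) L) LL \<longrightarrow>
            rough_path_eq T p JJ LL)"
proof -
  interpret control_on T p \<omega> by unfold_locales fact+
  note X = assms(4) and H = assms(5) and I = assms(6) and II = assms(7) and K = assms(8)
    and J = assms(9) and L = assms(10)
  let ?N = "level p"
  let ?I = "controlled_integral H I" and ?J = "controlled_integral K J"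
  let ?L = "controlled_integral (leibniz (star K ?I) H) L"
  note rII = is_lift_rough_path[OF II]
  have bI: "bdd (\<lambda>s t. ?I s w)" if "w \<in> wordsle ?N" for w
    by (rule bdd_controlled_integral[OF H I that])
  have bJ: "bdd (\<lambda>s t. ?J s w)" if "w \<in> wordsle ?N" for w
    by (rule bdd_controlled_integral[OF K J that])
  \<comment> \<open>The full degree \<open>?N\<close> is available because \<open>?I\<close> is an
    integral: its trace is expanded one degree further than that of a general controlled
    path.\<close>
  have lift: "near (Suc ?N) (\<lambda>s t. II s t y)
      (\<lambda>s t. tensor_sum (X s t) ?N (\<lambda>w. \<Sum>bs\<leftarrow>parts w. pure_tensor (map (?I s) bs) y))"
    if "y \<in> wordsle ?N" for y
    by (rule is_lift_near[OF X II order_refl bI _ that])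
      (use rough_integral_near[OF X I] in \<open>auto simp: wordsle_def\<close>)
  have star_eq: "star ?J ?I t w = ?L t w" if "w \<in> wordsle ?N" "w \<noteq> []" for t w
  proof -
    have "w \<in> words (length w)" using that(1) by (simp add: wordsle_def words_def)
    from star_controlled_integral[OF this that(2)] show ?thesis
      using that(2) by (simp add: controlled_integral_def)
  qed
  have star_Nil: "star ?J ?I t [] = J t" for t by (simp add: star_def)

  \<comment> \<open>The expansions of \<open>J\<close> and \<open>L\<close> along \<open>X\<close>
    have the same terms of positive degree. Hence \<open>J - L\<close> has increments of order
    \<open>Suc ?N\<close> and is constant, and both paths start at zero.\<close>
  have JL: "J t = L t" if t: "t \<in> {0..T}" for t
  proof -
    have "near (Suc ?N) (\<lambda>s t. J t) (\<lambda>s t. tensor_sum (II s t) ?N (?J s))"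
      by (rule rough_integral_near[OF rII J])
    also have "near (Suc ?N) \<dots> (\<lambda>s t. tensor_sum (X s t) ?N (\<lambda>w. \<Sum>bs\<leftarrow>parts w. multilin (?J s) (map (?I s) bs)))"
      by (rule tensor_sum_lift[OF X order_refl lift bJ])
    finally have nJ: "near (Suc ?N) (\<lambda>s t. J t) (\<lambda>s t. tensor_sum (X s t) ?N (\<lambda>w. \<Sum>bs\<leftarrow>parts w. multilin (?J s) (map (?I s) bs)))" .
    have nL: "near (Suc ?N) (\<lambda>s t. L t) (\<lambda>s t. tensor_sum (X s t) ?N (?L s))"
      by (rule rough_integral_near[OF X L])
    have "near (Suc ?N) (\<lambda>s t. J t + - 1 *\<^sub>R L t) (\<lambda>s t. tensor_sum (X s t) ?N (\<lambda>w. \<Sum>bs\<leftarrow>parts w. multilin (?J s) (map (?I s) bs))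
        + - 1 *\<^sub>R tensor_sum (X s t) ?N (?L s))"
      by (intro near_add nJ near_bounded_linear[OF bounded_linear_scaleR_right] nL)
    then have "near (Suc ?N) (\<lambda>s t. J t - L t) (\<lambda>s t. J s - L s)"
    proof (rule near_eqI)
      fix s t assume st: "(s, t) \<in> triangle T"
      have "tensor_sum (X s t) ?N (\<lambda>w. \<Sum>bs\<leftarrow>parts w. multilin (?J s) (map (?I s) bs)) =
          tensor_sum (X s t) ?N (star ?J ?I s)"
        by (rule tensor_sum_cong) (rule star_eq_parts'[symmetric])
      also have "\<dots> = J s + (\<Sum>w\<in>wordsle ?N - {[]}. X s t w *\<^sub>R ?L s w)"
        unfolding tensor_sum_split_Nil star_Nil by (simp add: rough_path_Nil[OF X st] star_eq)
      finally show "J s - L s = tensor_sum (X s t) ?N (\<lambda>w. \<Sum>bs\<leftarrow>parts w. multilin (?J s) (map (?I s) bs))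
          + - 1 *\<^sub>R tensor_sum (X s t) ?N (?L s)"
        unfolding tensor_sum_split_Nil[of _ _ "?L s"] by (simp add: rough_path_Nil[OF X st])
    qed simp
    from small_increments_imp_constant[OF this t] have "J t - L t = J 0 - L 0" .
    then show ?thesis using J L by (simp add: is_rough_integral_def)
  qed
  have eq: "star ?J ?I t w = ?L t w" if "t \<in> {0..T}" "w \<in> wordsle ?N" for t w
    using star_eq[OF that(2)] star_Nil JL[OF that(1)] by (cases "w = []") simp_all
  have controlled: "controlled_path T p \<omega> X (star ?J ?I)"
    by (intro star_controlled[OF X _ II] controlled_integral_controlled X rII H I K J)
  moreover have "controlled_path T p \<omega> X ?L"
    \<comment> \<open>The equality of the two paths on \<open>{0..T}\<close> transfers control from
      \<open>star ?J ?I\<close>.\<close>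
    by (rule controlled_path_cong[OF _ controlled]) (rule eq, auto simp: wordsle_def)
  moreover have "controlled_path_eq T p (star ?J ?I) ?L"
    unfolding controlled_path_eq_def using eq by (auto simp: words_def wordsle_def)
  moreover have "rough_path_eq T p JJ LL"
    if JJ: "is_lift T p \<omega> II ?J JJ" and LL: "is_lift T p \<omega> X ?L LL" for JJ LL
  proof (rule rough_path_unique[OF is_lift_rough_path[OF JJ] is_lift_rough_path[OF LL]])
    fix z :: "'u list" assume z: "z \<in> wordsle ?N"
    have zw: "z \<in> words (length z)" using z by (simp add: wordsle_def words_def)
    \<comment> \<open>The coordinate \<open>z\<close> of the expansion of \<open>JJ\<close>, as a
      linear map on tensors over the intermediate space. The second time is a dummy, present to fit
      \<open>tensor_sum_lift\<close>.\<close>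
    define G where "G = (\<lambda>(s :: real) (t :: real) y. \<Sum>bs\<leftarrow>parts y. pure_tensor (map (?J s) bs) z)"
    have bL: "bdd (\<lambda>s t. ?L s w)" if w: "w \<in> wordsle (?N - 1)" for w
      using controlled_path_bdd(1)[OF \<open>controlled_path T p \<omega> X ?L\<close> w] .
    have "near (Suc ?N) (\<lambda>s t. JJ s t z) (\<lambda>s t. tensor_sum (II s t) ?N (G s t))"
      unfolding G_def
      by (rule is_lift_near[OF rII JJ order_refl bJ _ z])
        (use rough_integral_near[OF rII J] in \<open>auto simp: wordsle_def\<close>)
    also have "near (Suc ?N) \<dots> (\<lambda>s t. tensor_sum (X s t) ?N (\<lambda>w. \<Sum>bs\<leftarrow>parts w. multilin (G s t) (map (?I s) bs)))"
    proof (rule tensor_sum_lift[OF X order_refl lift])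
      fix y :: "'w list" assume y: "y \<in> wordsle ?N"
      show "bdd (\<lambda>s t. G s t y)"
        unfolding G_def by (intro bdd_sum_list bdd_pure_tensor bJ) (rule parts_wordsle(2)[OF _ y])
    qed
    also have "(\<lambda>s t. tensor_sum (X s t) ?N (\<lambda>w. \<Sum>bs\<leftarrow>parts w. multilin (G s t) (map (?I s) bs))) =
        (\<lambda>s t. tensor_sum (X s t) ?N (\<lambda>w. \<Sum>bs\<leftarrow>parts w. pure_tensor (map (?L s) bs) z))"
    proof (intro ext tensor_sum_cong)
      fix s t and w :: "'v list" assume w: "w \<in> wordsle ?N"
      \<comment> \<open>First partition \<open>w\<close> into blocks \<open>cs\<close>, then
        partition the list \<open>cs\<close>. The values of \<open>?I\<close> on blocks are not
        basis vectors, so \<open>multilin_parts\<close> moves the inner partition outside the basis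
        expansion.\<close>
      have "(\<Sum>cs\<leftarrow>parts w. multilin (G s t) (map (?I s) cs)) =
          (\<Sum>cs\<leftarrow>parts w. \<Sum>ds\<leftarrow>parts cs. pure_tensor (map (\<lambda>d. multilin (?J s) (map (?I s) d)) ds) z)"
        unfolding G_def pure_tensor_eq_multilin[OF zw] multilin_parts parts_map by (simp add: o_def)
      also have "\<dots> = (\<Sum>bs\<leftarrow>parts w. pure_tensor (map (\<lambda>b. \<Sum>d\<leftarrow>parts b. multilin (?J s) (map (?I s) d)) bs) z)"
        unfolding sum_parts_parts pure_tensor_eq_multilin[OF zw] sum_parts_product_multilin ..
      also have "\<dots> = (\<Sum>bs\<leftarrow>parts w. pure_tensor (map (?L s) bs) z)"
      proof (intro sum_list_cong arg_cong[of _ _ "\<lambda>us. pure_tensor us z"] map_cong refl)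
        fix bs b assume bs: "bs \<in> set (parts w)" "b \<in> set bs"
        \<comment> \<open>A partition with a single block has a block as long as \<open>w\<close>,
          so the identity with \<open>?L\<close> is used up to degree \<open>?N\<close>, beyond the
          degrees compared by \<open>controlled_path_eq\<close>.\<close>
        have b: "b \<in> wordsle ?N" by (rule parts_wordsle(2)[OF bs(1) w bs(2)])
        have "b \<noteq> []" using partsD(2)[OF bs(1)] bs(2) by blast
        from star_eq[OF b this] show "(\<Sum>d\<leftarrow>parts b. multilin (?J s) (map (?I s) d)) = ?L s b"
          by (simp add: star_eq_parts'[OF b])
      qed
      finally show "(\<Sum>cs\<leftarrow>parts w. multilin (G s t) (map (?I s) cs)) = (\<Sum>bs\<leftarrow>parts w. pure_tensor (map (?L s) bs) z)" .
    qed
    also have "near (Suc ?N) \<dots> (\<lambda>s t. LL s t z)"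
      by (rule near_sym, rule is_lift_near[OF X LL order_refl bL _ z])
        (use rough_integral_near[OF X L] in simp_all)
    finally show "near (Suc ?N) (\<lambda>s t. JJ s t z) (\<lambda>s t. LL s t z)" .
  qed
  ultimately show ?thesis by blast
qed

end
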